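(* Let $a<b$ be real numbers, $\Omega=(a,b)\subset\mathbb{R}$, and let $U\in H^{-1}_{\overline\Omega}$. Let $Q_{-1}:H^{-1}(\mathbb{R})\to(H^{-1}_{\Omega^c})^\perp$ be the orthogonal projection, so that $Q_{-1}U$ is the extension of $U|_\Omega$ to $\mathbb{R}$ with minimal $H^{-1}(\mathbb{R})$ norm. Then $$Q_{-1}U=U+c_a\delta_a+c_b\delta_b,$$ where $$c_a=\frac{(U,\delta_b)_{H^{-1}(\mathbb{R})}-e^{b-a}(U,\delta_a)_{H^{-1}(\mathbb{R})}}{\sinh(b-a)},\qquad c_b=\frac{(U,\delta_a)_{H^{-1}(\mathbb{R})}-e^{b-a}(U,\delta_b)_{H^{-1}(\mathbb{R})}}{\sinh(b-a)}.$$
   Context: $\mathscr{S}^*(\mathbb{R})$ is the space of tempered distributions (anti-linear continuous functionals on the Schwartz space $\mathscr{S}(\mathbb{R})$). The Fourier transform is $\hat u(\xi)=(2\pi)^{-1/2}\int_{\mathbb{R}}e^{-i\xi x}u(x)\,dx$, extended to $\mathscr{S}^*(\mathbb{R})$. $H^{-1}(\mathbb{R})$ is the Hilbert space of $u\in\mathscr{S}^*(\mathbb{R})$ with $\|u\|^2_{H^{-1}(\mathbb{R})}=\int_{\mathbb{R}}(1+\xi^2)^{-1}|\hat u(\xi)|^2\,d\xi<\infty$, with inner product $(u,v)_{H^{-1}(\mathbb{R})}=\int_{\mathbb{R}}(1+\xi^2)^{-1}\hat u(\xi)\overline{\hat v(\xi)}\,d\xi$. For closed $F\subset\mathbb{R}$,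 $H^{-1}_F=\{u\in H^{-1}(\mathbb{R}):\operatorname{supp}u\subset F\}$; $\Omega^c=\mathbb{R}\setminus\Omega$, and $(H^{-1}_{\Omega^c})^\perp$ is the orthogonal complement in $H^{-1}(\mathbb{R})$. $U|_\Omega$ denotes the restriction of the distribution $U$ to $\Omega$; an extension of $u\in\mathscr{D}^*(\Omega)$ (a distribution on $\Omega$) is a distribution on $\mathbb{R}$ whose restriction to $\Omega$ is $u$. $\delta_x$ is the Dirac delta centred at $x\in\mathbb{R}$, acting (in the anti-linear convention) by $\delta_x(\phi)=\overline{\phi(x)}$ for $\phi\in\mathscr{S}(\mathbb{R})$. *)

theory Defs
  imports "HOL-Analysis.Analysis"
begin

section \<open>Test functions\<close>

definition Dn :: "nat \<Rightarrow> (real \<Rightarrow> complex) \<Rightarrow> real \<Rightarrow> complex" where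
  "Dn n = ((\<lambda>f x. vector_derivative f (at x)) ^^ n)"

definition smooth :: "(real \<Rightarrow> complex) \<Rightarrow> bool" where
  "smooth f \<longleftrightarrow> (\<forall>n x. Dn n f differentiable (at x))"

definition schwartz :: "(real \<Rightarrow> complex) set" where
  "schwartz = {f. smooth f \<and> (\<forall>m n. bounded (range (\<lambda>x. of_real (x ^ m) * Dn n f x)))}"

definition schwartz_seminorm :: "nat \<Rightarrow> nat \<Rightarrow> (real \<Rightarrow> complex) \<Rightarrow> real" where
  "schwartz_seminorm m n f = (SUP x. norm (of_real (x ^ m) * Dn n f x))"

definition schwartz_topology :: "(real \<Rightarrow> complex) topology" where
  "schwartz_topology = topology_generated_by
     {{g \<in> schwartz. schwartz_seminorm m n (\<lambda>x. g x - f x) < e} | f m n e. f \<in> schwartz \<and> 0 < e}"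

definition test_functions :: "real set \<Rightarrow> (real \<Rightarrow> complex) set" where
  "test_functions \<Omega> =
     {f. smooth f \<and> compact (closure {x. f x \<noteq> 0}) \<and> closure {x. f x \<noteq> 0} \<subseteq> \<Omega>}"

section \<open>Tempered distributions\<close>

text \<open>Functionals on the Schwartz space are represented by total functions that vanish off
  \<^const>\<open>schwartz\<close>, so that equality, sums and scalar multiples of functionals are the
  pointwise ones. They are anti-linear.\<close>

definition tempered :: "((real \<Rightarrow> complex) \<Rightarrow> complex) set" where
  "tempered = {u.
     (\<forall>f. f \<notin> schwartz \<longrightarrow> u f = 0) \<and>
     (\<forall>f\<in>schwartz. \<forall>g\<in>schwartz. u (\<lambda>x. f x + g x) = u f + u g) \<and>
     (\<forall>c. \<forall>f\<in>schwartz. u (\<lambda>x. c * f x) = cnj c * u f) \<and>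
     continuous_map schwartz_topology euclidean u}"

definition dirac :: "real \<Rightarrow> (real \<Rightarrow> complex) \<Rightarrow> complex" where
  "dirac x f = (if f \<in> schwartz then cnj (f x) else 0)"

definition restrict_dist ::
    "real set \<Rightarrow> ((real \<Rightarrow> complex) \<Rightarrow> complex) \<Rightarrow> (real \<Rightarrow> complex) \<Rightarrow> complex" where
  "restrict_dist \<Omega> u f = (if f \<in> test_functions \<Omega> then u f else 0)"

definition supp :: "((real \<Rightarrow> complex) \<Rightarrow> complex) \<Rightarrow> real set" where
  "supp u = - \<Union>{V. open V \<and> (\<forall>f\<in>test_functions V. u f = 0)}"

section \<open>The Fourier transform\<close>

definition inv_fourier :: "(real \<Rightarrow> complex) \<Rightarrow> real \<Rightarrow> complex" where
  "inv_fourier f x =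
     of_real (1 / sqrt (2 * pi)) * (LINT \<xi>|lborel. exp (\<i> * of_real (\<xi> * x)) * f \<xi>)"

text \<open>With the anti-linear convention, a function \<open>u\<close> acts by
  \<open>f \<mapsto> \<integral> u * cnj f\<close>, and Parseval's identity shows that the extension of
  \<open>u \<mapsto> (2 * pi) powr (-1/2) * \<integral> exp (- \<i> * \<xi> * x) * u x dx\<close> from functions to tempered
  distributions is the transpose of the inverse transform.\<close>

definition fourier_dist ::
    "((real \<Rightarrow> complex) \<Rightarrow> complex) \<Rightarrow> (real \<Rightarrow> complex) \<Rightarrow> complex" where
  "fourier_dist u f = (if f \<in> schwartz then u (inv_fourier f) else 0)"

definition represents :: "(real \<Rightarrow> complex) \<Rightarrow> ((real \<Rightarrow> complex) \<Rightarrow> complex) \<Rightarrow> bool" where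
  "represents g u \<longleftrightarrow> g \<in> borel_measurable borel \<and>
     (\<forall>f\<in>schwartz. integrable lborel (\<lambda>\<xi>. g \<xi> * cnj (f \<xi>)) \<and>
                   u f = (LINT \<xi>|lborel. g \<xi> * cnj (f \<xi>)))"

text \<open>The function representing the Fourier transform is unique up to null sets, so the choice
  below does not affect the integrals defining norm and inner product.\<close>

definition fhat :: "((real \<Rightarrow> complex) \<Rightarrow> complex) \<Rightarrow> real \<Rightarrow> complex" where
  "fhat u = (SOME g. represents g (fourier_dist u))"

section \<open>The space \<open>H\<close> of order \<open>-1\<close>\<close>

definition Hm1 :: "((real \<Rightarrow> complex) \<Rightarrow> complex) set" where
  "Hm1 = {u \<in> tempered. \<exists>g. represents g (fourier_dist u) \<and>
            integrable lborel (\<lambda>\<xi>. inverse (1 + \<xi>\<^sup>2) * (norm (g \<xi>))\<^sup>2)}"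

definition Hm1_norm :: "((real \<Rightarrow> complex) \<Rightarrow> complex) \<Rightarrow> real" where
  "Hm1_norm u = sqrt (LINT \<xi>|lborel. inverse (1 + \<xi>\<^sup>2) * (norm (fhat u \<xi>))\<^sup>2)"

definition Hm1_inner ::
    "((real \<Rightarrow> complex) \<Rightarrow> complex) \<Rightarrow> ((real \<Rightarrow> complex) \<Rightarrow> complex) \<Rightarrow> complex" where
  "Hm1_inner u v =
     (LINT \<xi>|lborel. of_real (inverse (1 + \<xi>\<^sup>2)) * fhat u \<xi> * cnj (fhat v \<xi>))"

definition Hm1_supp :: "real set \<Rightarrow> ((real \<Rightarrow> complex) \<Rightarrow> complex) set" where
  "Hm1_supp F = {u \<in> Hm1. supp u \<subseteq> F}"

definition Hm1_orth ::
    "((real \<Rightarrow> complex) \<Rightarrow> complex) set \<Rightarrow> ((real \<Rightarrow> complex) \<Rightarrow> complex) set" where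
  "Hm1_orth M = {u \<in> Hm1. \<forall>v\<in>M. Hm1_inner u v = 0}"

definition is_orth_proj ::
    "((real \<Rightarrow> complex) \<Rightarrow> complex) set \<Rightarrow>
     ((real \<Rightarrow> complex) \<Rightarrow> complex) \<Rightarrow> ((real \<Rightarrow> complex) \<Rightarrow> complex) \<Rightarrow> bool" where
  "is_orth_proj N u v \<longleftrightarrow> v \<in> N \<and> (\<forall>w\<in>N. Hm1_inner (\<lambda>f. u f - v f) w = 0)"

definition Qm1 ::
    "real set \<Rightarrow> ((real \<Rightarrow> complex) \<Rightarrow> complex) \<Rightarrow> (real \<Rightarrow> complex) \<Rightarrow> complex" where
  "Qm1 \<Omega> u = (THE v. is_orth_proj (Hm1_orth (Hm1_supp (- \<Omega>))) u v)"

definition is_min_norm_extension ::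
    "real set \<Rightarrow> ((real \<Rightarrow> complex) \<Rightarrow> complex) \<Rightarrow> ((real \<Rightarrow> complex) \<Rightarrow> complex) \<Rightarrow> bool" where
  "is_min_norm_extension \<Omega> u v \<longleftrightarrow>
     v \<in> Hm1 \<and> restrict_dist \<Omega> v = u \<and>
     (\<forall>w\<in>Hm1. restrict_dist \<Omega> w = u \<and> w \<noteq> v \<longrightarrow> Hm1_norm v < Hm1_norm w)"

end

(* With v(x) = (V, delta_x), the function v is the solution of v - v'' = V, and the constants c_a, c_b
   are exactly those for which V = U + c_a delta_a + c_b delta_b satisfies v(a) = v(b) = 0. If a
   functional W vanishes on an interval (p, q), then W is orthogonal to every functional whose
   potential vanishes off (p, q), because such a potential is a weak H^1 limit of test functions on
   (p, q): dilate about the midpoint, then mollify. Applied to delta_x and the deltas at the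
   endpoints, this gives
     sinh(q - p) w(x) = sinh(q - x) w(p) + sinh(x - p) w(q)   for w(x) = (W, delta_x),
   so v, being bounded and zero at a and b, vanishes off (a, b) (let the other endpoint tend to
   infinity). Applied to V itself, it gives that V is orthogonal to everything supported off
   (a, b). *)

theory Submission
  imports Defs "HOL-Probability.Characteristic_Functions" "HOL-Probability.Sinc_Integral"
begin

section \<open>Smooth functions\<close>

text \<open>Everything is done on the Fourier side. An H^1 function is handled as
  \<open>ft g\<close> with (1 + xi^2) |g|^2 integrable, and multiplication by 1 / (1 + xi^2) carries
  H^{-1} to H^1, turning the inner product into the pairing of \<open>fhat W\<close> with
  \<open>g\<close>. The obstacle is that a functional is known on an interval only through test
  functions, whereas the potentials to be paired with it merely vanish off the open interval and
  need not be smooth at its endpoints. The dilation precedes the mollification because the support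
  must be pulled away from the endpoints to leave room for smoothing. The potential of
  \<open>dirac x\<close> is exp (- |y - x|) / 2, so v(a) = v(b) = 0 is a linear system for c_a and
  c_b with matrix entries 1/2 and exp (- (b - a)) / 2; its determinant puts sinh (b - a) into the
  denominators. Orthogonality to everything supported off (a, b) places V in the range of the
  projection, while U - V is a combination of two deltas that are themselves supported off (a, b);
  uniqueness of projections then identifies \<open>Qm1\<close> with V.\<close>

definition deriv_closed :: "(real \<Rightarrow> complex) set \<Rightarrow> bool" where
  "deriv_closed T \<longleftrightarrow> (\<forall>f\<in>T. \<exists>f'\<in>T. \<forall>x. (f has_vector_derivative f' x) (at x))"

lemma deriv_closedI:
  assumes "\<And>f. f \<in> T \<Longrightarrow> \<exists>f'. f' \<in> T \<and> (\<forall>x. (f has_vector_derivative f' x) (at x))"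
  shows "deriv_closed T"
  using assms unfolding deriv_closed_def by blast

lemma Dn_0 [simp]: "Dn 0 f = f"
  by (simp add: Dn_def)

lemma Dn_Suc: "Dn (Suc n) f = (\<lambda>x. vector_derivative (Dn n f) (at x))"
  by (simp add: Dn_def)

lemma Dn_add: "Dn m (Dn n f) = Dn (m + n) f"
  by (simp add: Dn_def funpow_add)

lemma deriv_closed_Dn:
  assumes T: "deriv_closed T" and f: "f \<in> T"
  shows "Dn n f \<in> T"
proof (induction n)
  case (Suc n)
  then obtain f' where "f' \<in> T" "\<And>x. (Dn n f has_vector_derivative f' x) (at x)"
    using T unfolding deriv_closed_def by blast
  then show ?case
    by (metis Dn_Suc ext vector_derivative_at)
qed (use f in simp)

text \<open>\<open>smooth\<close> speaks about all iterates \<open>Dn n f\<close>. By induction they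
  stay inside \<open>T\<close>, so a set that contains a derivative of each of its members certifies
  smoothness without any formula for higher derivatives; most smoothness proofs below only choose a
  suitable \<open>T\<close>.\<close>

lemma deriv_closed_smooth:
  assumes T: "deriv_closed T" and f: "f \<in> T"
  shows "smooth f"
  unfolding smooth_def
proof (intro allI)
  fix n x
  have "Dn n f \<in> T"
    using assms by (rule deriv_closed_Dn)
  then show "Dn n f differentiable at x"
    using T unfolding deriv_closed_def
    by (metis differentiableI_vector)
qed

lemma smooth_Dn: "smooth f \<Longrightarrow> smooth (Dn n f)"
  by (simp add: smooth_def Dn_add)

lemma smooth_has_vector_derivative:
  assumes "smooth f"
  shows "(f has_vector_derivative Dn (Suc 0) f x) (at x)"
proof -
  have "f differentiable at x"
    using assms unfolding smooth_def by (metis Dn_0)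
  then show ?thesis
    by (simp add: Dn_def vector_derivative_works)
qed

lemma deriv_closed_smooth_set: "deriv_closed {f. smooth f}"
  by (rule deriv_closedI, rule exI[of _ "Dn (Suc 0) f" for f]) (auto intro: smooth_Dn smooth_has_vector_derivative)

lemma smooth_isCont: "smooth f \<Longrightarrow> isCont f x"
  using smooth_has_vector_derivative has_vector_derivative_continuous by blast

lemma smooth_continuous_on: "smooth f \<Longrightarrow> continuous_on S f"
  by (simp add: smooth_isCont continuous_at_imp_continuous_on)

lemma smooth_measurable [measurable (raw)]: "smooth f \<Longrightarrow> f \<in> borel_measurable borel"
  by (simp add: borel_measurable_continuous_onI smooth_continuous_on)

text \<open>Leibniz' rule keeps finite sums of products inside the span of products, so closure under
  differentiation can be checked without computing higher derivatives.\<close>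

inductive_set sumprods :: "(real \<Rightarrow> complex) set \<Rightarrow> (real \<Rightarrow> complex) set \<Rightarrow> (real \<Rightarrow> complex) set"
  for A B where
  mult: "f \<in> A \<Longrightarrow> g \<in> B \<Longrightarrow> (\<lambda>x. f x * g x) \<in> sumprods A B"
| add: "f \<in> sumprods A B \<Longrightarrow> g \<in> sumprods A B \<Longrightarrow> (\<lambda>x. f x + g x) \<in> sumprods A B"

lemma deriv_closed_sumprods:
  assumes A: "deriv_closed A" and B: "deriv_closed B"
  shows "deriv_closed (sumprods A B)"
proof (rule deriv_closedI)
  fix f assume "f \<in> sumprods A B"
  then show "\<exists>f'. f' \<in> sumprods A B \<and> (\<forall>x. (f has_vector_derivative f' x) (at x))"
  proof induction
    case (mult f g)
    obtain f' g' where d: "f' \<in> A" "g' \<in> B" "\<And>x. (f has_vector_derivative f' x) (at x)"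
       "\<And>x. (g has_vector_derivative g' x) (at x)"
      using mult A B unfolding deriv_closed_def by meson
    show ?case
    proof (intro exI conjI allI)
      show "(\<lambda>x. f x * g' x + f' x * g x) \<in> sumprods A B"
        using d mult by (intro sumprods.intros)
      show "((\<lambda>x. f x * g x) has_vector_derivative f x * g' x + f' x * g x) (at x)" for x
        using d by (intro has_vector_derivative_mult)
    qed
  next
    case (add f g)
    then obtain f' g' where d: "f' \<in> sumprods A B" "g' \<in> sumprods A B"
      "\<And>x. (f has_vector_derivative f' x) (at x)" "\<And>x. (g has_vector_derivative g' x) (at x)"
      by blast
    show ?case
      using d by (intro exI[of _ "\<lambda>x. f' x + g' x"])
        (auto intro!: sumprods.intros has_vector_derivative_add)
  qed
qed

lemma smooth_mult:
  assumes "smooth f" "smooth g"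
  shows "smooth (\<lambda>x. f x * g x)"
  by (rule deriv_closed_smooth[OF deriv_closed_sumprods[OF deriv_closed_smooth_set deriv_closed_smooth_set]])
     (use assms in \<open>auto intro: sumprods.mult\<close>)

lemma smooth_add:
  assumes "smooth f" "smooth g"
  shows "smooth (\<lambda>x. f x + g x)"
proof (rule deriv_closed_smooth)
  show "deriv_closed {h. \<exists>f g. smooth f \<and> smooth g \<and> h = (\<lambda>x. f x + g x)}"
  proof (rule deriv_closedI)
    fix h assume "h \<in> {h. \<exists>f g. smooth f \<and> smooth g \<and> h = (\<lambda>x. f x + g x)}"
    then obtain f g where fg: "smooth f" "smooth g" "h = (\<lambda>x. f x + g x)" by auto
    then show "\<exists>h'. h' \<in> {h. \<exists>f g. smooth f \<and> smooth g \<and> h = (\<lambda>x. f x + g x)}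
        \<and> (\<forall>x. (h has_vector_derivative h' x) (at x))"
      by (intro exI[of _ "\<lambda>x. Dn (Suc 0) f x + Dn (Suc 0) g x"])
        (auto intro!: smooth_Dn smooth_has_vector_derivative has_vector_derivative_add)
  qed
qed (use assms in auto)

lemma deriv_closed_consts: "deriv_closed (range (\<lambda>c x. c))"
  by (rule deriv_closedI) (auto intro!: exI[of _ 0] has_vector_derivative_const)

lemma smooth_const: "smooth (\<lambda>x. c)"
  by (rule deriv_closed_smooth[OF deriv_closed_consts]) auto

lemma smooth_cmult: "smooth f \<Longrightarrow> smooth (\<lambda>x. c * f x)"
  by (intro smooth_mult smooth_const)

lemma smooth_diff: "smooth f \<Longrightarrow> smooth g \<Longrightarrow> smooth (\<lambda>x. f x - g x)"
  using smooth_add[of f "\<lambda>x. (-1) * g x"] smooth_cmult[of g "-1"] by simp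

text \<open>The chain rule puts the factor \<open>c\<close> in front of the inner derivative, so
  \<open>T\<close> has to absorb scalar multiples.\<close>

lemma deriv_closed_affine:
  assumes "deriv_closed T" "\<And>f k. f \<in> T \<Longrightarrow> (\<lambda>x. k * f x) \<in> T"
  shows "deriv_closed ((\<lambda>f x. f (t + c * x)) ` T)"
proof (rule deriv_closedI)
  fix h assume "h \<in> (\<lambda>f x. f (t + c * x)) ` T"
  then obtain f where f: "f \<in> T" "h = (\<lambda>x. f (t + c * x))" by auto
  then obtain f' where f': "f' \<in> T" "\<And>x. (f has_vector_derivative f' x) (at x)"
    using assms unfolding deriv_closed_def by meson
  have "((f \<circ> (\<lambda>x. t + c * x)) has_vector_derivative c *\<^sub>R f' (t + c * x)) (at x)" for x
    by (rule vector_diff_chain_at) (auto intro!: derivative_eq_intros f')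
  then have "(h has_vector_derivative (of_real c * f' (t + c * x))) (at x)" for x
    using f by (simp add: o_def scaleR_conv_of_real)
  then show "\<exists>h'. h' \<in> (\<lambda>f x. f (t + c * x)) ` T \<and> (\<forall>x. (h has_vector_derivative h' x) (at x))"
    using assms(2)[OF f'(1), of "of_real c"] by (intro exI[of _ "\<lambda>x. of_real c * f' (t + c * x)"]) auto
qed

lemma smooth_affine:
  assumes "smooth f"
  shows "smooth (\<lambda>x. f (t + c * x))"
  by (rule deriv_closed_smooth[OF deriv_closed_affine[OF deriv_closed_smooth_set]])
     (use assms in \<open>auto intro: smooth_cmult\<close>)

section \<open>Schwartz functions\<close>

text \<open>All \<open>Dn n f\<close> lie in \<open>T\<close>, so decay of the undifferentiated
  members of \<open>T\<close> already bounds every Schwartz seminorm of \<open>f\<close>.\<close>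

lemma deriv_closed_schwartz:
  assumes T: "deriv_closed T" and f: "f \<in> T"
    and "\<And>f m. f \<in> T \<Longrightarrow> bounded (range (\<lambda>x. of_real (x ^ m) * f x))"
  shows "f \<in> schwartz"
  unfolding schwartz_def
  using deriv_closed_smooth[OF T f] deriv_closed_Dn[OF T f] assms(3) by blast

lemma schwartz_smooth: "f \<in> schwartz \<Longrightarrow> smooth f"
  by (simp add: schwartz_def)

lemma schwartz_bounded: "f \<in> schwartz \<Longrightarrow> bounded (range (\<lambda>x. of_real (x ^ m) * f x))"
  unfolding schwartz_def by (drule CollectD, drule conjunct2, drule spec[of _ m], drule spec[of _ 0]) simp

lemma schwartz_Dn: "f \<in> schwartz \<Longrightarrow> Dn n f \<in> schwartz"
  by (simp add: schwartz_def smooth_Dn Dn_add)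

lemma schwartz_measurable [measurable (raw)]: "f \<in> schwartz \<Longrightarrow> f \<in> borel_measurable borel"
  by (simp add: schwartz_smooth smooth_measurable)

lemma schwartz_has_vector_derivative:
  "f \<in> schwartz \<Longrightarrow> (f has_vector_derivative Dn (Suc 0) f x) (at x)"
  by (simp add: schwartz_smooth smooth_has_vector_derivative)

lemma deriv_closed_schwartz_set: "deriv_closed schwartz"
  by (rule deriv_closedI, rule exI[of _ "Dn (Suc 0) f" for f]) (auto intro: schwartz_Dn schwartz_has_vector_derivative)

lemma bounded_range_add:
  fixes f g :: "'a \<Rightarrow> complex"
  assumes "bounded (range f)" "bounded (range g)"
  shows "bounded (range (\<lambda>x. f x + g x))"
  using bounded_plus_comp[OF assms] .

lemma schwartz_add:
  assumes "f \<in> schwartz" "g \<in> schwartz"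
  shows "(\<lambda>x. f x + g x) \<in> schwartz"
proof (rule deriv_closed_schwartz)
  let ?T = "{h. \<exists>f g. f \<in> schwartz \<and> g \<in> schwartz \<and> h = (\<lambda>x. f x + g x)}"
  show "deriv_closed ?T"
  proof (rule deriv_closedI)
    fix h assume "h \<in> ?T"
    then obtain f g where fg: "f \<in> schwartz" "g \<in> schwartz" "h = (\<lambda>x. f x + g x)" by auto
    then show "\<exists>h'. h' \<in> ?T \<and> (\<forall>x. (h has_vector_derivative h' x) (at x))"
      by (intro exI[of _ "\<lambda>x. Dn (Suc 0) f x + Dn (Suc 0) g x"])
        (auto intro!: schwartz_Dn schwartz_has_vector_derivative has_vector_derivative_add)
  qed
  show "(\<lambda>x. f x + g x) \<in> ?T"
    using assms by auto
  show "bounded (range (\<lambda>x. of_real (x ^ m) * h x))" if "h \<in> ?T" for h m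
    using that bounded_range_add[OF schwartz_bounded schwartz_bounded]
    by (auto simp: distrib_left simp del: of_real_power)
qed

lemma deriv_closed_monoms: "deriv_closed {\<lambda>x. c * of_real (x ^ k) | c k. True}"
proof (rule deriv_closedI)
  fix f :: "real \<Rightarrow> complex" assume "f \<in> {\<lambda>x. c * of_real (x ^ k) | c k. True}"
  then obtain c k where f: "f = (\<lambda>x. c * of_real (x ^ k))" by auto
  have "((\<lambda>x. c * of_real (x ^ k)) has_vector_derivative c * of_real (of_nat k * x ^ (k - 1))) (at x)" for x
    by (intro has_vector_derivative_mult_right has_vector_derivative_of_real)
       (auto intro!: derivative_eq_intros)
  then have "(f has_vector_derivative (c * of_nat k) * of_real (x ^ (k - 1))) (at x)" for x
    unfolding f by (simp add: mult.assoc)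
  then show "\<exists>f'. f' \<in> {\<lambda>x. c * of_real (x ^ k) | c k. True} \<and>
      (\<forall>x. (f has_vector_derivative f' x) (at x))"
    by blast
qed

text \<open>By Leibniz' rule the derivatives stay among the sums of monomials times Schwartz
  functions, and there \<open>x ^ m\<close> merges with the monomial into a higher power. The case k
  = 1 serves the derivatives of transforms, k = 0 gives scalar multiples.\<close>

lemma schwartz_monom_mult:
  assumes "f \<in> schwartz"
  shows "(\<lambda>x. c * of_real (x ^ k) * f x) \<in> schwartz"
proof (rule deriv_closed_schwartz[OF deriv_closed_sumprods[OF deriv_closed_monoms deriv_closed_schwartz_set]])
  show "(\<lambda>x. c * of_real (x ^ k) * f x) \<in> sumprods {\<lambda>x. c * of_real (x ^ k) | c k. True} schwartz"
    by (rule sumprods.mult) (use assms in blast)+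
  fix h m assume "h \<in> sumprods {\<lambda>x. c * of_real (x ^ k) | c k. True} schwartz"
  then show "bounded (range (\<lambda>x. of_real (x ^ m) * h x))"
  proof induction
    case (mult f g)
    then obtain c k where f: "f = (\<lambda>x. c * of_real (x ^ k))" by auto
    have "bounded ((\<lambda>y. c * y) ` range (\<lambda>x. of_real (x ^ (m + k)) * g x))"
      using mult by (intro bounded_linear_image schwartz_bounded bounded_linear_mult_right)
    then show ?case
      by (simp add: f image_image power_add mult_ac)
  next
    case (add f g)
    then show ?case
      by (auto simp: distrib_left intro!: bounded_range_add)
  qed
qed

lemma schwartz_cmult: "f \<in> schwartz \<Longrightarrow> (\<lambda>x. c * f x) \<in> schwartz"
  using schwartz_monom_mult[of f c 0] by simp

lemma schwartz_diff: "f \<in> schwartz \<Longrightarrow> g \<in> schwartz \<Longrightarrow> (\<lambda>x. f x - g x) \<in> schwartz"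
  using schwartz_add[of f "\<lambda>x. (-1) * g x"] schwartz_cmult[of g "-1"] by simp

lemma schwartz_reflect:
  assumes "f \<in> schwartz"
  shows "(\<lambda>x. f (- x)) \<in> schwartz"
proof (rule deriv_closed_schwartz[OF deriv_closed_affine[OF deriv_closed_schwartz_set, of 0 "-1"]])
  show "(\<lambda>x. k * g x) \<in> schwartz" if "g \<in> schwartz" for g k
    using that by (rule schwartz_cmult)
  show "(\<lambda>x. f (- x)) \<in> (\<lambda>f x. f (0 + - 1 * x)) ` schwartz"
    using assms by auto
  fix h m assume "h \<in> (\<lambda>f x. f (0 + - 1 * x)) ` schwartz"
  then obtain g where g: "g \<in> schwartz" "h = (\<lambda>x. g (- x))" by auto
  have "bounded (uminus ` range (\<lambda>x. of_real (x ^ m) * g x)) " "bounded (range (\<lambda>x. of_real (x ^ m) * g x))"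
    using g by (auto intro: schwartz_bounded simp del: of_real_power)
  then obtain B where "\<And>x. norm (of_real (x ^ m) * g x) \<le> B"
    unfolding bounded_iff by auto
  then have "norm (of_real (x ^ m) * h x) \<le> B" for x
    unfolding g by (metis (no_types, opaque_lifting) abs_minus_cancel minus_minus norm_mult norm_of_real power_abs)
  then show "bounded (range (\<lambda>x. of_real (x ^ m) * h x))"
    unfolding bounded_iff by blast
qed

lemma schwartz_zero: "(\<lambda>x. 0) \<in> schwartz"
  by (rule deriv_closed_schwartz[of "{\<lambda>x. 0}"]) (auto intro!: deriv_closedI)

section \<open>Test functions\<close>

lemma vector_derivative_eq_0_if_locally_0:
  assumes "open V" "x \<in> V" "\<And>y. y \<in> V \<Longrightarrow> f y = 0" "(f has_vector_derivative d) (at x)"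
  shows "d = (0 :: complex)"
proof -
  have "((\<lambda>y. 0) has_vector_derivative d) (at x)"
    by (rule has_vector_derivative_transform_within_open[OF assms(4,1,2)]) (use assms in auto)
  then show ?thesis
    using has_vector_derivative_const vector_derivative_unique_at by blast
qed

text \<open>Any compact set outside of which \<open>f\<close> vanishes will do as a witness, so that
  the closure in the definition never has to be computed.\<close>

lemma test_functions_iff:
  "f \<in> test_functions S \<longleftrightarrow> smooth f \<and> (\<exists>K. compact K \<and> K \<subseteq> S \<and> (\<forall>x. x \<notin> K \<longrightarrow> f x = 0))"
proof safe
  assume "f \<in> test_functions S"
  then show "smooth f" "\<exists>K. compact K \<and> K \<subseteq> S \<and> (\<forall>x. x \<notin> K \<longrightarrow> f x = 0)"
    unfolding test_functions_def
    by (auto intro!: exI[of _ "closure {x. f x \<noteq> 0}"]) (metis (mono_tags) closure_subset mem_Collect_eq subsetD)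
next
  fix K assume K: "smooth f" "compact K" "K \<subseteq> S" "\<forall>x. x \<notin> K \<longrightarrow> f x = 0"
  then have "closure {x. f x \<noteq> 0} \<subseteq> K"
    by (intro closure_minimal) (auto intro: compact_imp_closed)
  with K show "f \<in> test_functions S"
    unfolding test_functions_def
    by (metis (mono_tags, lifting) bounded_subset closed_closure compact_eq_bounded_closed mem_Collect_eq subset_trans)
qed

lemma test_functionsI:
  assumes "smooth f" "compact K" "K \<subseteq> S" "\<And>x. x \<notin> K \<Longrightarrow> f x = 0"
  shows "f \<in> test_functions S"
  unfolding test_functions_iff using assms by blast

lemma test_functions_mono: "S \<subseteq> S' \<Longrightarrow> test_functions S \<subseteq> test_functions S'"
  by (auto simp: test_functions_def)

lemma test_functions_mult: "f \<in> test_functions S \<Longrightarrow> smooth g \<Longrightarrow> (\<lambda>x. f x * g x) \<in> test_functions S"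
  unfolding test_functions_iff using smooth_mult by auto

lemma deriv_closed_test_functions: "deriv_closed (test_functions S)"
proof (rule deriv_closedI)
  fix f assume "f \<in> test_functions S"
  then obtain K where f: "smooth f" "compact K" "K \<subseteq> S" "\<forall>x. x \<notin> K \<longrightarrow> f x = 0"
    unfolding test_functions_iff by auto
  have "Dn (Suc 0) f x = 0" if "x \<notin> K" for x
    by (rule vector_derivative_eq_0_if_locally_0[of "- K" x f])
      (use f that in \<open>auto intro: smooth_has_vector_derivative[OF f(1)] compact_imp_closed\<close>)
  then show "\<exists>f'. f' \<in> test_functions S \<and> (\<forall>x. (f has_vector_derivative f' x) (at x))"
    using f by (intro exI[of _ "Dn (Suc 0) f"]) (auto simp: test_functions_iff smooth_Dn smooth_has_vector_derivative)
qed

lemma test_functions_schwartz: "f \<in> test_functions S \<Longrightarrow> f \<in> schwartz"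
proof (erule deriv_closed_schwartz[OF deriv_closed_test_functions])
  fix f m assume "f \<in> test_functions S"
  then obtain K where f: "smooth f" "compact K" "K \<subseteq> S" "\<forall>x. x \<notin> K \<longrightarrow> f x = 0"
    unfolding test_functions_iff by auto
  have "compact ((\<lambda>x. of_real (x ^ m) * f x) ` K)"
    using f by (intro compact_continuous_image continuous_intros smooth_continuous_on)
  then have "bounded (insert 0 ((\<lambda>x. of_real (x ^ m) * f x) ` K))"
    using compact_imp_bounded by (simp del: of_real_power)
  then show "bounded (range (\<lambda>x. of_real (x ^ m) * f x))"
    by (rule bounded_subset) (use f in auto)
qed

section \<open>A smooth bump and a smooth step\<close>

lemma poly_exp_minus_tendsto_0: "((\<lambda>y::real. poly p y * exp (- y)) \<longlongrightarrow> 0) at_top"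
proof -
  have mono: "((\<lambda>y::real. y ^ k * exp (- y)) \<longlongrightarrow> 0) at_top" for k
    using tendsto_power_div_exp_0[of k] by (simp add: exp_minus divide_inverse)
  have "((\<lambda>y::real. \<Sum>i\<le>degree p. coeff p i * (y ^ i * exp (- y))) \<longlongrightarrow> (\<Sum>i\<le>degree p. coeff p i * 0)) at_top"
    by (intro tendsto_intros mono)
  then show ?thesis
    by (simp add: poly_altdef sum_distrib_right mult.assoc)
qed

text \<open>The functions p(1/x) exp (-1/x), extended by 0, form a family closed under
  differentiation: the derivative replaces p(y) by y^2 (p(y) - p'(y)).\<close>

definition flat :: "real poly \<Rightarrow> real \<Rightarrow> real" where
  "flat p x = (if x > 0 then poly p (inverse x) * exp (- inverse x) else 0)"

lemma flat_has_derivative: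
  "(flat p has_real_derivative flat (monom 1 2 * (p - pderiv p)) x) (at x)"
proof (cases x "0 :: real" rule: linorder_cases)
  case less
  have "((\<lambda>x. 0) has_real_derivative 0) (at x)" by simp
  then have "(flat p has_real_derivative 0) (at x)"
    by (rule has_field_derivative_transform_within_open[of _ _ _ "{..<0}"])
       (use less in \<open>auto simp: flat_def\<close>)
  with less show ?thesis by (simp add: flat_def)
next
  case greater
  have "((\<lambda>x. poly p (inverse x) * exp (- inverse x)) has_real_derivative
      flat (monom 1 2 * (p - pderiv p)) x) (at x)"
    using greater
    by (auto intro!: derivative_eq_intros
        simp: flat_def poly_monom power2_eq_square algebra_simps)
  then show ?thesis
    by (rule has_field_derivative_transform_within_open[of _ _ _ "{0<..}"])
       (use greater in \<open>auto simp: flat_def\<close>)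
next
  case equal
  \<comment> \<open>With y = 1/h the right quotient is y p(y) exp (-y), a polynomial times a
    decaying exponential; the left quotient vanishes identically.\<close>
  have "((\<lambda>h. flat p h / h) \<longlongrightarrow> 0) (at_right 0)"
  proof (rule Lim_transform_eventually)
    show "((\<lambda>h. poly (monom 1 1 * p) (inverse h) * exp (- inverse h)) \<longlongrightarrow> 0) (at_right (0::real))"
      by (rule filterlim_compose[OF poly_exp_minus_tendsto_0 filterlim_inverse_at_top_right])
    show "\<forall>\<^sub>F h in at_right 0. poly (monom 1 1 * p) (inverse h) * exp (- inverse h) = flat p h / h"
      by (auto simp: eventually_at_filter flat_def poly_monom divide_inverse mult_ac)
  qed
  moreover have "((\<lambda>h. flat p h / h) \<longlongrightarrow> 0) (at_left 0)"
    by (rule tendsto_eventually) (auto simp: eventually_at_filter flat_def)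
  ultimately have "((\<lambda>h. flat p h / h) \<longlongrightarrow> 0) (at 0)"
    by (simp add: filterlim_split_at)
  with equal show ?thesis
    by (simp add: has_field_derivative_iff flat_def)
qed

lemma smooth_flat: "smooth (\<lambda>x. of_real (flat p x))"
proof (rule deriv_closed_smooth)
  show "deriv_closed {\<lambda>x. of_real (flat p x) | p. True}"
    by (rule deriv_closedI)
       (use flat_has_derivative has_vector_derivative_of_real in blast)
qed blast

definition bump :: "real \<Rightarrow> real" where
  "bump x = flat 1 (1 + x) * flat 1 (1 - x)"

lemma flat_1: "flat 1 x = (if x > 0 then exp (- inverse x) else 0)"
  by (simp add: flat_def)

lemma bump_nonneg: "0 \<le> bump x"
  by (simp add: bump_def flat_1)

lemma bump_eq_0: "1 \<le> \<bar>x\<bar> \<Longrightarrow> bump x = 0"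
  by (auto simp: bump_def flat_1)

lemma smooth_bump: "smooth (\<lambda>x. of_real (bump x))"
  using smooth_mult[OF smooth_affine[OF smooth_flat, of 1 1 1] smooth_affine[OF smooth_flat, of 1 1 "-1"]]
  by (simp add: bump_def)

lemma continuous_on_bump: "continuous_on S bump"
  using continuous_on_Re[OF smooth_continuous_on[OF smooth_bump]] by simp

definition bump_mass :: real where
  "bump_mass = integral {-1..1} bump"

lemma bump_mass_pos: "0 < bump_mass"
proof -
  have "0 \<le> bump_mass"
    unfolding bump_mass_def by (intro integral_nonneg integrable_continuous_real continuous_on_bump) (auto simp: bump_nonneg)
  moreover have "bump_mass \<noteq> 0"
  proof
    assume "bump_mass = 0"
    then have "\<forall>x\<in>cbox (-1) 1. bump x = 0"
      unfolding bump_mass_def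
      using integral_cbox_eq_0_iff[of "-1" 1 bump] by (auto simp: continuous_on_bump bump_nonneg)
    then have "bump 0 = 0" by simp
    then show False by (simp add: bump_def flat_1)
  qed
  ultimately show ?thesis by simp
qed

definition mollifier :: "real \<Rightarrow> real" where
  "mollifier x = bump x / bump_mass"

lemma mollifier_nonneg: "0 \<le> mollifier x"
  using bump_mass_pos by (simp add: mollifier_def bump_nonneg)

lemma mollifier_eq_0: "1 \<le> \<bar>x\<bar> \<Longrightarrow> mollifier x = 0"
  by (simp add: mollifier_def bump_eq_0)

lemma test_mollifier: "(\<lambda>x. of_real (mollifier x)) \<in> test_functions {-1..1}"
proof -
  have "smooth (\<lambda>x. of_real (inverse bump_mass) * of_real (bump x))"
    by (intro smooth_cmult smooth_bump)
  then have "smooth (\<lambda>x. of_real (mollifier x))"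
    by (simp add: mollifier_def divide_inverse mult.commute)
  then show ?thesis
    by (rule test_functionsI[of _ "{-1..1}"]) (auto intro!: mollifier_eq_0)
qed

lemma continuous_on_mollifier: "continuous_on S mollifier"
  unfolding mollifier_def using bump_mass_pos by (intro continuous_intros continuous_on_bump) auto

lemma integral_mollifier: "integral {-1..1} mollifier = 1"
proof -
  have "integral {-1..1} mollifier = integral {-1..1} bump / bump_mass"
    unfolding mollifier_def by (rule integral_divide)
  then show ?thesis
    using bump_mass_pos by (simp add: bump_mass_def[symmetric])
qed

lemma mollifier_has_bochner_integral: "has_bochner_integral lborel mollifier 1"
proof -
  have int: "set_integrable lborel {-1..1} mollifier"
    by (rule borel_integrable_atLeastAtMost') (rule continuous_on_mollifier)
  have eq: "indicator {-1..1} x *\<^sub>R mollifier x = mollifier x" for x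
    using mollifier_eq_0[of x] by (cases "\<bar>x\<bar> \<le> 1") (auto simp: indicator_def abs_le_iff)
  have "(LINT x:{-1..1}|lborel. mollifier x) = integral {-1..1} mollifier"
    by (rule set_borel_integral_eq_integral(2)[OF int])
  also have "\<dots> = 1"
    by (rule integral_mollifier)
  finally show ?thesis
    using int by (simp only: has_bochner_integral_iff set_integrable_def set_lebesgue_integral_def eq)
qed

definition step :: "real \<Rightarrow> real" where
  "step x = integral {-1..x} mollifier"

lemma step_has_derivative: "(step has_real_derivative mollifier x) (at x)"
proof -
  \<comment> \<open>Starting the integral at \<open>- ?c\<close> instead of -1 makes x interior to
    an interval on which the fundamental theorem applies. The added piece contributes nothing
    because the mollifier vanishes there, and for y < -1 the interval in \<open>step\<close> is
    empty, so that its integral is 0.\<close>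
  let ?c = "max 1 (\<bar>x\<bar> + 1)"
  have ext: "integral {- ?c..y} mollifier = step y" if "y \<in> {- ?c<..<?c}" for y
  proof (cases "-1 \<le> y")
    case True
    have "integral {- ?c..-1} mollifier = 0"
      by (rule integral_unique[OF has_integral_is_0]) (auto intro!: mollifier_eq_0)
    moreover have "integral {- ?c..-1} mollifier + integral {-1..y} mollifier = integral {- ?c..y} mollifier"
      by (rule Henstock_Kurzweil_Integration.integral_combine)
         (use True in \<open>auto intro!: integrable_continuous_real continuous_on_mollifier\<close>)
    ultimately show ?thesis by (simp add: step_def)
  next
    case False
    then have "integral {- ?c..y} mollifier = 0"
      by (intro integral_unique[OF has_integral_is_0]) (auto intro!: mollifier_eq_0)
    then show ?thesis using False by (simp add: step_def)
  qed
  have "((\<lambda>y. integral {- ?c..y} mollifier) has_real_derivative mollifier x) (at x within {- ?c..?c})"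
    by (rule integral_has_real_derivative) (auto intro: continuous_on_mollifier)
  then have "((\<lambda>y. integral {- ?c..y} mollifier) has_real_derivative mollifier x) (at x)"
    by (subst (asm) at_within_interior) auto
  then show ?thesis
    by (rule has_field_derivative_transform_within_open[of _ _ _ "{- ?c<..<?c}"]) (use ext in auto)
qed

text \<open>One function is added to the set of all smooth functions: its derivative, the mollifier,
  already belongs to that set.\<close>

lemma smooth_step: "smooth (\<lambda>x. of_real (step x))"
proof (rule deriv_closed_smooth)
  show "deriv_closed (insert (\<lambda>x. of_real (step x)) {f. smooth f})"
  proof (rule deriv_closedI)
    fix f :: "real \<Rightarrow> complex" assume "f \<in> insert (\<lambda>x. of_real (step x)) {f. smooth f}"
    then consider "f = (\<lambda>x. of_real (step x))" | "smooth f" by auto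
    then show "\<exists>f'. f' \<in> insert (\<lambda>x. of_real (step x)) {f. smooth f} \<and> (\<forall>x. (f has_vector_derivative f' x) (at x))"
    proof cases
      case 1
      have "smooth (\<lambda>x. of_real (mollifier x))"
        using test_mollifier by (simp add: test_functions_iff)
      then show ?thesis
        unfolding 1 using step_has_derivative
        by (intro exI[of _ "\<lambda>x. of_real (mollifier x)"]) (auto intro: has_vector_derivative_of_real)
    next
      case 2
      then show ?thesis
        by (intro exI[of _ "Dn (Suc 0) f"]) (simp add: smooth_Dn smooth_has_vector_derivative)
    qed
  qed
qed simp

lemma step_eq_0: "x \<le> -1 \<Longrightarrow> step x = 0"
  by (cases "x = -1") (auto simp: step_def)

lemma step_eq_1: assumes "1 \<le> x" shows "step x = 1"
proof -
  have "integral {1..x} mollifier = 0"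
    by (rule integral_unique[OF has_integral_is_0]) (auto intro!: mollifier_eq_0)
  moreover have "integral {-1..1} mollifier + integral {1..x} mollifier = integral {-1..x} mollifier"
    by (rule Henstock_Kurzweil_Integration.integral_combine)
       (use assms in \<open>auto intro!: integrable_continuous_real continuous_on_mollifier\<close>)
  moreover have "integral {-1..1} mollifier = 1"
    by (rule integral_mollifier)
  ultimately show ?thesis by (simp add: step_def)
qed

lemma step_mono: assumes "x \<le> y" shows "step x \<le> step y"
  by (rule DERIV_nonneg_imp_nondecreasing[OF assms]) (use step_has_derivative mollifier_nonneg in blast)

lemma step_bounds: "0 \<le> step x" "step x \<le> 1"
  using step_mono[of "min x (-1)" x] step_eq_0[of "min x (-1)"]
    step_mono[of x "max x 1"] step_eq_1[of "max x 1"] by auto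

section \<open>Distributions vanish off their support\<close>

lemma temperedD_add:
  "u \<in> tempered \<Longrightarrow> f \<in> schwartz \<Longrightarrow> g \<in> schwartz \<Longrightarrow> u (\<lambda>x. f x + g x) = u f + u g"
  unfolding tempered_def by blast

lemma temperedD_mult:
  "u \<in> tempered \<Longrightarrow> f \<in> schwartz \<Longrightarrow> u (\<lambda>x. c * f x) = cnj c * u f"
  unfolding tempered_def by blast

lemma temperedD_zero: "u \<in> tempered \<Longrightarrow> u (\<lambda>x. 0) = 0"
  using temperedD_mult[of u "\<lambda>x. 0" 0] schwartz_zero by simp

lemma temperedD_off: "u \<in> tempered \<Longrightarrow> f \<notin> schwartz \<Longrightarrow> u f = 0"
  unfolding tempered_def by blast

lemma tempered_sum_eq_0:
  assumes u: "u \<in> tempered" and "finite I"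
    and "\<And>i. i \<in> I \<Longrightarrow> f i \<in> schwartz" "\<And>i. i \<in> I \<Longrightarrow> u (f i) = 0"
  shows "(\<lambda>x. \<Sum>i\<in>I. f i x) \<in> schwartz \<and> u (\<lambda>x. \<Sum>i\<in>I. f i x) = 0"
  using assms(2-)
  by (induction I) (auto simp: schwartz_zero temperedD_zero[OF u] temperedD_add[OF u] schwartz_add)

text \<open>A test function off the support may meet several of the open sets on which
  \<open>u\<close> is known to vanish. A Lebesgue number \<open>d\<close> of that cover reduces the
  claim to pieces of diameter below \<open>d\<close>, each of which fits into one open set.\<close>

lemma vanishes_off_supp:
  assumes u: "u \<in> tempered" and f: "f \<in> test_functions (- supp u)"
  shows "u f = 0"
proof (cases "\<forall>x. f x = 0")
  case True
  then have "f = (\<lambda>x. 0)" by auto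
  then show ?thesis using temperedD_zero[OF u] by simp
next
  case False
  obtain K where K: "smooth f" "compact K" "K \<subseteq> - supp u" "\<And>x. x \<notin> K \<Longrightarrow> f x = 0"
    using f unfolding test_functions_iff by auto
  let ?C = "{V. open V \<and> (\<forall>f\<in>test_functions V. u f = 0)}"
  obtain d where d: "0 < d" "\<And>T. T \<subseteq> K \<Longrightarrow> diameter T < d \<Longrightarrow> \<exists>B\<in>?C. T \<subseteq> B"
  proof (rule Lebesgue_number_lemma[OF K(2), of ?C])
    show "?C \<noteq> {}" using False K by (auto simp: supp_def) blast
    show "K \<subseteq> \<Union> ?C" using K by (auto simp: supp_def)
  qed auto
  obtain R where R: "0 < R" "\<And>x. x \<in> K \<Longrightarrow> \<bar>x\<bar> \<le> R"
    using compact_imp_bounded[OF K(2)] unfolding bounded_pos by auto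
  \<comment> \<open>The differences of consecutive steps form a partition of unity subordinate to a fine cover.\<close>
  define h where "h = d / 4"
  define e where "e k x = step (x / h - real_of_int k)" for k x
  have h: "0 < h" using d by (simp add: h_def)
  \<comment> \<open>The extra 1 is a margin: on \<open>K\<close> it gives |x / h| at most N - 1, so
    that \<open>e (-N)\<close> is 1 and \<open>e (N + 1)\<close> is 0 there and the telescoping sum
    equals 1.\<close>
  define N where "N = \<lceil>R / h\<rceil> + 1"
  have N: "R / h \<le> real_of_int (N - 1)" by (simp add: N_def)
  have N0: "0 < N" using zero_le_ceiling[of "R / h"] divide_pos_pos[OF R(1) h] unfolding N_def by linarith
  let ?g = "\<lambda>k x. f x * of_real (e k x - e (k + 1) x)"
  have smooth_e: "smooth (\<lambda>x. of_real (e k x))" for k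
    using smooth_affine[OF smooth_step, of "- real_of_int k" "1/h"] by (simp add: e_def)
  have sm: "smooth (\<lambda>x. of_real (e k x - e (k + 1) x))" for k
    using smooth_diff[OF smooth_e smooth_e] by simp
  have fS: "f \<in> test_functions K"
    using K unfolding test_functions_iff by auto
  have gS: "?g k \<in> schwartz" for k
    by (rule test_functions_schwartz[OF test_functions_mult[OF fS sm]])
  have ug: "u (?g k) = 0" for k
  proof -
    \<comment> \<open>Outside this range \<open>e k\<close> and \<open>e (k + 1)\<close> agree: both
      are 0 to the left and both are 1 to the right. The range has length 3 h, which is less than
      \<open>d\<close> because h = d / 4.\<close>
    let ?T = "K \<inter> {h * (k - 1) .. h * (k + 2)}"
    have "diameter ?T \<le> 3 * h"
    proof (rule diameter_le)
      show "norm (x - y) \<le> 3 * h" if "x \<in> ?T" "y \<in> ?T" for x y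
        using that h by (auto simp: algebra_simps abs_le_iff)
    qed (use h in auto)
    then have "diameter ?T < d" using d by (simp add: h_def)
    then obtain B where B: "B \<in> ?C" "?T \<subseteq> B" using d(2)[of ?T] by auto
    have "?g k x = 0" if x: "x \<notin> ?T" for x
    proof (cases "x \<in> K")
      case True
      then consider "x < h * (k - 1)" | "x > h * (k + 2)" using x by fastforce
      then show ?thesis
      proof cases
        case 1
        then have "x / h \<le> k - 1" using h by (simp add: field_simps)
        then show ?thesis by (simp add: e_def step_eq_0)
      next
        case 2
        then have "x / h \<ge> k + 2" using h by (simp add: field_simps)
        then show ?thesis by (simp add: e_def step_eq_1)
      qed
    qed (use K in auto)
    then have "?g k \<in> test_functions B"
      using smooth_mult[OF K(1) sm] K(2) B(2)
      by (intro test_functionsI[of _ ?T] compact_Int_closed) auto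
    with B show ?thesis by auto
  qed
  have "f x = (\<Sum>k\<in>{-N..N}. ?g k x)" for x
  proof (cases "x \<in> K")
    case True
    have tele: "(\<Sum>k\<in>{-N..M}. of_real (e k x - e (k + 1) x)) = (of_real (e (-N) x - e (M + 1) x) :: complex)" if "-N \<le> M" for M
      using that
    proof (induction M rule: int_ge_induct)
      case (step M)
      have "{-N..M + 1} = insert (M + 1) {-N..M}" using step by auto
      then show ?case using step by simp
    qed simp
    have "\<bar>x / h\<bar> \<le> N - 1" using R(2)[OF True] h N
      by (simp add: abs_divide) (meson divide_right_mono less_imp_le order_trans)
    then have "e (-N) x = 1" "e (N + 1) x = 0"
      using abs_le_D1[of "x/h" "N-1"] abs_le_D2[of "x/h" "N-1"] unfolding e_def by (auto intro!: step_eq_1 step_eq_0)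
    then show ?thesis using tele[of N] N0 by (simp add: sum_distrib_left[symmetric] del: of_real_diff)
  qed (use K in auto)
  then have feq: "f = (\<lambda>x. \<Sum>k\<in>{-N..N}. ?g k x)" by (rule ext)
  have "u (\<lambda>x. \<Sum>k\<in>{-N..N}. ?g k x) = 0"
    using tempered_sum_eq_0[OF u, of "{-N..N}" ?g] gS ug by blast
  then show ?thesis
    by (subst feq)
qed

lemma vanishes_off_supp':
  assumes "u \<in> tempered" "supp u \<subseteq> F" "f \<in> test_functions V" "V \<inter> F = {}"
  shows "u f = 0"
  by (rule vanishes_off_supp[OF assms(1)]) (use assms test_functions_mono[of V "- supp u"] in auto)

section \<open>The fundamental lemma of the calculus of variations\<close>

text \<open>Cutting \<open>g\<close> down to (-n, n) makes it integrable. The Borel sets over which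
  the truncated function integrates to 0 form a Dynkin system containing the intersection-stable
  family of open intervals, hence are all Borel sets, and uniqueness of densities applies.\<close>

lemma AE_eq_0_if_interval_integrals_0:
  fixes g :: "real \<Rightarrow> complex"
  assumes int: "\<And>R. set_integrable lborel {-R..R} g"
    and zero: "\<And>p q. p \<le> q \<Longrightarrow> (LINT x:{p<..<q}|lborel. g x) = 0"
  shows "AE x in lborel. g x = 0"
proof -
  have "AE x in lborel. indicator {- real n<..<real n} x *\<^sub>R g x = 0" for n
  proof (rule sigma_finite_measure.density_unique_banach[OF lborel.sigma_finite_measure_axioms, where f' = "\<lambda>x. 0"])
    have sets_eq: "sets borel = sigma_sets UNIV (range (\<lambda>(a, b). {a <..< b :: real}))"
      using arg_cong[OF borel_eq_box[where 'a = real], of sets] by simp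
    let ?I = "{- real n<..<real n}"
    let ?f = "\<lambda>x. indicator ?I x *\<^sub>R g x"
    have I: "set_integrable lborel ?I g"
      by (rule set_integrable_subset[OF int[of "real n"]]) auto
    then show f: "integrable lborel ?f"
      by (simp add: set_integrable_def)
    have fA: "set_integrable lborel A ?f" if "A \<in> sets borel" for A
      unfolding set_integrable_def by (rule integrable_mult_indicator) (use that f in auto)
    have tot: "(LINT x|lborel. ?f x) = 0"
      using zero[of "- real n" "real n"] by (simp add: set_lebesgue_integral_def)
    show "(LINT x:A|lborel. ?f x) = (LINT x:A|lborel. 0)" if "A \<in> sets lborel" for A
    proof -
      have A: "A \<in> sigma_sets UNIV (range (\<lambda>(a, b). {a <..< b :: real}))"
        using that by (simp add: sets_eq)
      have "Int_stable (range (\<lambda>(a, b). {a <..< b :: real}))"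
      proof (rule Int_stableI, safe)
        fix a b c d :: real
        have "{a<..<b} \<inter> {c<..<d} = (\<lambda>(a, b). {a<..<b}) (max a c, min b d)" by auto
        then show "{a<..<b} \<inter> {c<..<d} \<in> range (\<lambda>(a, b). {a<..<b})" by blast
      qed
      moreover have "range (\<lambda>(a, b). {a <..< b :: real}) \<subseteq> Pow UNIV" by simp
      ultimately have "(LINT x:A|lborel. ?f x) = 0" using A
      proof (induction rule: sigma_sets_induct_disjoint)
        case (basic A)
        then obtain p q where A: "A = {p<..<q}" by auto
        have "A \<inter> ?I = {max p (- real n)<..<min q (real n)}" by (auto simp: A)
        then have "(LINT x:A|lborel. ?f x) = (LINT x:{max p (- real n)<..<min q (real n)}|lborel. g x)"
          by (auto simp: set_lebesgue_integral_def indicator_inter_arith[symmetric] intro!: Bochner_Integration.integral_cong split: split_indicator)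
        also have "\<dots> = 0"
          using zero[of "max p (- real n)" "min q (real n)"]
          by (cases "max p (- real n) \<le> min q (real n)") (auto simp: set_lebesgue_integral_def)
        finally show ?case .
      next
        case empty
        then show ?case by (simp add: set_lebesgue_integral_def)
      next
        case (compl A)
        then have A: "A \<in> sets borel" using sets_eq by auto
        \<comment> \<open>Complements are where the total integral enters; it is 0 by the hypothesis
          on the interval (-n, n).\<close>
        have "(LINT x:UNIV - A|lborel. ?f x) + (LINT x:A|lborel. ?f x) = (LINT x:(UNIV - A) \<union> A|lborel. ?f x)"
          by (rule set_integral_Un[symmetric]) (use A fA in auto)
        then show ?case using compl tot by (simp add: set_lebesgue_integral_def)
      next
        case (union A)
        then have A: "A i \<in> sets borel" for i using sets_eq by auto
        have "(LINT x:(\<Union>i. A i)|lborel. ?f x) = (\<Sum>i. LINT x:A i|lborel. ?f x)"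
          by (rule lebesgue_integral_countable_add) (use A fA union in \<open>auto simp: disjoint_family_on_def\<close>)
        then show ?case using union by simp
      qed
      then show ?thesis by (simp add: set_lebesgue_integral_def)
    qed
  qed simp
  then have "AE x in lborel. \<forall>n. indicator {- real n<..<real n} x *\<^sub>R g x = 0"
    unfolding AE_all_countable by blast
  then show ?thesis
  proof eventually_elim
    case (elim x)
    obtain n where "\<bar>x\<bar> < real n" using reals_Archimedean2 by blast
    then show ?case using elim[rule_format, of n] by (auto simp: indicator_def abs_less_iff split: if_splits)
  qed
qed

text \<open>The argument k (x - p) - 1 runs through the transition range [-1, 1] of
  \<open>step\<close> while x - p runs through [0, 2 / k], so both transitions take place inside the
  interval and their width shrinks with k.\<close>

definition plateau :: "real \<Rightarrow> real \<Rightarrow> real \<Rightarrow> real \<Rightarrow> real" where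
  "plateau p q k x = step (k * (x - p) - 1) * step (k * (q - x) - 1)"

lemma plateau_bounds: "0 \<le> plateau p q k x" "plateau p q k x \<le> 1"
  unfolding plateau_def by (auto intro!: mult_nonneg_nonneg mult_le_one step_bounds)

lemma plateau_eq_0: assumes "k \<ge> 0" "x \<notin> {p<..<q}" shows "plateau p q k x = 0"
proof -
  have "k * (x - p) \<le> 0 \<or> k * (q - x) \<le> 0"
    using assms by (auto simp: mult_nonneg_nonpos not_less)
  then show ?thesis by (auto simp: plateau_def step_eq_0)
qed

lemma plateau_eq_1: "2 \<le> k * (x - p) \<Longrightarrow> 2 \<le> k * (q - x) \<Longrightarrow> plateau p q k x = 1"
  by (simp add: plateau_def step_eq_1)

lemma plateau_test: assumes "k \<ge> 0" shows "(\<lambda>x. of_real (plateau p q k x)) \<in> test_functions {p..q}"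
proof -
  have "smooth (\<lambda>x. of_real (step (- k * p - 1 + k * x)) * of_real (step (k * q - 1 + - k * x)))"
    by (intro smooth_mult smooth_affine[OF smooth_step])
  moreover have "plateau p q k = (\<lambda>x. step (- k * p - 1 + k * x) * step (k * q - 1 + - k * x))"
    by (auto simp: plateau_def algebra_simps)
  ultimately have "smooth (\<lambda>x. of_real (plateau p q k x))" by simp
  then show ?thesis
    by (rule test_functionsI[of _ "{p..q}"]) (use plateau_eq_0[OF assms, of _ p q] in auto)
qed

lemma plateau_tendsto: "(\<lambda>k. plateau p q (real k) x) \<longlonglongrightarrow> indicator {p<..<q} x"
proof (cases "x \<in> {p<..<q}")
  case True
  then have "\<forall>\<^sub>F k in sequentially. 2 \<le> real k * (x - p)" "\<forall>\<^sub>F k in sequentially. 2 \<le> real k * (q - x)"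
    by real_asymp+
  then have "\<forall>\<^sub>F k in sequentially. plateau p q (real k) x = 1"
    by eventually_elim (rule plateau_eq_1)
  with True show ?thesis by (simp add: tendsto_eventually)
qed (simp add: plateau_eq_0)

text \<open>Plateaus converge boundedly to the indicator of an open interval, so testing against
  Schwartz functions determines all interval integrals of \<open>g\<close>.\<close>

lemma fundamental_lemma:
  fixes g :: "real \<Rightarrow> complex"
  assumes [measurable]: "g \<in> borel_measurable borel"
    and int: "\<And>f. f \<in> schwartz \<Longrightarrow> integrable lborel (\<lambda>x. g x * cnj (f x))"
    and zero: "\<And>f. f \<in> schwartz \<Longrightarrow> (LINT x|lborel. g x * cnj (f x)) = 0"
  shows "AE x in lborel. g x = 0"
proof (rule AE_eq_0_if_interval_integrals_0)
  show loc: "set_integrable lborel {-R..R} g" for R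
  proof -
    \<comment> \<open>This plateau equals 1 on [-R, R], which turns integrability against it into
      local integrability of \<open>g\<close>; the margin 2 is the transition width for k =
      1.\<close>
    let ?f = "\<lambda>x. complex_of_real (plateau (-R - 2) (R + 2) 1 x)"
    have "?f \<in> schwartz" by (rule test_functions_schwartz[OF plateau_test]) simp
    then have "set_integrable lborel {-R..R} (\<lambda>x. g x * cnj (?f x))"
      unfolding set_integrable_def by (intro integrable_mult_indicator int) auto
    then show ?thesis
      by (rule set_integrable_cong[THEN iffD1, rotated -1]) (auto simp: plateau_eq_1)
  qed
  show "(LINT x:{p<..<q}|lborel. g x) = 0" if "p \<le> q" for p q
  proof -
    define R where "R = max \<bar>p\<bar> \<bar>q\<bar>"
    let ?f = "\<lambda>k x. complex_of_real (plateau p q (real k) x)"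
    have f: "?f k \<in> schwartz" for k by (rule test_functions_schwartz[OF plateau_test]) simp
    have "(\<lambda>k. LINT x|lborel. g x * cnj (?f k x)) \<longlonglongrightarrow> (LINT x|lborel. indicator {p<..<q} x *\<^sub>R g x)"
    proof (rule integral_dominated_convergence)
      show "integrable lborel (\<lambda>x. norm (indicator {-R..R} x *\<^sub>R g x))"
        using loc[of R] unfolding set_integrable_def by (rule integrable_norm)
      show "AE x in lborel. (\<lambda>k. g x * cnj (?f k x)) \<longlonglongrightarrow> indicator {p<..<q} x *\<^sub>R g x"
      proof (rule AE_I2)
        fix x
        have "(\<lambda>k. g x * cnj (?f k x)) \<longlonglongrightarrow> g x * cnj (of_real (indicator {p<..<q} x))"
          by (intro tendsto_intros plateau_tendsto)
        then show "(\<lambda>k. g x * cnj (?f k x)) \<longlonglongrightarrow> indicator {p<..<q} x *\<^sub>R g x"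
          by (simp add: scaleR_conv_of_real mult.commute)
      qed
      show "AE x in lborel. norm (g x * cnj (?f k x)) \<le> norm (indicator {-R..R} x *\<^sub>R g x)" for k
      proof (rule AE_I2)
        fix x
        show "norm (g x * cnj (?f k x)) \<le> norm (indicator {-R..R} x *\<^sub>R g x)"
        proof (cases "x \<in> {p<..<q}")
          case True
          then have "x \<in> {-R..R}" by (auto simp: R_def)
          moreover have "norm (g x) * \<bar>plateau p q (real k) x\<bar> \<le> norm (g x) * 1"
            using plateau_bounds[of p q k x] by (intro mult_left_mono) auto
          ultimately show ?thesis by (simp add: norm_mult)
        qed (simp add: plateau_eq_0)
      qed
      show "(\<lambda>x. g x * cnj (?f k x)) \<in> borel_measurable lborel" for k
        using int[OF f] by auto
    qed auto
    then have "(\<lambda>k. 0) \<longlonglongrightarrow> (LINT x|lborel. indicator {p<..<q} x *\<^sub>R g x)"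
      using zero[OF f] by simp
    then show ?thesis
      using LIMSEQ_unique tendsto_const by (auto simp: set_lebesgue_integral_def)
  qed
qed

section \<open>The Fourier transform of integrable functions\<close>

text \<open>Positive exponent and no normalising factor: \<open>inv_fourier\<close> is a constant
  multiple of \<open>ft\<close>, and the forward transform is the same multiple of its reflection,
  so one set of estimates serves both.\<close>

definition ft :: "(real \<Rightarrow> complex) \<Rightarrow> real \<Rightarrow> complex" where
  "ft f x = (LINT \<xi>|lborel. exp (\<i> * of_real (\<xi> * x)) * f \<xi>)"

lemma inv_fourier_eq: "inv_fourier f x = of_real (1 / sqrt (2 * pi)) * ft f x"
  by (simp add: inv_fourier_def ft_def)

lemma norm_exp_i [simp]: "norm (exp (\<i> * of_real y)) = 1"
  by simp

lemma integrable_exp_i_mult: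
  assumes "integrable lborel f"
  shows "integrable lborel (\<lambda>\<xi>. exp (\<i> * of_real (\<xi> * x)) * f \<xi>)"
proof (rule Bochner_Integration.integrable_bound[OF assms])
  have [measurable]: "f \<in> borel_measurable borel" using assms by auto
  show "(\<lambda>\<xi>. exp (\<i> * of_real (\<xi> * x)) * f \<xi>) \<in> borel_measurable lborel"
    by measurable
qed (simp add: norm_mult del: of_real_mult)

lemma norm_ft_le: "norm (ft f x) \<le> (LINT \<xi>|lborel. norm (f \<xi>))"
proof -
  have "norm (ft f x) \<le> (LINT \<xi>|lborel. norm (exp (\<i> * of_real (\<xi> * x)) * f \<xi>))"
    unfolding ft_def by (rule integral_norm_bound)
  then show ?thesis by (simp add: norm_mult del: of_real_mult)
qed

lemma continuous_on_ft:
  assumes f: "integrable lborel f"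
  shows "continuous_on S (ft f)"
proof (rule continuous_on_subset[OF continuous_at_imp_continuous_on])
  show "\<forall>x\<in>UNIV. isCont (ft f) x"
    unfolding continuous_at_sequentially
  proof (intro ballI allI impI)
    fix x :: real and X assume X: "X \<longlonglongrightarrow> x"
    have [measurable]: "f \<in> borel_measurable borel" using f by auto
    show "(ft f \<circ> X) \<longlonglongrightarrow> ft f x"
      unfolding ft_def o_def
      by (rule integral_dominated_convergence[where w = "\<lambda>\<xi>. norm (f \<xi>)"])
         (use f in \<open>auto intro!: tendsto_intros X AE_I2 simp: norm_mult simp del: of_real_mult\<close>)
  qed
qed simp

lemma ft_measurable [measurable (raw)]: "integrable lborel f \<Longrightarrow> ft f \<in> borel_measurable borel"
  by (intro borel_measurable_continuous_onI continuous_on_ft)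

text \<open>Differentiation under the integral sign. The Taylor remainder \<open>E h\<close> is
  bounded both linearly and quadratically in h: after division by |h| the linear bound yields the
  majorant 2 |xi f(xi)|, the quadratic one the pointwise limit 0.\<close>

lemma ft_has_vector_derivative:
  assumes f: "integrable lborel f" and f': "integrable lborel (\<lambda>\<xi>. \<i> * of_real \<xi> * f \<xi>)"
  shows "(ft f has_vector_derivative ft (\<lambda>\<xi>. \<i> * of_real \<xi> * f \<xi>) x) (at x)"
proof -
  have [measurable]: "f \<in> borel_measurable borel" using f by auto
  define E where "E h \<xi> = iexp (\<xi> * h) - 1 - \<i> * of_real (\<xi> * h)" for h \<xi> :: real
  have E1: "norm (E h \<xi>) \<le> 2 * \<bar>\<xi> * h\<bar>" for h \<xi>
  proof -
    have "norm (iexp (\<xi> * h) - 1) \<le> \<bar>\<xi> * h\<bar>"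
      using iexp_approx1[of "\<xi> * h" 0] by simp
    moreover have "norm (\<i> * of_real (\<xi> * h)) = \<bar>\<xi> * h\<bar>"
      by (simp add: norm_mult abs_mult)
    ultimately show ?thesis
      unfolding E_def using norm_triangle_ineq4[of "iexp (\<xi> * h) - 1" "\<i> * of_real (\<xi> * h)"] by linarith
  qed
  have E2: "norm (E h \<xi>) \<le> (\<xi> * h)\<^sup>2" for h \<xi>
  proof -
    have "norm (E h \<xi>) \<le> (\<xi> * h)\<^sup>2 / 2"
      using iexp_approx1[of "\<xi> * h" 1] by (simp add: E_def numeral_2_eq_2 diff_diff_eq)
    also have "\<dots> \<le> (\<xi> * h)\<^sup>2" by simp
    finally show ?thesis .
  qed
  let ?D = "ft (\<lambda>\<xi>. \<i> * of_real \<xi> * f \<xi>) x"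
  have diff: "ft f (x + h) - ft f x - h *\<^sub>R ?D = (LINT \<xi>|lborel. iexp (\<xi> * x) * f \<xi> * E h \<xi>)" for h
  proof -
    have "ft f (x + h) - ft f x - h *\<^sub>R ?D =
        (LINT \<xi>|lborel. iexp (\<xi> * (x + h)) * f \<xi> - iexp (\<xi> * x) * f \<xi> - h *\<^sub>R (iexp (\<xi> * x) * (\<i> * of_real \<xi> * f \<xi>)))"
      unfolding ft_def using integrable_exp_i_mult[OF f] integrable_exp_i_mult[OF f']
      by (subst Bochner_Integration.integral_diff Bochner_Integration.integral_scaleR_right,
          (auto intro!: Bochner_Integration.integrable_diff integrable_scaleR_right simp del: of_real_mult)[2])+ simp
    also have "\<dots> = (LINT \<xi>|lborel. iexp (\<xi> * x) * f \<xi> * E h \<xi>)"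
      by (rule Bochner_Integration.integral_cong)
         (auto simp: E_def scaleR_conv_of_real exp_add distrib_left ring_distribs mult_ac)
    finally show ?thesis .
  qed
  have "((\<lambda>h. (ft f (x + h) - ft f x - h *\<^sub>R ?D) /\<^sub>R norm h) \<longlongrightarrow> 0) (at 0)"
    unfolding tendsto_at_iff_sequentially
  proof (intro allI impI)
    fix X :: "nat \<Rightarrow> real" assume X: "\<forall>i. X i \<in> UNIV - {0}" "X \<longlonglongrightarrow> 0"
    have [measurable]: "E h \<in> borel_measurable borel" for h
      unfolding E_def by measurable
    have "(\<lambda>n. LINT \<xi>|lborel. (iexp (\<xi> * x) * f \<xi> * E (X n) \<xi>) /\<^sub>R \<bar>X n\<bar>) \<longlonglongrightarrow> (LINT \<xi>::real|lborel. 0)"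
    proof (rule integral_dominated_convergence[where w = "\<lambda>\<xi>. 2 * norm (\<i> * of_real \<xi> * f \<xi>)"])
      show "AE \<xi> in lborel. norm ((iexp (\<xi> * x) * f \<xi> * E (X n) \<xi>) /\<^sub>R \<bar>X n\<bar>) \<le> 2 * norm (\<i> * of_real \<xi> * f \<xi>)" for n
      proof (rule AE_I2)
        fix \<xi>
        have "norm (f \<xi>) * norm (E (X n) \<xi>) \<le> norm (f \<xi>) * (2 * \<bar>\<xi> * X n\<bar>)"
          by (intro mult_left_mono E1) auto
        then show "norm ((iexp (\<xi> * x) * f \<xi> * E (X n) \<xi>) /\<^sub>R \<bar>X n\<bar>) \<le> 2 * norm (\<i> * of_real \<xi> * f \<xi>)"
          using X(1) by (simp add: norm_mult abs_mult field_simps del: of_real_mult)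
      qed
      show "AE \<xi> in lborel. (\<lambda>n. (iexp (\<xi> * x) * f \<xi> * E (X n) \<xi>) /\<^sub>R \<bar>X n\<bar>) \<longlonglongrightarrow> 0"
      proof (rule AE_I2, rule Lim_null_comparison)
        fix \<xi>
        show "\<forall>\<^sub>F n in sequentially. norm ((iexp (\<xi> * x) * f \<xi> * E (X n) \<xi>) /\<^sub>R \<bar>X n\<bar>) \<le> norm (f \<xi>) * \<xi>\<^sup>2 * \<bar>X n\<bar>"
        proof (rule always_eventually, rule allI)
          fix n
          have "norm (f \<xi>) * norm (E (X n) \<xi>) \<le> norm (f \<xi>) * (\<xi> * X n)\<^sup>2"
            by (intro mult_left_mono E2) auto
          also have "\<dots> = (norm (f \<xi>) * \<xi>\<^sup>2 * \<bar>X n\<bar>) * \<bar>X n\<bar>"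
            by (simp add: power_mult_distrib power2_eq_square[of "X n"])
          finally show "norm ((iexp (\<xi> * x) * f \<xi> * E (X n) \<xi>) /\<^sub>R \<bar>X n\<bar>) \<le> norm (f \<xi>) * \<xi>\<^sup>2 * \<bar>X n\<bar>"
            using X(1) by (simp add: norm_mult divide_inverse[symmetric] pos_divide_le_eq mult.commute[of "inverse \<bar>X n\<bar>"] del: of_real_mult)
        qed
        show "(\<lambda>n. norm (f \<xi>) * \<xi>\<^sup>2 * \<bar>X n\<bar>) \<longlonglongrightarrow> 0"
          using tendsto_mult_left[OF tendsto_rabs[OF X(2)], of "norm (f \<xi>) * \<xi>\<^sup>2"] by simp
      qed
    qed (use f' in auto)
    then show "((\<lambda>h. (ft f (x + h) - ft f x - h *\<^sub>R ?D) /\<^sub>R norm h) \<circ> X) \<longlonglongrightarrow> 0"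
      by (simp add: diff o_def)
  qed
  then show ?thesis
    unfolding has_vector_derivative_def has_derivative_at
    using tendsto_norm_zero by (fastforce simp: bounded_linear_scaleR_left divide_inverse mult.commute)
qed

section \<open>Decay of Schwartz functions and their transforms\<close>

lemma integrable_inverse_1_plus_power2: "integrable lborel (\<lambda>x::real. inverse (1 + x\<^sup>2))"
  using integrable_inverse_1_plus_square by (simp add: set_integrable_def)

lemma integral_inverse_1_plus_power2: "(LINT x|lborel. inverse (1 + x\<^sup>2)) = pi"
  using LBINT_inverse_1_plus_square
  by (simp add: interval_lebesgue_integral_def set_lebesgue_integral_def)

lemma bounded_by_inverse_1_plus_integrable:
  fixes f :: "real \<Rightarrow> complex"
  assumes "f \<in> borel_measurable borel" "\<And>x. norm (f x) \<le> C * inverse (1 + x\<^sup>2)"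
  shows "integrable lborel f"
proof (rule Bochner_Integration.integrable_bound)
  show "integrable lborel (\<lambda>x. C * inverse (1 + x\<^sup>2))"
    by (intro integrable_mult_right integrable_inverse_1_plus_power2)
  show "AE x in lborel. norm (f x) \<le> norm (C * inverse (1 + x\<^sup>2))"
    using assms(2) abs_ge_self order_trans by (intro AE_I2) (fastforce simp: abs_mult)
qed (use assms in simp)

lemma schwartz_bound:
  assumes "f \<in> schwartz"
  obtains C where "\<And>x. norm (f x) \<le> C * inverse (1 + x\<^sup>2)"
proof -
  obtain A where A: "\<And>x. norm (of_real (x ^ 0) * f x) \<le> A"
    using schwartz_bounded[OF assms, of 0] unfolding bounded_iff by auto
  obtain B where B: "\<And>x. norm (of_real (x ^ 2) * f x) \<le> B"
    using schwartz_bounded[OF assms, of 2] unfolding bounded_iff by blast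
  have "norm (f x) \<le> (A + B) * inverse (1 + x\<^sup>2)" for x
  proof -
    have "norm (f x) * (1 + x\<^sup>2) \<le> A + B"
      using A[of x] B[of x] by (simp add: norm_mult norm_power algebra_simps)
    then show ?thesis
      by (simp add: divide_inverse[symmetric] pos_le_divide_eq add_pos_nonneg)
  qed
  then show ?thesis by (rule that)
qed

lemma schwartz_integrable: "f \<in> schwartz \<Longrightarrow> integrable lborel f"
  by (metis schwartz_bound bounded_by_inverse_1_plus_integrable schwartz_measurable)

lemma schwartz_tendsto_0:
  assumes "f \<in> schwartz"
  shows "(f \<longlongrightarrow> 0) at_top" "(f \<longlongrightarrow> 0) at_bot"
proof -
  obtain C where C: "\<And>x. norm (f x) \<le> C * inverse (1 + x\<^sup>2)"
    using schwartz_bound[OF assms] by blast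
  have "((\<lambda>x::real. C * inverse (1 + x\<^sup>2)) \<longlongrightarrow> 0) at_top" "((\<lambda>x::real. C * inverse (1 + x\<^sup>2)) \<longlongrightarrow> 0) at_bot"
    by real_asymp+
  then show "(f \<longlongrightarrow> 0) at_top" "(f \<longlongrightarrow> 0) at_bot"
    by (auto intro: Lim_null_comparison[OF always_eventually[rule_format, OF C]])
qed

lemma exp_i_has_vector_derivative:
  "((\<lambda>\<xi>. iexp (\<xi> * x)) has_vector_derivative \<i> * of_real x * iexp (\<xi> * x)) (at \<xi>)"
proof -
  have "((\<lambda>z. exp (\<i> * of_real x * z)) has_field_derivative \<i> * of_real x * exp (\<i> * of_real x * of_real \<xi>)) (at (of_real \<xi>))"
    by (auto intro!: derivative_eq_intros)
  from has_vector_derivative_real_field[OF this] show ?thesis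
    by (simp add: o_def mult_ac)
qed

text \<open>Integration by parts: the derivative of exp (i xi x) f(xi) integrates to 0 over the line
  because \<open>f\<close> decays at both ends.\<close>

lemma ft_derivative:
  assumes f: "f \<in> schwartz"
  shows "of_real x * ft f x = \<i> * ft (Dn (Suc 0) f) x"
proof -
  let ?f' = "Dn (Suc 0) f"
  let ?F = "\<lambda>\<xi>. iexp (\<xi> * x) * f \<xi>"
  let ?F' = "\<lambda>\<xi>. iexp (\<xi> * x) * ?f' \<xi> + \<i> * of_real x * (iexp (\<xi> * x) * f \<xi>)"
  have f': "?f' \<in> schwartz" by (rule schwartz_Dn[OF f])
  have i: "integrable lborel (\<lambda>\<xi>. iexp (\<xi> * x) * ?f' \<xi>)" "integrable lborel (\<lambda>\<xi>. iexp (\<xi> * x) * f \<xi>)"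
    by (intro integrable_exp_i_mult schwartz_integrable f f')+
  have lim: "(?F \<longlongrightarrow> 0) at_top" "(?F \<longlongrightarrow> 0) at_bot"
    by (rule Lim_null_comparison[where g = "\<lambda>\<xi>. norm (f \<xi>)"];
        simp add: norm_mult schwartz_tendsto_0[OF f] tendsto_norm_zero del: of_real_mult)+
  have "(LBINT \<xi>=-\<infinity>..\<infinity>. ?F' \<xi>) = 0 - 0"
  proof (rule interval_integral_FTC_integrable)
    show "(?F has_vector_derivative ?F' \<xi>) (at \<xi>)" for \<xi>
      using has_vector_derivative_mult[OF exp_i_has_vector_derivative[of x \<xi>] schwartz_has_vector_derivative[OF f, of \<xi>]]
      by (simp add: mult.assoc)
    have "isCont f \<xi>" "isCont ?f' \<xi>" for \<xi>
      using f f' by (auto intro: smooth_isCont schwartz_smooth)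
    then show "isCont ?F' \<xi>" for \<xi>
      by (intro continuous_intros) auto
    show "set_integrable lborel (einterval (-\<infinity>) \<infinity>) ?F'"
      using i by (simp add: set_integrable_def del: of_real_mult)
    show "((?F \<circ> real_of_ereal) \<longlongrightarrow> 0) (at_right (- \<infinity>))" "((?F \<circ> real_of_ereal) \<longlongrightarrow> 0) (at_left \<infinity>)"
      using lim unfolding ereal_tendsto_simps by auto
  qed simp
  then have "(LINT \<xi>|lborel. ?F' \<xi>) = 0"
    by (simp add: interval_lebesgue_integral_def set_lebesgue_integral_def)
  moreover have "(LINT \<xi>|lborel. ?F' \<xi>) = ft ?f' x + \<i> * of_real x * ft f x"
    unfolding ft_def using i by (simp del: of_real_mult)
  ultimately have "\<i> * (ft ?f' x + \<i> * of_real x * ft f x) = 0" by simp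
  then show ?thesis by (simp add: algebra_simps)
qed

text \<open>Differentiating a transform multiplies \<open>f\<close> by i xi, and multiplying a
  transform by x differentiates \<open>f\<close> up to a factor i. Powers of x are thus traded for
  derivatives of \<open>f\<close>, and each transform is bounded by an L1 norm.\<close>

lemma schwartz_ft:
  assumes "f \<in> schwartz"
  shows "ft f \<in> schwartz"
proof (rule deriv_closed_schwartz)
  show "deriv_closed (ft ` schwartz)"
  proof (rule deriv_closedI)
    fix g assume "g \<in> ft ` schwartz"
    then obtain f where f: "f \<in> schwartz" "g = ft f" by auto
    have f': "(\<lambda>\<xi>. \<i> * of_real \<xi> * f \<xi>) \<in> schwartz"
      using schwartz_monom_mult[OF f(1), of \<i> 1] by simp
    then show "\<exists>g'. g' \<in> ft ` schwartz \<and> (\<forall>x. (g has_vector_derivative g' x) (at x))"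
      using ft_has_vector_derivative[OF schwartz_integrable[OF f(1)] schwartz_integrable[OF f']] f(2) by blast
  qed
  show "bounded (range (\<lambda>x. of_real (x ^ m) * g x))" if g: "g \<in> ft ` schwartz" for g m
  proof -
    obtain f where f: "f \<in> schwartz" "g = ft f" using g by auto
    have "\<exists>C. \<forall>x. norm (of_real (x ^ m) * ft f x) \<le> C" using f(1)
    proof (induction m arbitrary: f)
      case 0
      then show ?case using norm_ft_le by auto
    next
      case (Suc m)
      obtain C where "\<And>x. norm (of_real (x ^ m) * ft (Dn (Suc 0) f) x) \<le> C"
        using Suc.IH[OF schwartz_Dn[OF Suc.prems]] by blast
      moreover have "norm (of_real (x ^ Suc m) * ft f x) = norm (of_real (x ^ m) * ft (Dn (Suc 0) f) x)" for x
      proof -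
        have "of_real (x ^ Suc m) * ft f x = of_real (x ^ m) * (of_real x * ft f x)" by simp
        also have "\<dots> = \<i> * (of_real (x ^ m) * ft (Dn (Suc 0) f) x)"
          unfolding ft_derivative[OF Suc.prems] by simp
        finally have "norm (of_real (x ^ Suc m) * ft f x) = norm (\<i> * (of_real (x ^ m) * ft (Dn (Suc 0) f) x))"
          by (rule arg_cong)
        then show ?thesis unfolding norm_mult[of \<i>] by simp
      qed
      ultimately show ?case by auto
    qed
    then show ?thesis unfolding bounded_iff f(2) by blast
  qed
qed (use assms in auto)

lemma schwartz_cnj:
  assumes "f \<in> schwartz"
  shows "(\<lambda>x. cnj (f x)) \<in> schwartz"
proof (rule deriv_closed_schwartz)
  show "deriv_closed ((\<lambda>f x. cnj (f x)) ` schwartz)"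
  proof (rule deriv_closedI)
    fix g assume "g \<in> (\<lambda>f x. cnj (f x)) ` schwartz"
    then obtain f where f: "f \<in> schwartz" "g = (\<lambda>x. cnj (f x))" by auto
    then show "\<exists>g'. g' \<in> (\<lambda>f x. cnj (f x)) ` schwartz \<and> (\<forall>x. (g has_vector_derivative g' x) (at x))"
      using schwartz_Dn[OF f(1), of "Suc 0"] schwartz_has_vector_derivative[OF f(1)]
      by (intro exI[of _ "\<lambda>x. cnj (Dn (Suc 0) f x)"]) (auto intro: has_vector_derivative_cnj)
  qed
  fix g m assume "g \<in> (\<lambda>f x. cnj (f x)) ` schwartz"
  then obtain f where f: "f \<in> schwartz" "g = (\<lambda>x. cnj (f x))" by auto
  obtain C where "\<And>x. norm (of_real (x ^ m) * f x) \<le> C"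
    using schwartz_bounded[OF f(1), of m] unfolding bounded_iff by blast
  then have "norm (of_real (x ^ m) * g x) \<le> C" for x
    unfolding f(2) by (metis complex_mod_cnj norm_mult)
  then show "bounded (range (\<lambda>x. of_real (x ^ m) * g x))"
    unfolding bounded_iff by blast
qed (use assms in auto)

text \<open>Both sides are iterated integrals of a(xi) exp (i xi x) b(x), whose modulus |a(xi)|
  |b(x)| is integrable on the plane.\<close>

lemma ft_multiplication_formula:
  assumes a: "integrable lborel a" and b: "integrable lborel b"
  shows "(LINT x|lborel. ft a x * b x) = (LINT x|lborel. a x * ft b x)"
proof -
  have [measurable]: "a \<in> borel_measurable borel" "b \<in> borel_measurable borel"
    using a b by auto
  let ?K = "\<lambda>\<xi> x. iexp (\<xi> * x) * a \<xi> * b x"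
  have "integrable (lborel \<Otimes>\<^sub>M lborel) (\<lambda>(\<xi>, x). ?K \<xi> x)"
  proof (rule lborel_pair.Fubini_integrable)
    show "integrable lborel (\<lambda>\<xi>. LINT x|lborel. norm (case (\<xi>, x) of (\<xi>, x) \<Rightarrow> ?K \<xi> x))"
      using a by (simp add: norm_mult del: of_real_mult)
    show "AE \<xi> in lborel. integrable lborel (\<lambda>x. case (\<xi>, x) of (\<xi>, x) \<Rightarrow> ?K \<xi> x)"
    proof (rule AE_I2)
      fix \<xi>
      have "integrable lborel (\<lambda>x. a \<xi> * (iexp (x * \<xi>) * b x))"
        by (intro integrable_mult_right integrable_exp_i_mult b)
      then show "integrable lborel (\<lambda>x. case (\<xi>, x) of (\<xi>, x) \<Rightarrow> ?K \<xi> x)"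
        by (simp add: mult_ac)
    qed
  qed measurable
  from lborel_pair.Fubini_integral[OF this]
  have "(LINT x|lborel. LINT \<xi>|lborel. ?K \<xi> x) = (LINT \<xi>|lborel. LINT x|lborel. ?K \<xi> x)"
    by (simp only: prod.case)
  moreover have e1: "(LINT \<xi>|lborel. ?K \<xi> x) = ft a x * b x" for x
    unfolding ft_def by simp
  moreover have e2: "(LINT x|lborel. ?K \<xi> x) = a \<xi> * ft b \<xi>" for \<xi>
  proof -
    have "(LINT x|lborel. ?K \<xi> x) = (LINT x|lborel. a \<xi> * (iexp (x * \<xi>) * b x))"
      by (simp add: mult_ac)
    then show ?thesis unfolding ft_def by simp
  qed
  ultimately show ?thesis by (simp only: e1 e2)
qed

lemma ft_scale:
  assumes "c > 0"
  shows "ft (\<lambda>\<xi>. f (c * \<xi>)) x = of_real (inverse c) * ft f (x / c)"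
proof -
  have "ft f (x / c) = of_real c * ft (\<lambda>\<xi>. f (c * \<xi>)) x"
    unfolding ft_def
    using lborel_integral_real_affine[of c "\<lambda>\<xi>. iexp (\<xi> * (x / c)) * f \<xi>" 0] assms
    by (simp add: scaleR_conv_of_real)
  then show ?thesis using assms by (simp add: field_simps)
qed

lemma ft_modulate: "ft (\<lambda>\<xi>. iexp (\<xi> * t) * f \<xi>) x = ft f (x + t)"
  unfolding ft_def by (rule Bochner_Integration.integral_cong) (auto simp: exp_add distrib_left mult_ac)

section \<open>Fourier inversion\<close>

lemma exp_minus_abs_le: "exp (- \<bar>x\<bar>) \<le> 2 * inverse (1 + x\<^sup>2)" for x :: real
proof -
  have "(1 + x\<^sup>2) / 2 \<le> exp \<bar>x\<bar>"
    using exp_lower_Taylor_quadratic[of "\<bar>x\<bar>"] by simp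
  then show ?thesis
    using add_pos_nonneg[OF zero_less_one zero_le_power2[of x]] by (simp add: exp_minus field_simps)
qed

lemma integrable_exp_minus_abs: "integrable lborel (\<lambda>x. complex_of_real (exp (- \<bar>x\<bar>)))"
  by (rule bounded_by_inverse_1_plus_integrable[where C = 2]) (use exp_minus_abs_le in auto)

lemma exp_complex_has_vector_derivative:
  "((\<lambda>x. exp (c * of_real x)) has_vector_derivative c * exp (c * of_real x)) (at x)"
  for c :: complex
proof -
  have "((\<lambda>z. exp (c * z)) has_field_derivative c * exp (c * of_real x)) (at (of_real x))"
    by (auto intro!: derivative_eq_intros)
  from has_vector_derivative_real_field[OF this] show ?thesis by (simp add: o_def)
qed

text \<open>Split at 0, the integrand is a pure exponential on each half line, with exponent (i t +
  1) xi on the left and (i t - 1) xi on the right; the halves contribute 1 / (i t + 1) and - 1 / (i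
  t - 1).\<close>

lemma ft_exp_minus_abs: "ft (\<lambda>x. of_real (exp (- \<bar>x\<bar>))) t = of_real (2 * inverse (1 + t\<^sup>2))"
proof -
  let ?f = "\<lambda>\<xi>. iexp (\<xi> * t) * complex_of_real (exp (- \<bar>\<xi>\<bar>))"
  let ?c = "\<i> * of_real t - 1" and ?d = "\<i> * of_real t + 1"
  have nz: "?c \<noteq> 0" "?d \<noteq> 0" by (auto simp: complex_eq_iff)
  have int: "integrable lborel ?f"
    by (rule integrable_exp_i_mult[OF integrable_exp_minus_abs])
  have sint: "set_integrable lborel A ?f" if "A \<in> sets borel" for A
    unfolding set_integrable_def using that by (intro integrable_mult_indicator int) auto
  have fpos: "?f \<xi> = exp (?c * of_real \<xi>)" if "\<xi> > 0" for \<xi>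
    using that by (simp add: exp_of_real exp_minus exp_diff exp_add ring_distribs divide_inverse mult_ac flip: of_real_inverse)
  have fneg: "?f \<xi> = exp (?d * of_real \<xi>)" if "\<xi> < 0" for \<xi>
    using that by (simp add: exp_of_real exp_minus exp_diff exp_add ring_distribs divide_inverse mult_ac flip: of_real_inverse)
  have l0: "((\<lambda>x. exp (c * of_real x) / c) \<longlongrightarrow> 1 / c) (at 0 within S)" if "c \<noteq> 0" for c :: complex and S :: "real set"
    using that by (auto intro!: tendsto_eq_intros)
  have "(LBINT \<xi>=0..\<infinity>. ?f \<xi>) = (LBINT \<xi>=0..\<infinity>. exp (?c * of_real \<xi>))"
    by (rule interval_integral_cong, rule fpos) (auto simp: einterval_iff zero_ereal_def)
  also have "\<dots> = 0 - 1 / ?c"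
  proof (rule interval_integral_FTC_integrable)
    show "((\<lambda>x. exp (?c * of_real x) / ?c) has_vector_derivative exp (?c * of_real \<xi>)) (at \<xi>)" for \<xi>
      using has_vector_derivative_divide[OF exp_complex_has_vector_derivative[of ?c \<xi>], of ?c] nz by simp
    show "set_integrable lborel (einterval 0 \<infinity>) (\<lambda>\<xi>. exp (?c * of_real \<xi>))"
      by (rule set_integrable_cong[THEN iffD1, OF refl refl _ sint], rule fpos) (auto simp: einterval_iff zero_ereal_def)
    show "(((\<lambda>x. exp (?c * of_real x) / ?c) \<circ> real_of_ereal) \<longlongrightarrow> 1 / ?c) (at_right 0)"
      using l0 nz by (auto simp: zero_ereal_def ereal_tendsto_simps)
    have "((\<lambda>x::real. exp (- x) / norm ?c) \<longlongrightarrow> 0) at_top" by real_asymp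
    then have "((\<lambda>x. exp (?c * of_real x) / ?c) \<longlongrightarrow> 0) at_top"
      by (rule Lim_null_comparison[rotated]) (auto simp: norm_divide)
    then show "(((\<lambda>x. exp (?c * of_real x) / ?c) \<circ> real_of_ereal) \<longlongrightarrow> 0) (at_left \<infinity>)"
      by (simp add: ereal_tendsto_simps)
  qed auto
  finally have pos: "(LBINT \<xi>=0..\<infinity>. ?f \<xi>) = - 1 / ?c" by simp
  have "(LBINT \<xi>=-\<infinity>..0. ?f \<xi>) = (LBINT \<xi>=-\<infinity>..0. exp (?d * of_real \<xi>))"
    by (rule interval_integral_cong, rule fneg) (auto simp: einterval_iff zero_ereal_def)
  also have "\<dots> = 1 / ?d - 0"
  proof (rule interval_integral_FTC_integrable)
    show "((\<lambda>x. exp (?d * of_real x) / ?d) has_vector_derivative exp (?d * of_real \<xi>)) (at \<xi>)" for \<xi>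
      using has_vector_derivative_divide[OF exp_complex_has_vector_derivative[of ?d \<xi>], of ?d] nz by simp
    show "set_integrable lborel (einterval (-\<infinity>) 0) (\<lambda>\<xi>. exp (?d * of_real \<xi>))"
      by (rule set_integrable_cong[THEN iffD1, OF refl refl _ sint], rule fneg) (auto simp: einterval_iff zero_ereal_def)
    show "(((\<lambda>x. exp (?d * of_real x) / ?d) \<circ> real_of_ereal) \<longlongrightarrow> 1 / ?d) (at_left 0)"
      using l0 nz by (auto simp: zero_ereal_def ereal_tendsto_simps)
    have "((\<lambda>x::real. exp x / norm ?d) \<longlongrightarrow> 0) at_bot"
      using tendsto_divide[OF exp_at_bot tendsto_const, of "norm ?d"] nz by simp
    then have "((\<lambda>x. exp (?d * of_real x) / ?d) \<longlongrightarrow> 0) at_bot"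
      by (rule Lim_null_comparison[rotated]) (auto simp: norm_divide)
    then show "(((\<lambda>x. exp (?d * of_real x) / ?d) \<circ> real_of_ereal) \<longlongrightarrow> 0) (at_right (-\<infinity>))"
      by (simp add: ereal_tendsto_simps)
  qed auto
  finally have neg: "(LBINT \<xi>=-\<infinity>..0. ?f \<xi>) = 1 / ?d" by simp
  have "ft (\<lambda>x. of_real (exp (- \<bar>x\<bar>))) t = (LBINT \<xi>=-\<infinity>..\<infinity>. ?f \<xi>)"
    by (simp add: ft_def interval_lebesgue_integral_def set_lebesgue_integral_def)
  also have "\<dots> = (LBINT \<xi>=-\<infinity>..0. ?f \<xi>) + (LBINT \<xi>=0..\<infinity>. ?f \<xi>)"
    by (rule interval_integral_sum[symmetric]) (use sint in \<open>auto simp: interval_lebesgue_integrable_def\<close>)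
  also have "\<dots> = 1 / ?d - 1 / ?c" unfolding pos neg by simp
  also have "\<dots> = of_real (2 * inverse (1 + t\<^sup>2))"
  proof -
    have "?d * ?c = - of_real (1 + t\<^sup>2)" by (simp add: algebra_simps power2_eq_square)
    moreover have "1 / ?d - 1 / ?c = (?c - ?d) / (?d * ?c)" using nz by (simp add: field_simps)
    ultimately have "1 / ?d - 1 / ?c = (?c - ?d) / (- of_real (1 + t\<^sup>2))" by simp
    also have "\<dots> = (?d - ?c) / of_real (1 + t\<^sup>2)"
      using minus_divide_divide[of "?d - ?c" "of_real (1 + t\<^sup>2)"] by simp
    also have "?d - ?c = 2" by simp
    finally show ?thesis by (simp add: divide_inverse)
  qed
  finally show ?thesis .
qed

text \<open>Abel summation: \<open>ft f\<close> is damped by \<open>P n\<close>, which tends to 1.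
  The multiplication formula moves the transform onto the damping factor and produces a Poisson
  kernel concentrating at x. After the substitution y = x + u / (n + 1), continuity and boundedness
  of \<open>f\<close> give the limit f(x) times the integral of 2 / (1 + u^2), which is 2
  pi.\<close>

lemma fourier_inversion:
  assumes f: "integrable lborel f" and F: "integrable lborel (ft f)"
    and cont: "continuous_on UNIV f" and bd: "\<And>x. norm (f x) \<le> B"
  shows "ft (ft f) (- x) = 2 * of_real pi * f x"
proof -
  have [measurable]: "f \<in> borel_measurable borel" "ft f \<in> borel_measurable borel"
    using f F by auto
  define P where "P n \<xi> = complex_of_real (exp (- \<bar>inverse (real (Suc n)) * \<xi>\<bar>))" for n and \<xi> :: real
  have P: "integrable lborel (P n)" for n
    using lborel_integrable_real_affine[OF integrable_exp_minus_abs, of "inverse (real (Suc n))" 0]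
    by (simp add: P_def[abs_def])
  have [measurable]: "P n \<in> borel_measurable borel" for n unfolding P_def by measurable
  have Pbd: "norm (P n \<xi>) \<le> 1" for n \<xi> by (simp add: P_def)
  have Plim: "(\<lambda>n. P n \<xi>) \<longlonglongrightarrow> 1" for \<xi>
  proof -
    have "(\<lambda>n. exp (- \<bar>inverse (real (Suc n)) * \<xi>\<bar>)) \<longlonglongrightarrow> exp (- \<bar>0 * \<xi>\<bar>)"
      by (intro tendsto_intros LIMSEQ_inverse_real_of_nat)
    then show ?thesis unfolding P_def by (metis abs_0 exp_zero minus_zero mult_zero_left of_real_1 tendsto_of_real)
  qed
  have lhs: "(\<lambda>n. LINT \<xi>|lborel. ft f \<xi> * (iexp (\<xi> * (- x)) * P n \<xi>)) \<longlonglongrightarrow> (LINT \<xi>|lborel. ft f \<xi> * (iexp (\<xi> * (- x)) * 1))"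
  proof (rule integral_dominated_convergence)
    show "integrable lborel (\<lambda>\<xi>. norm (ft f \<xi>))" using F by (rule integrable_norm)
    show "AE \<xi> in lborel. norm (ft f \<xi> * (iexp (\<xi> * (- x)) * P n \<xi>)) \<le> norm (ft f \<xi>)" for n
      using mult_left_mono[OF Pbd norm_ge_zero] by (intro AE_I2) (simp add: norm_mult del: of_real_mult)
    show "AE \<xi> in lborel. (\<lambda>n. ft f \<xi> * (iexp (\<xi> * (- x)) * P n \<xi>)) \<longlonglongrightarrow> ft f \<xi> * (iexp (\<xi> * (- x)) * 1)"
      by (intro AE_I2 tendsto_intros Plim)
  qed measurable
  have eq: "(LINT \<xi>|lborel. ft f \<xi> * (iexp (\<xi> * (- x)) * P n \<xi>))
      = (LINT u|lborel. f (x + inverse (real (Suc n)) * u) * of_real (2 * inverse (1 + u\<^sup>2)))" for n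
  proof -
    have ftP: "ft (\<lambda>\<xi>. iexp (\<xi> * (- x)) * P n \<xi>) y = of_real (real (Suc n)) * of_real (2 * inverse (1 + (real (Suc n) * (y - x))\<^sup>2))" for y
      unfolding ft_modulate
      using ft_scale[of "inverse (real (Suc n))" "\<lambda>\<xi>. of_real (exp (- \<bar>\<xi>\<bar>))" "y - x"]
      by (simp add: P_def ft_exp_minus_abs divide_inverse mult.commute del: of_nat_Suc)
    have "(LINT \<xi>|lborel. ft f \<xi> * (iexp (\<xi> * (- x)) * P n \<xi>)) = (LINT y|lborel. f y * ft (\<lambda>\<xi>. iexp (\<xi> * (- x)) * P n \<xi>) y)"
      by (rule ft_multiplication_formula[OF f integrable_exp_i_mult[OF P]])
    also have "\<dots> = (LINT u|lborel. f (x + inverse (real (Suc n)) * u) * of_real (2 * inverse (1 + u\<^sup>2)))"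
      unfolding ftP
      by (subst lborel_integral_real_affine[of "inverse (real (Suc n))" _ x])
         (auto simp: scaleR_conv_of_real field_simps simp del: of_nat_Suc integral_mult_right_zero integral_mult_left_zero
           simp flip: integral_mult_right_zero)
    finally show ?thesis .
  qed
  have rhs: "(\<lambda>n. LINT u|lborel. f (x + inverse (real (Suc n)) * u) * of_real (2 * inverse (1 + u\<^sup>2)))
     \<longlonglongrightarrow> (LINT u|lborel. f x * of_real (2 * inverse (1 + u\<^sup>2)))"
  proof (rule integral_dominated_convergence)
    show "integrable lborel (\<lambda>u::real. B * (2 * inverse (1 + u\<^sup>2)))"
      by (intro integrable_mult_right integrable_inverse_1_plus_power2)
    show "AE u in lborel. norm (f (x + inverse (real (Suc n)) * u) * of_real (2 * inverse (1 + u\<^sup>2))) \<le> B * (2 * inverse (1 + u\<^sup>2))" for n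
    proof (rule AE_I2)
      fix u :: real
      have "norm (complex_of_real (2 * inverse (1 + u\<^sup>2))) = 2 * inverse (1 + u\<^sup>2)"
        unfolding norm_of_real by (simp add: add_nonneg_nonneg)
      then show "norm (f (x + inverse (real (Suc n)) * u) * of_real (2 * inverse (1 + u\<^sup>2))) \<le> B * (2 * inverse (1 + u\<^sup>2))"
        unfolding norm_mult by (simp add: mult_right_mono bd)
    qed
    show "AE u in lborel. (\<lambda>n. f (x + inverse (real (Suc n)) * u) * of_real (2 * inverse (1 + u\<^sup>2))) \<longlonglongrightarrow> f x * of_real (2 * inverse (1 + u\<^sup>2))"
    proof (rule AE_I2, rule tendsto_mult_right)
      fix u :: real
      have "(\<lambda>n. x + inverse (real (Suc n)) * u) \<longlonglongrightarrow> x + 0 * u"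
        by (intro tendsto_intros LIMSEQ_inverse_real_of_nat)
      then have "(\<lambda>n. x + inverse (real (Suc n)) * u) \<longlonglongrightarrow> x" by simp
      moreover have "isCont f x" using cont by (simp add: continuous_on_eq_continuous_at)
      ultimately show "(\<lambda>n. f (x + inverse (real (Suc n)) * u)) \<longlonglongrightarrow> f x"
        by (rule isCont_tendsto_compose[rotated])
    qed
  qed measurable
  have "(LINT u|lborel. f x * of_real (2 * inverse (1 + u\<^sup>2))) = f x * of_real (LINT u|lborel. 2 * inverse (1 + u\<^sup>2))"
    by (simp only: integral_mult_right_zero integral_complex_of_real)
  also have "\<dots> = 2 * of_real pi * f x"
    by (simp add: integral_inverse_1_plus_power2)
  finally have "(LINT u|lborel. f x * of_real (2 * inverse (1 + u\<^sup>2))) = 2 * of_real pi * f x" .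
  moreover have "(LINT \<xi>|lborel. ft f \<xi> * (iexp (\<xi> * (- x)) * 1)) = ft (ft f) (- x)"
    by (simp add: ft_def mult.commute)
  ultimately show ?thesis
    using LIMSEQ_unique[OF lhs[unfolded eq] rhs] by simp
qed

lemma schwartz_fourier_inversion: "f \<in> schwartz \<Longrightarrow> ft (ft f) (- x) = 2 * of_real pi * f x"
proof -
  assume f: "f \<in> schwartz"
  obtain B where "\<And>x. norm (f x) \<le> B"
    using schwartz_bounded[OF f, of 0] unfolding bounded_iff by auto
  then show ?thesis
    using f by (intro fourier_inversion) (auto intro: schwartz_integrable schwartz_ft smooth_continuous_on schwartz_smooth)
qed

text \<open>Inversion applied to exp (- |x|), whose transform is 2 / (1 + t^2). Up to a constant the
  result is the Green function of 1 - d^2/dx^2, and the potentials of the deltas come from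
  it.\<close>

lemma ft_inverse_1_plus_power2: "ft (\<lambda>\<xi>. of_real (inverse (1 + \<xi>\<^sup>2))) x = of_real (pi * exp (- \<bar>x\<bar>))"
proof -
  let ?f = "\<lambda>x. complex_of_real (exp (- \<bar>x\<bar>))"
  have ft: "ft ?f = (\<lambda>t. 2 * of_real (inverse (1 + t\<^sup>2)))"
    using ft_exp_minus_abs by (auto simp del: of_real_inverse)
  have "ft (ft ?f) (- (- x)) = 2 * of_real pi * ?f (- x)"
  proof (rule fourier_inversion)
    show "integrable lborel (ft ?f)"
      unfolding ft by (intro integrable_mult_right integrable_of_real integrable_inverse_1_plus_power2)
    show "norm (?f x) \<le> 1" for x by simp
  qed (auto intro!: integrable_exp_minus_abs continuous_intros)
  moreover have "ft (ft ?f) x = 2 * ft (\<lambda>\<xi>. of_real (inverse (1 + \<xi>\<^sup>2))) x"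
    unfolding ft unfolding ft_def by (subst integral_mult_right_zero[symmetric]) (simp add: mult_ac)
  ultimately show ?thesis by simp
qed

text \<open>\<open>k\<close> may be discontinuous, so the pointwise inversion theorem does not reach
  it. Tested against a Schwartz function, two uses of the multiplication formula move both
  transforms onto the test function, where inversion is available.\<close>

lemma ft_inversion_AE:
  assumes k: "integrable lborel k" and h: "integrable lborel (ft k)"
  shows "AE \<xi> in lborel. ft (ft k) (- \<xi>) = 2 * of_real pi * k \<xi>"
proof -
  have [measurable]: "k \<in> borel_measurable borel" "ft (ft k) \<in> borel_measurable borel"
    using k h by auto
  let ?g = "\<lambda>\<xi>. ft (ft k) (- \<xi>) - 2 * of_real pi * k \<xi>"
  have "AE \<xi> in lborel. ?g \<xi> = 0"
  proof (rule fundamental_lemma)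
    fix f assume f: "f \<in> schwartz"
    \<comment> \<open>Taking conjugation and reflection into \<open>c\<close> writes the test factor
      cnj (f xi) as c (- xi), matching the reflection in the claim.\<close>
    define c where "c \<xi> = cnj (f (- \<xi>))" for \<xi>
    have c: "c \<in> schwartz" unfolding c_def by (intro schwartz_cnj schwartz_reflect f)
    have cm [measurable]: "c \<in> borel_measurable borel" using c by auto
    have cf: "cnj (f \<xi>) = c (- \<xi>)" for \<xi> by (simp add: c_def)
    obtain B where B: "\<And>x. norm (c x) \<le> B"
      using schwartz_bounded[OF c, of 0] unfolding bounded_iff by auto
    have kc: "integrable lborel (\<lambda>\<xi>. k \<xi> * c (- \<xi>))"
    proof (rule Bochner_Integration.integrable_bound)
      show "integrable lborel (\<lambda>\<xi>. B * norm (k \<xi>))" using k by auto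
      show "AE \<xi> in lborel. norm (k \<xi> * c (- \<xi>)) \<le> norm (B * norm (k \<xi>))"
      proof (rule AE_I2)
        fix \<xi>
        have "norm (k \<xi>) * norm (c (- \<xi>)) \<le> norm (k \<xi>) * \<bar>B\<bar>"
          using B[of "- \<xi>"] by (intro mult_left_mono) auto
        then show "norm (k \<xi> * c (- \<xi>)) \<le> norm (B * norm (k \<xi>))"
          by (simp add: norm_mult abs_mult mult.commute)
      qed
    qed measurable
    have hc: "integrable lborel (\<lambda>\<xi>. ft (ft k) \<xi> * c \<xi>)"
    proof (rule Bochner_Integration.integrable_bound)
      show "integrable lborel (\<lambda>\<xi>. (LINT x|lborel. norm (ft k x)) * norm (c \<xi>))"
        using schwartz_integrable[OF c] by auto
      show "AE \<xi> in lborel. norm (ft (ft k) \<xi> * c \<xi>) \<le> norm ((LINT x|lborel. norm (ft k x)) * norm (c \<xi>))"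
        by (intro AE_I2) (auto simp: norm_mult abs_mult intro!: mult_right_mono order_trans[OF norm_ft_le])
    qed measurable
    have hc': "integrable lborel (\<lambda>\<xi>. ft (ft k) (- \<xi>) * c (- \<xi>))"
      using lborel_integrable_real_affine[OF hc, of "-1" 0] by simp
    show "integrable lborel (\<lambda>\<xi>. ?g \<xi> * cnj (f \<xi>))"
      using Bochner_Integration.integrable_diff[OF hc' integrable_mult_right[OF kc, of "2 * of_real pi"]]
      by (simp add: cf left_diff_distrib mult.assoc)
    have "(LINT \<xi>|lborel. ft (ft k) (- \<xi>) * c (- \<xi>)) = (LINT \<xi>|lborel. ft (ft k) \<xi> * c \<xi>)"
      using lborel_integral_real_affine[of "-1" "\<lambda>\<xi>. ft (ft k) \<xi> * c \<xi>" 0] by simp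
    also have "\<dots> = (LINT x|lborel. ft k x * ft c x)"
      by (rule ft_multiplication_formula[OF h schwartz_integrable[OF c]])
    also have "\<dots> = (LINT x|lborel. k x * ft (ft c) x)"
      by (rule ft_multiplication_formula[OF k schwartz_integrable[OF schwartz_ft[OF c]]])
    also have "\<dots> = (LINT x|lborel. 2 * of_real pi * (k x * c (- x)))"
      using schwartz_fourier_inversion[OF c, of "- x" for x] by (simp add: mult_ac)
    also have "\<dots> = 2 * of_real pi * (LINT x|lborel. k x * c (- x))" by simp
    finally show "(LINT \<xi>|lborel. ?g \<xi> * cnj (f \<xi>)) = 0"
      using hc' kc by (simp add: cf left_diff_distrib mult.assoc)
  qed measurable
  then show ?thesis by simp
qed

section \<open>Functionals in \<open>Hm1\<close> and their pairings\<close>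

lemma borel_measurable_cnj [measurable (raw)]:
  "f \<in> borel_measurable M \<Longrightarrow> (\<lambda>x. cnj (f x)) \<in> borel_measurable M"
  by (rule borel_measurable_continuous_on) (auto intro!: continuous_intros)

lemma represents_measurable [measurable_dest]: "represents g u \<Longrightarrow> g \<in> borel_measurable borel"
  by (simp add: represents_def)

lemma representsD:
  assumes "represents g u" "f \<in> schwartz"
  shows "integrable lborel (\<lambda>\<xi>. g \<xi> * cnj (f \<xi>))" "u f = (LINT \<xi>|lborel. g \<xi> * cnj (f \<xi>))"
  using assms by (auto simp: represents_def)

lemma represents_unique:
  assumes g: "represents g u" and h: "represents h u"
  shows "AE \<xi> in lborel. g \<xi> = h \<xi>"
proof -
  have [measurable]: "g \<in> borel_measurable borel" "h \<in> borel_measurable borel"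
    using g h by (auto dest: represents_measurable)
  have "AE \<xi> in lborel. g \<xi> - h \<xi> = 0"
  proof (rule fundamental_lemma)
    fix f assume f: "f \<in> schwartz"
    show "integrable lborel (\<lambda>\<xi>. (g \<xi> - h \<xi>) * cnj (f \<xi>))"
      using representsD(1)[OF g f] representsD(1)[OF h f] by (simp add: left_diff_distrib)
    show "(LINT \<xi>|lborel. (g \<xi> - h \<xi>) * cnj (f \<xi>)) = 0"
      using representsD[OF g f] representsD[OF h f] by (simp add: left_diff_distrib)
  qed measurable
  then show ?thesis by simp
qed

lemma represents_fhat: "represents g (fourier_dist u) \<Longrightarrow> represents (fhat u) (fourier_dist u)"
  unfolding fhat_def by (rule someI[where P = "\<lambda>g. represents g (fourier_dist u)"])

lemma fhat_AE: "represents g (fourier_dist u) \<Longrightarrow> AE \<xi> in lborel. fhat u \<xi> = g \<xi>"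
  by (rule represents_unique[OF represents_fhat])

text \<open>The condition on transforms of elements of \<open>Hm1\<close>. The dual weight 1 + xi^2,
  which characterises transforms of H^1 functions, is written out wherever it occurs.\<close>

definition weighted_L2 :: "(real \<Rightarrow> complex) \<Rightarrow> bool" where
  "weighted_L2 g \<longleftrightarrow> g \<in> borel_measurable borel \<and>
     integrable lborel (\<lambda>\<xi>. inverse (1 + \<xi>\<^sup>2) * (norm (g \<xi>))\<^sup>2)"

lemma one_plus_power2_pos [simp]: "0 < 1 + (x::real)\<^sup>2"
  by (simp add: add_pos_nonneg)

lemma one_plus_power2_nz [simp]: "1 + (x::real)\<^sup>2 \<noteq> 0"
  using one_plus_power2_pos[of x] by linarith

lemma weighted_L2_measurable [measurable_dest]: "weighted_L2 g \<Longrightarrow> g \<in> borel_measurable borel"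
  by (simp add: weighted_L2_def)

lemma weighted_L2_integrable:
  "weighted_L2 g \<Longrightarrow> integrable lborel (\<lambda>\<xi>. inverse (1 + \<xi>\<^sup>2) * (norm (g \<xi>))\<^sup>2)"
  by (simp add: weighted_L2_def)

lemma weighted_L2_bounded:
  assumes [measurable]: "g \<in> borel_measurable borel" and "\<And>\<xi>. norm (g \<xi>) \<le> B"
  shows "weighted_L2 g"
  unfolding weighted_L2_def
proof
  show "integrable lborel (\<lambda>\<xi>. inverse (1 + \<xi>\<^sup>2) * (norm (g \<xi>))\<^sup>2)"
  proof (rule Bochner_Integration.integrable_bound)
    show "integrable lborel (\<lambda>\<xi>::real. B\<^sup>2 * inverse (1 + \<xi>\<^sup>2))"
      by (intro integrable_mult_right integrable_inverse_1_plus_power2)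
    show "AE \<xi> in lborel. norm (inverse (1 + \<xi>\<^sup>2) * (norm (g \<xi>))\<^sup>2) \<le> norm (B\<^sup>2 * inverse (1 + \<xi>\<^sup>2))"
    proof (rule AE_I2)
      fix \<xi>
      have "(norm (g \<xi>))\<^sup>2 * inverse (1 + \<xi>\<^sup>2) \<le> B\<^sup>2 * inverse (1 + \<xi>\<^sup>2)"
        using assms(2)[of \<xi>] by (intro mult_right_mono power_mono) (auto simp: less_imp_le)
      then show "norm (inverse (1 + \<xi>\<^sup>2) * (norm (g \<xi>))\<^sup>2) \<le> norm (B\<^sup>2 * inverse (1 + \<xi>\<^sup>2))"
        by (simp add: abs_mult less_imp_le mult.commute)
    qed
  qed measurable
qed measurable

lemma norm_add_sq_le: "(norm (x + y))\<^sup>2 \<le> 2 * (norm x)\<^sup>2 + 2 * (norm (y :: 'a :: real_normed_vector))\<^sup>2"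
proof -
  have "(norm (x + y))\<^sup>2 \<le> (norm x + norm y)\<^sup>2"
    by (intro power_mono norm_triangle_ineq) auto
  also have "\<dots> \<le> 2 * (norm x)\<^sup>2 + 2 * (norm y)\<^sup>2"
    using zero_le_power2[of "norm x - norm y"] by (simp add: power2_eq_square algebra_simps)
  finally show ?thesis .
qed

lemma weighted_L2_lincomb:
  assumes f: "weighted_L2 f" and g: "weighted_L2 g"
  shows "weighted_L2 (\<lambda>\<xi>. f \<xi> + c * g \<xi>)"
  unfolding weighted_L2_def
proof
  have [measurable]: "f \<in> borel_measurable borel" "g \<in> borel_measurable borel"
    using f g by (auto dest: weighted_L2_measurable)
  show "(\<lambda>\<xi>. f \<xi> + c * g \<xi>) \<in> borel_measurable borel" by measurable
  show "integrable lborel (\<lambda>\<xi>. inverse (1 + \<xi>\<^sup>2) * (norm (f \<xi> + c * g \<xi>))\<^sup>2)"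
  proof (rule Bochner_Integration.integrable_bound)
    show "integrable lborel (\<lambda>\<xi>. 2 * (inverse (1 + \<xi>\<^sup>2) * (norm (f \<xi>))\<^sup>2) + 2 * (norm c)\<^sup>2 * (inverse (1 + \<xi>\<^sup>2) * (norm (g \<xi>))\<^sup>2))"
      by (intro Bochner_Integration.integrable_add integrable_mult_right weighted_L2_integrable f g)
    show "AE \<xi> in lborel. norm (inverse (1 + \<xi>\<^sup>2) * (norm (f \<xi> + c * g \<xi>))\<^sup>2) \<le>
       norm (2 * (inverse (1 + \<xi>\<^sup>2) * (norm (f \<xi>))\<^sup>2) + 2 * (norm c)\<^sup>2 * (inverse (1 + \<xi>\<^sup>2) * (norm (g \<xi>))\<^sup>2))"
    proof (rule AE_I2)
      fix \<xi>
      have "inverse (1 + \<xi>\<^sup>2) * (norm (f \<xi> + c * g \<xi>))\<^sup>2 \<le> inverse (1 + \<xi>\<^sup>2) * (2 * (norm (f \<xi>))\<^sup>2 + 2 * (norm (c * g \<xi>))\<^sup>2)"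
        by (intro mult_left_mono norm_add_sq_le) (auto simp: less_imp_le)
      also have "\<dots> = 2 * (inverse (1 + \<xi>\<^sup>2) * (norm (f \<xi>))\<^sup>2) + 2 * (norm c)\<^sup>2 * (inverse (1 + \<xi>\<^sup>2) * (norm (g \<xi>))\<^sup>2)"
        by (simp add: norm_mult power_mult_distrib algebra_simps)
      finally show "norm (inverse (1 + \<xi>\<^sup>2) * (norm (f \<xi> + c * g \<xi>))\<^sup>2) \<le>
       norm (2 * (inverse (1 + \<xi>\<^sup>2) * (norm (f \<xi>))\<^sup>2) + 2 * (norm c)\<^sup>2 * (inverse (1 + \<xi>\<^sup>2) * (norm (g \<xi>))\<^sup>2))"
        by (simp add: abs_mult less_imp_le)
    qed
  qed measurable
qed

text \<open>Expand the square (t x - w y)^2 / (2 t w) with w = 1 + xi^2. The free parameter serves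
  two ends: t = 1 gives integrability of pairings, and a large t makes the last term small in a
  limit.\<close>

lemma weighted_young:
  fixes t x y \<xi> :: real
  assumes "0 < t"
  shows "x * y \<le> t / 2 * (inverse (1 + \<xi>\<^sup>2) * x\<^sup>2) + (1 + \<xi>\<^sup>2) * y\<^sup>2 / (2 * t)"
proof -
  define w where "w = 1 + \<xi>\<^sup>2"
  have w: "w > 0" by (simp add: w_def)
  have "0 \<le> (t * x - w * y)\<^sup>2 / (2 * t * w)"
    using assms w by (intro divide_nonneg_nonneg) auto
  also have "\<dots> = t / 2 * (inverse w * x\<^sup>2) + w * y\<^sup>2 / (2 * t) - x * y"
    using assms w by (simp add: field_simps power2_eq_square)
  finally show ?thesis by (simp add: w_def)
qed

lemma weighted_pairing_integrable:
  fixes G g :: "real \<Rightarrow> complex"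
  assumes G: "weighted_L2 G" and [measurable]: "g \<in> borel_measurable borel"
    and g: "integrable lborel (\<lambda>\<xi>. (1 + \<xi>\<^sup>2) * (norm (g \<xi>))\<^sup>2)"
  shows "integrable lborel (\<lambda>\<xi>. G \<xi> * cnj (g \<xi>))"
proof (rule Bochner_Integration.integrable_bound)
  have [measurable]: "G \<in> borel_measurable borel" using G by (rule weighted_L2_measurable)
  show "(\<lambda>\<xi>. G \<xi> * cnj (g \<xi>)) \<in> borel_measurable lborel" by measurable
  show "integrable lborel (\<lambda>\<xi>. 1 / 2 * (inverse (1 + \<xi>\<^sup>2) * (norm (G \<xi>))\<^sup>2) + (1 + \<xi>\<^sup>2) * (norm (g \<xi>))\<^sup>2 / (2 * 1))"
    by (intro Bochner_Integration.integrable_add integrable_mult_right integrable_divide weighted_L2_integrable G g)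
  show "AE \<xi> in lborel. norm (G \<xi> * cnj (g \<xi>)) \<le>
      norm (1 / 2 * (inverse (1 + \<xi>\<^sup>2) * (norm (G \<xi>))\<^sup>2) + (1 + \<xi>\<^sup>2) * (norm (g \<xi>))\<^sup>2 / (2 * 1))"
    unfolding norm_mult complex_mod_cnj real_norm_def
    by (intro AE_I2 order_trans[OF weighted_young[of 1] abs_ge_self]) simp
qed

text \<open>Multiplication by 1 / (1 + xi^2) is the Riesz map on the Fourier side: it turns the
  inner product of H^{-1} into a plain pairing with an H^1 function.\<close>

lemma weighted_L2_dual:
  assumes "weighted_L2 g"
  shows "integrable lborel (\<lambda>\<xi>. (1 + \<xi>\<^sup>2) * (norm (of_real (inverse (1 + \<xi>\<^sup>2)) * g \<xi>))\<^sup>2)"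
proof -
  have "(1 + \<xi>\<^sup>2) * (norm (of_real (inverse (1 + \<xi>\<^sup>2)) * g \<xi>))\<^sup>2 = inverse (1 + \<xi>\<^sup>2) * (norm (g \<xi>))\<^sup>2" for \<xi>
    unfolding norm_mult norm_of_real power_mult_distrib power2_abs
    by (simp add: power2_eq_square[of "inverse (1 + \<xi>\<^sup>2)"] mult.assoc[symmetric] del: inverse_mult_distrib)
  then show ?thesis using weighted_L2_integrable[OF assms] by simp
qed

lemma weighted_L2_inner_integrable:
  assumes "weighted_L2 f" "weighted_L2 g"
  shows "integrable lborel (\<lambda>\<xi>. of_real (inverse (1 + \<xi>\<^sup>2)) * f \<xi> * cnj (g \<xi>))"
proof -
  have [measurable]: "g \<in> borel_measurable borel" using assms(2) by (rule weighted_L2_measurable)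
  have "integrable lborel (\<lambda>\<xi>. f \<xi> * cnj (of_real (inverse (1 + \<xi>\<^sup>2)) * g \<xi>))"
    by (intro weighted_pairing_integrable assms weighted_L2_dual) measurable
  then show ?thesis by (simp add: mult_ac)
qed

lemma Hm1_tempered: "u \<in> Hm1 \<Longrightarrow> u \<in> tempered"
  by (simp add: Hm1_def)

lemma Hm1_iff: "u \<in> Hm1 \<longleftrightarrow> u \<in> tempered \<and> (\<exists>g. represents g (fourier_dist u) \<and> weighted_L2 g)"
  by (auto simp: Hm1_def weighted_L2_def represents_def)

lemma Hm1_represents: "u \<in> Hm1 \<Longrightarrow> represents (fhat u) (fourier_dist u)"
  using represents_fhat by (auto simp: Hm1_iff)

text \<open>Membership in \<open>Hm1\<close> only asserts that some representing function has finite
  norm; uniqueness up to null sets transfers this to the chosen \<open>fhat u\<close>.\<close>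

lemma Hm1_weighted_L2:
  assumes "u \<in> Hm1"
  shows "weighted_L2 (fhat u)"
proof -
  obtain g where g: "represents g (fourier_dist u)" "weighted_L2 g"
    using assms by (auto simp: Hm1_iff)
  have [measurable]: "g \<in> borel_measurable borel" "fhat u \<in> borel_measurable borel"
    using g(1) Hm1_represents[OF assms] by (auto dest: represents_measurable)
  have "integrable lborel (\<lambda>\<xi>. inverse (1 + \<xi>\<^sup>2) * (norm (fhat u \<xi>))\<^sup>2)
      \<longleftrightarrow> integrable lborel (\<lambda>\<xi>. inverse (1 + \<xi>\<^sup>2) * (norm (g \<xi>))\<^sup>2)"
    by (rule integrable_cong_AE) (use fhat_AE[OF g(1)] in auto)
  with g(2) show ?thesis by (simp add: weighted_L2_def)
qed

lemma Hm1_measurable [measurable_dest]: "u \<in> Hm1 \<Longrightarrow> fhat u \<in> borel_measurable borel"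
  by (rule weighted_L2_measurable[OF Hm1_weighted_L2])

section \<open>The Fourier transform on Schwartz functions and the action of functionals\<close>

lemma ft_cmult: "ft (\<lambda>\<xi>. c * f \<xi>) x = c * ft f x"
  unfolding ft_def by (subst integral_mult_right_zero[symmetric]) (simp add: mult_ac)

lemma ft_reflect: "ft (\<lambda>\<xi>. f (- \<xi>)) x = ft f (- x)"
  unfolding ft_def
  using lborel_integral_real_affine[of "-1" "\<lambda>\<xi>. exp (\<i> * of_real (\<xi> * - x)) * f \<xi>" 0] by simp

lemma ft_cong_AE:
  assumes [measurable]: "f \<in> borel_measurable borel" "g \<in> borel_measurable borel"
    and "AE \<xi> in lborel. f \<xi> = g \<xi>"
  shows "ft f x = ft g x"
  unfolding ft_def by (rule integral_cong_AE) (use assms(3) in auto)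

definition fourier :: "(real \<Rightarrow> complex) \<Rightarrow> real \<Rightarrow> complex" where
  "fourier f \<xi> = of_real (1 / sqrt (2 * pi)) * ft f (- \<xi>)"

lemma schwartz_fourier: "f \<in> schwartz \<Longrightarrow> fourier f \<in> schwartz"
  unfolding fourier_def[abs_def] by (intro schwartz_cmult schwartz_reflect[of "ft f"] schwartz_ft)

lemma inv_sqrt_2pi_sq: "complex_of_real (1 / sqrt (2 * pi)) * of_real (1 / sqrt (2 * pi)) = 1 / (2 * of_real pi)"
proof -
  have "1 / sqrt (2 * pi) * (1 / sqrt (2 * pi)) = 1 / (2 * pi)" by simp
  then have "complex_of_real (1 / sqrt (2 * pi) * (1 / sqrt (2 * pi))) = of_real (1 / (2 * pi))"
    by (rule arg_cong)
  then show ?thesis unfolding of_real_mult by simp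
qed

lemma inv_fourier_fourier:
  assumes "f \<in> schwartz"
  shows "inv_fourier (fourier f) = f"
proof
  fix x
  have "inv_fourier (fourier f) x =
      of_real (1 / sqrt (2 * pi)) * (of_real (1 / sqrt (2 * pi)) * ft (ft f) (- x))"
    unfolding inv_fourier_eq fourier_def[abs_def] ft_cmult using ft_reflect[of "ft f" x] by simp
  also have "\<dots> = f x"
    unfolding schwartz_fourier_inversion[OF assms] mult.assoc[symmetric] inv_sqrt_2pi_sq by simp
  finally show "inv_fourier (fourier f) x = f x" .
qed

lemma inv_fourier_schwartz: "f \<in> schwartz \<Longrightarrow> inv_fourier f \<in> schwartz"
  unfolding inv_fourier_eq[abs_def] by (intro schwartz_cmult schwartz_ft)

text \<open>The representation of \<open>fourier_dist u\<close> is read at \<open>fourier f\<close>,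
  which \<open>inv_fourier\<close> takes back to \<open>f\<close>.\<close>

lemma Hm1_apply:
  assumes "u \<in> Hm1" "f \<in> schwartz"
  shows "u f = (LINT \<xi>|lborel. fhat u \<xi> * cnj (fourier f \<xi>))"
  using representsD(2)[OF Hm1_represents[OF assms(1)] schwartz_fourier[OF assms(2)]] assms(2)
  by (simp add: fourier_dist_def schwartz_fourier inv_fourier_fourier)

lemma Hm1_eq_0:
  assumes u: "u \<in> Hm1" and "AE \<xi> in lborel. fhat u \<xi> = 0"
  shows "u = (\<lambda>f. 0)"
proof
  fix f
  show "u f = 0"
  proof (cases "f \<in> schwartz")
    case True
    have "u f = (LINT \<xi>|lborel. fhat u \<xi> * cnj (fourier f \<xi>))"
      by (rule Hm1_apply[OF u True])
    also have "\<dots> = 0"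
      using assms(2) by (intro integral_eq_zero_AE) auto
    finally show ?thesis .
  qed (simp add: temperedD_off[OF Hm1_tempered[OF u]])
qed

section \<open>Linear combinations, inner product and norm\<close>

lemma tempered_lincomb:
  assumes u: "u \<in> tempered" and v: "v \<in> tempered"
  shows "(\<lambda>f. u f + c * v f) \<in> tempered"
proof -
  have "continuous_map schwartz_topology euclidean (\<lambda>f. u f + c * v f)"
  proof (rule continuous_map_add)
    show "continuous_map schwartz_topology euclidean u"
      using u by (simp add: tempered_def)
    have "continuous_map schwartz_topology euclidean v"
      using v by (simp add: tempered_def)
    moreover have "continuous_map euclidean euclidean (\<lambda>z::complex. c * z)"
      by (simp add: continuous_on_mult_left)
    ultimately show "continuous_map schwartz_topology euclidean (\<lambda>f. c * v f)"
      using continuous_map_compose[of _ _ v _ "\<lambda>z. c * z"] by (simp add: o_def)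
  qed
  then show ?thesis
    using temperedD_add[OF u] temperedD_add[OF v] temperedD_mult[OF u] temperedD_mult[OF v]
      temperedD_off[OF u] temperedD_off[OF v]
    unfolding tempered_def by (simp add: algebra_simps)
qed

lemma represents_lincomb:
  assumes "represents g (fourier_dist u)" "represents h (fourier_dist v)"
  shows "represents (\<lambda>\<xi>. g \<xi> + c * h \<xi>) (fourier_dist (\<lambda>f. u f + c * v f))"
  unfolding represents_def
proof (intro conjI ballI)
  have [measurable]: "g \<in> borel_measurable borel" "h \<in> borel_measurable borel"
    using assms by (auto dest: represents_measurable)
  show "(\<lambda>\<xi>. g \<xi> + c * h \<xi>) \<in> borel_measurable borel" by measurable
  fix f assume f: "f \<in> schwartz"
  note D = representsD[OF assms(1) f] representsD[OF assms(2) f]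
  show "integrable lborel (\<lambda>\<xi>. (g \<xi> + c * h \<xi>) * cnj (f \<xi>))"
    using D(1) integrable_mult_right[OF D(3), of c] by (simp add: distrib_right mult.assoc)
  have "(LINT \<xi>|lborel. (g \<xi> + c * h \<xi>) * cnj (f \<xi>)) =
      (LINT \<xi>|lborel. g \<xi> * cnj (f \<xi>)) + c * (LINT \<xi>|lborel. h \<xi> * cnj (f \<xi>))"
    using D(1,3) by (simp add: distrib_right mult.assoc)
  then show "fourier_dist (\<lambda>f. u f + c * v f) f = (LINT \<xi>|lborel. (g \<xi> + c * h \<xi>) * cnj (f \<xi>))"
    using D(2,4) f by (simp add: fourier_dist_def)
qed

lemma Hm1_lincomb:
  assumes u: "u \<in> Hm1" and v: "v \<in> Hm1"
  shows "(\<lambda>f. u f + c * v f) \<in> Hm1"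
  unfolding Hm1_iff
  using tempered_lincomb[OF Hm1_tempered[OF u] Hm1_tempered[OF v]]
    represents_lincomb[OF Hm1_represents[OF u] Hm1_represents[OF v]]
    weighted_L2_lincomb[OF Hm1_weighted_L2[OF u] Hm1_weighted_L2[OF v]] by blast

lemma fhat_lincomb:
  assumes u: "u \<in> Hm1" and v: "v \<in> Hm1"
  shows "AE \<xi> in lborel. fhat (\<lambda>f. u f + c * v f) \<xi> = fhat u \<xi> + c * fhat v \<xi>"
  by (rule fhat_AE[OF represents_lincomb[OF Hm1_represents[OF u] Hm1_represents[OF v]]])

lemma Hm1_diff: "u \<in> Hm1 \<Longrightarrow> v \<in> Hm1 \<Longrightarrow> (\<lambda>f. u f - v f) \<in> Hm1"
  using Hm1_lincomb[of u v "-1"] by simp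

lemma Hm1_inner_lincomb:
  assumes u: "u \<in> Hm1" and v: "v \<in> Hm1" and w: "w \<in> Hm1"
  shows "Hm1_inner (\<lambda>f. u f + c * v f) w = Hm1_inner u w + c * Hm1_inner v w"
proof -
  have [measurable]: "fhat u \<in> borel_measurable borel" "fhat v \<in> borel_measurable borel"
    "fhat w \<in> borel_measurable borel" "fhat (\<lambda>f. u f + c * v f) \<in> borel_measurable borel"
    using assms Hm1_lincomb[OF u v] by (auto dest: Hm1_measurable)
  let ?w = "\<lambda>\<xi>. complex_of_real (inverse (1 + \<xi>\<^sup>2))"
  have i: "integrable lborel (\<lambda>\<xi>. ?w \<xi> * fhat u \<xi> * cnj (fhat w \<xi>))" "integrable lborel (\<lambda>\<xi>. ?w \<xi> * fhat v \<xi> * cnj (fhat w \<xi>))"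
    by (intro weighted_L2_inner_integrable Hm1_weighted_L2 assms)+
  have "Hm1_inner (\<lambda>f. u f + c * v f) w =
      (LINT \<xi>|lborel. ?w \<xi> * fhat u \<xi> * cnj (fhat w \<xi>) + c * (?w \<xi> * fhat v \<xi> * cnj (fhat w \<xi>)))"
    unfolding Hm1_inner_def
    by (rule integral_cong_AE) (use fhat_lincomb[OF u v, of c] in \<open>auto simp: algebra_simps\<close>)
  also have "\<dots> = Hm1_inner u w + c * Hm1_inner v w"
    unfolding Hm1_inner_def
    by (subst Bochner_Integration.integral_add[OF i(1) integrable_mult_right[OF i(2)]]) simp
  finally show ?thesis .
qed

lemma Hm1_inner_diff:
  "u \<in> Hm1 \<Longrightarrow> v \<in> Hm1 \<Longrightarrow> w \<in> Hm1 \<Longrightarrow>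
    Hm1_inner (\<lambda>f. u f - v f) w = Hm1_inner u w - Hm1_inner v w"
  using Hm1_inner_lincomb[of u v w "-1"] by simp

lemma Hm1_inner_cnj: "Hm1_inner v u = cnj (Hm1_inner u v)"
  unfolding Hm1_inner_def by (subst Bochner_Integration.integral_cnj[symmetric]) (simp add: mult_ac)

lemma Hm1_inner_self:
  assumes "u \<in> Hm1"
  shows "Hm1_inner u u = of_real ((Hm1_norm u)\<^sup>2)"
proof -
  have "Hm1_inner u u = (LINT \<xi>|lborel. of_real (inverse (1 + \<xi>\<^sup>2) * (norm (fhat u \<xi>))\<^sup>2))"
    unfolding Hm1_inner_def by (simp add: complex_norm_square[symmetric] mult.assoc del: of_real_power)
  also have "\<dots> = of_real (LINT \<xi>|lborel. inverse (1 + \<xi>\<^sup>2) * (norm (fhat u \<xi>))\<^sup>2)"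
    by (rule integral_complex_of_real)
  also have "(LINT \<xi>|lborel. inverse (1 + \<xi>\<^sup>2) * (norm (fhat u \<xi>))\<^sup>2) = (Hm1_norm u)\<^sup>2"
    unfolding Hm1_norm_def by (rule real_sqrt_pow2[symmetric], rule Bochner_Integration.integral_nonneg) (simp add: less_imp_le)
  finally show ?thesis .
qed

lemma Hm1_norm_nonneg: "0 \<le> Hm1_norm u"
  unfolding Hm1_norm_def
  by (rule real_sqrt_ge_zero, rule Bochner_Integration.integral_nonneg) (simp add: less_imp_le)

lemma Hm1_norm_eq_0:
  assumes u: "u \<in> Hm1" and "Hm1_norm u = 0"
  shows "u = (\<lambda>f. 0)"
proof (rule Hm1_eq_0[OF u])
  have "(LINT \<xi>|lborel. inverse (1 + \<xi>\<^sup>2) * (norm (fhat u \<xi>))\<^sup>2) = 0"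
    using assms(2) by (simp add: Hm1_norm_def)
  then have "AE \<xi> in lborel. inverse (1 + \<xi>\<^sup>2) * (norm (fhat u \<xi>))\<^sup>2 = 0"
    by (subst (asm) integral_nonneg_eq_0_iff_AE[OF weighted_L2_integrable[OF Hm1_weighted_L2[OF u]]])
       (auto simp: less_imp_le)
  then show "AE \<xi> in lborel. fhat u \<xi> = 0" by eventually_elim auto
qed

section \<open>Dirac deltas\<close>

lemma schwartz_seminorm_ge:
  assumes "f \<in> schwartz"
  shows "norm (f x) \<le> schwartz_seminorm 0 0 f"
proof -
  have "bounded (range (\<lambda>x. of_real (x ^ 0) * Dn 0 f x))"
    using schwartz_bounded[OF assms, of 0] by (simp only: Dn_0)
  then have "bdd_above (range (\<lambda>x. norm (of_real (x ^ 0) * Dn 0 f x)))"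
    by (auto simp: bounded_iff bdd_above_def)
  from cSUP_upper[OF UNIV_I this, of x] show ?thesis
    by (simp add: schwartz_seminorm_def)
qed

text \<open>The seminorm with m = n = 0 dominates every point evaluation, so a ball around
  \<open>f\<close> in that one seminorm already maps into \<open>V\<close>.\<close>

lemma dirac_tempered: "dirac x \<in> tempered"
proof -
  have "continuous_map schwartz_topology euclidean (dirac x)"
    unfolding continuous_map_def
  proof (intro conjI allI impI)
    fix V :: "complex set" assume "openin euclidean V"
    then have V: "open V" by simp
    show "openin schwartz_topology {f \<in> topspace schwartz_topology. dirac x f \<in> V}" (is "openin _ ?S")
    proof (subst openin_subopen, intro ballI)
      fix f assume f: "f \<in> ?S"
      then have fS: "f \<in> schwartz"
        by (auto simp: schwartz_topology_def topology_generated_by_topspace)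
      obtain e where e: "0 < e" "\<And>z. dist z (dirac x f) < e \<Longrightarrow> z \<in> V"
        using V f unfolding open_dist by auto
      let ?B = "{g \<in> schwartz. schwartz_seminorm 0 0 (\<lambda>y. g y - f y) < e}"
      have B: "openin schwartz_topology ?B"
        unfolding schwartz_topology_def
        by (rule topology_generated_by_Basis) (use fS e in blast)
      moreover have "f \<in> ?B"
        using fS e(1) by (simp add: schwartz_seminorm_def)
      moreover have "?B \<subseteq> ?S"
      proof
        fix g assume g: "g \<in> ?B"
        then have "norm (g x - f x) < e"
          using schwartz_seminorm_ge[OF schwartz_diff, of g f x] fS by auto
        then have "dirac x g \<in> V"
          using g fS by (intro e) (simp add: dirac_def dist_norm flip: complex_cnj_diff)
        with g B openin_subset show "g \<in> ?S" by blast
      qed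
      ultimately show "\<exists>T. openin schwartz_topology T \<and> f \<in> T \<and> T \<subseteq> ?S" by blast
    qed
  qed auto
  then show ?thesis
    unfolding tempered_def by (auto simp: dirac_def schwartz_add schwartz_cmult)
qed

text \<open>The exponent is negative because of anti-linearity: \<open>dirac x\<close> returns the
  conjugate of \<open>inv_fourier f x\<close>, whose kernel is the conjugate of exp (i xi
  x).\<close>

definition dirac_hat :: "real \<Rightarrow> real \<Rightarrow> complex" where
  "dirac_hat x \<xi> = of_real (1 / sqrt (2 * pi)) * iexp (\<xi> * (- x))"

lemma dirac_hat_measurable [measurable]: "dirac_hat x \<in> borel_measurable borel"
  unfolding dirac_hat_def by measurable

lemma norm_dirac_hat: "norm (dirac_hat x \<xi>) = 1 / sqrt (2 * pi)"
  unfolding dirac_hat_def norm_mult norm_exp_i norm_of_real by simp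

lemma represents_dirac: "represents (dirac_hat x) (fourier_dist (dirac x))"
  unfolding represents_def
proof (intro conjI ballI)
  fix f assume f: "f \<in> schwartz"
  have eq: "dirac_hat x \<xi> * cnj (f \<xi>) = cnj (of_real (1 / sqrt (2 * pi)) * (iexp (\<xi> * x) * f \<xi>))" for \<xi>
    by (simp add: dirac_hat_def exp_cnj)
  have "integrable lborel (\<lambda>\<xi>. of_real (1 / sqrt (2 * pi)) * (iexp (\<xi> * x) * f \<xi>))"
    by (intro integrable_mult_right integrable_exp_i_mult schwartz_integrable f)
  then show "integrable lborel (\<lambda>\<xi>. dirac_hat x \<xi> * cnj (f \<xi>))"
    unfolding eq by (rule integrable_cnj)
  show "fourier_dist (dirac x) f = (LINT \<xi>|lborel. dirac_hat x \<xi> * cnj (f \<xi>))"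
    unfolding eq Bochner_Integration.integral_cnj using f
    by (simp add: fourier_dist_def dirac_def inv_fourier_schwartz inv_fourier_def)
qed measurable

lemma weighted_L2_dirac_hat: "weighted_L2 (dirac_hat x)"
  by (rule weighted_L2_bounded[of _ "1 / sqrt (2 * pi)"]) (auto simp: norm_dirac_hat)

lemma dirac_Hm1: "dirac x \<in> Hm1"
  unfolding Hm1_iff using dirac_tempered represents_dirac weighted_L2_dirac_hat by blast

lemma fhat_dirac: "AE \<xi> in lborel. fhat (dirac x) \<xi> = dirac_hat x \<xi>"
  by (rule fhat_AE[OF represents_dirac])

lemma Hm1_inner_dirac_pairing:
  assumes u: "u \<in> Hm1"
  shows "Hm1_inner u (dirac x) = (LINT \<xi>|lborel. of_real (inverse (1 + \<xi>\<^sup>2)) * fhat u \<xi> * cnj (dirac_hat x \<xi>))"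
proof -
  have [measurable]: "fhat u \<in> borel_measurable borel" "fhat (dirac x) \<in> borel_measurable borel"
    using u dirac_Hm1 by (auto dest: Hm1_measurable)
  show ?thesis
    unfolding Hm1_inner_def by (rule integral_cong_AE) (use fhat_dirac[of x] in auto)
qed

text \<open>As a function of x this is the potential of \<open>u\<close>. Its form as a transform of
  fhat u / (1 + xi^2) makes vanishing of the potential a statement about \<open>ft\<close>.\<close>

lemma Hm1_inner_dirac:
  assumes "u \<in> Hm1"
  shows "Hm1_inner u (dirac x) =
    of_real (1 / sqrt (2 * pi)) * ft (\<lambda>\<xi>. of_real (inverse (1 + \<xi>\<^sup>2)) * fhat u \<xi>) x"
  unfolding Hm1_inner_dirac_pairing[OF assms] ft_def
  by (subst integral_mult_right_zero[symmetric], rule Bochner_Integration.integral_cong)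
     (auto simp: dirac_hat_def exp_cnj mult_ac)

text \<open>Modulation shifts the transform of 1 / (1 + xi^2), and the two factors 1 / sqrt (2 pi)
  together with pi leave 1/2: this is the Green function of 1 - d^2/dx^2.\<close>

lemma Hm1_inner_dirac_dirac: "Hm1_inner (dirac x) (dirac y) = of_real (exp (- \<bar>y - x\<bar>) / 2)"
proof -
  have [measurable]: "fhat (dirac x) \<in> borel_measurable borel"
    using dirac_Hm1 by (auto dest: Hm1_measurable)
  let ?k = "complex_of_real (1 / sqrt (2 * pi))"
  have "ft (\<lambda>\<xi>. of_real (inverse (1 + \<xi>\<^sup>2)) * fhat (dirac x) \<xi>) y
      = ft (\<lambda>\<xi>. ?k * (iexp (\<xi> * (- x)) * of_real (inverse (1 + \<xi>\<^sup>2)))) y"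
    by (rule ft_cong_AE) (use fhat_dirac[of x] in \<open>auto simp: dirac_hat_def mult_ac\<close>)
  also have "\<dots> = ?k * of_real (pi * exp (- \<bar>y - x\<bar>))"
    unfolding ft_cmult ft_modulate ft_inverse_1_plus_power2 by simp
  finally have "Hm1_inner (dirac x) (dirac y) = ?k * ?k * of_real (pi * exp (- \<bar>y - x\<bar>))"
    unfolding Hm1_inner_dirac[OF dirac_Hm1] by (simp only: mult.assoc)
  also have "\<dots> = of_real (exp (- \<bar>y - x\<bar>) / 2)"
    unfolding inv_sqrt_2pi_sq by simp
  finally show ?thesis .
qed

section \<open>Functions vanishing off an interval pair to zero\<close>

text \<open>Weak convergence from bounded norms and pointwise limits. Dominated convergence does not
  apply directly, since the \<open>K n\<close> need not share an integrable majorant.\<close>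

lemma weighted_pairing_tendsto:
  fixes G k :: "real \<Rightarrow> complex" and K :: "nat \<Rightarrow> real \<Rightarrow> complex"
  assumes G: "weighted_L2 G"
    and [measurable]: "k \<in> borel_measurable borel" "\<And>n. K n \<in> borel_measurable borel"
    and k: "integrable lborel (\<lambda>\<xi>. (1 + \<xi>\<^sup>2) * (norm (k \<xi>))\<^sup>2)"
    and K: "\<And>n. integrable lborel (\<lambda>\<xi>. (1 + \<xi>\<^sup>2) * (norm (K n \<xi>))\<^sup>2)"
    and bound: "\<And>n. (LINT \<xi>|lborel. (1 + \<xi>\<^sup>2) * (norm (K n \<xi>))\<^sup>2) \<le> C"
    and lim: "\<And>\<xi>. (\<lambda>n. K n \<xi>) \<longlonglongrightarrow> k \<xi>"
  shows "(\<lambda>n. LINT \<xi>|lborel. G \<xi> * cnj (K n \<xi>)) \<longlonglongrightarrow> (LINT \<xi>|lborel. G \<xi> * cnj (k \<xi>))"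
proof -
  have [measurable]: "G \<in> borel_measurable borel" using G by (rule weighted_L2_measurable)
  define d where "d n \<xi> = K n \<xi> - k \<xi>" for n \<xi>
  have [measurable]: "d n \<in> borel_measurable borel" for n unfolding d_def by measurable
  define D where "D = 2 * C + 2 * (LINT \<xi>|lborel. (1 + \<xi>\<^sup>2) * (norm (k \<xi>))\<^sup>2)"
  let ?b = "\<lambda>n \<xi>. 2 * ((1 + \<xi>\<^sup>2) * (norm (K n \<xi>))\<^sup>2) + 2 * ((1 + \<xi>\<^sup>2) * (norm (k \<xi>))\<^sup>2)"
  have b: "integrable lborel (?b n)" for n
    by (intro Bochner_Integration.integrable_add integrable_mult_right K k)
  have d_le: "(1 + \<xi>\<^sup>2) * (norm (d n \<xi>))\<^sup>2 \<le> ?b n \<xi>" for n \<xi>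
  proof -
    have "(norm (d n \<xi>))\<^sup>2 \<le> 2 * (norm (K n \<xi>))\<^sup>2 + 2 * (norm (k \<xi>))\<^sup>2"
      using norm_add_sq_le[of "K n \<xi>" "- k \<xi>"] by (simp add: d_def)
    then have "(1 + \<xi>\<^sup>2) * (norm (d n \<xi>))\<^sup>2 \<le> (1 + \<xi>\<^sup>2) * (2 * (norm (K n \<xi>))\<^sup>2 + 2 * (norm (k \<xi>))\<^sup>2)"
      by (intro mult_left_mono) (auto simp: less_imp_le)
    then show ?thesis by (simp add: algebra_simps)
  qed
  have d: "integrable lborel (\<lambda>\<xi>. (1 + \<xi>\<^sup>2) * (norm (d n \<xi>))\<^sup>2)" for n
  proof (rule Bochner_Integration.integrable_bound[OF b[of n]])
    show "AE \<xi> in lborel. norm ((1 + \<xi>\<^sup>2) * (norm (d n \<xi>))\<^sup>2) \<le> norm (?b n \<xi>)"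
      by (intro AE_I2) (use d_le in \<open>auto simp: abs_mult less_imp_le intro: order_trans[OF _ abs_ge_self]\<close>)
  qed measurable
  have dD: "(LINT \<xi>|lborel. (1 + \<xi>\<^sup>2) * (norm (d n \<xi>))\<^sup>2) \<le> D" for n
  proof -
    have "(LINT \<xi>|lborel. (1 + \<xi>\<^sup>2) * (norm (d n \<xi>))\<^sup>2) \<le> (LINT \<xi>|lborel. ?b n \<xi>)"
      by (rule integral_mono[OF d b d_le])
    also have "\<dots> \<le> D"
      using bound[of n] K[of n] k by (simp add: D_def)
    finally show ?thesis .
  qed
  have D0: "0 \<le> D"
    by (rule order_trans[OF Bochner_Integration.integral_nonneg dD[of 0]]) (simp add: less_imp_le)
  have Gd: "integrable lborel (\<lambda>\<xi>. G \<xi> * cnj (d n \<xi>))" for n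
    by (intro weighted_pairing_integrable G d) measurable
  \<comment> \<open>The part of \<open>|G d|\<close> exceeding the quadratic term of Young's inequality is dominated by a
    fixed integrable function, while the quadratic term is uniformly small for large \<open>t\<close>.\<close>
  have "(\<lambda>n. LINT \<xi>|lborel. G \<xi> * cnj (d n \<xi>)) \<longlonglongrightarrow> 0"
  proof (rule LIMSEQ_I)
    fix e :: real assume e: "0 < e"
    \<comment> \<open>The summand 1 keeps \<open>t\<close> positive when D = 0; with this choice D /
      (2 t) is at most e / 2.\<close>
    define t where "t = (D + 1) / e"
    have t: "0 < t" using D0 e by (simp add: t_def)
    let ?q = "\<lambda>n \<xi>. (1 + \<xi>\<^sup>2) * (norm (d n \<xi>))\<^sup>2 / (2 * t)"
    let ?h = "\<lambda>n \<xi>. max 0 (norm (G \<xi>) * norm (d n \<xi>) - ?q n \<xi>)"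
    let ?P = "\<lambda>\<xi>. t / 2 * (inverse (1 + \<xi>\<^sup>2) * (norm (G \<xi>))\<^sup>2)"
    have P: "integrable lborel ?P"
      by (intro integrable_mult_right weighted_L2_integrable G)
    have hP: "norm (?h n \<xi>) \<le> ?P \<xi>" for n \<xi>
      
    proof -
      have "0 \<le> ?P \<xi>" using t by (simp add: less_imp_le)
      with weighted_young[OF t, of "norm (G \<xi>)" "norm (d n \<xi>)" \<xi>] show ?thesis
        unfolding real_norm_def by linarith
    qed
    have h: "integrable lborel (?h n)" for n
      by (rule Bochner_Integration.integrable_bound[OF P]) (measurable, use hP in \<open>auto intro!: AE_I2 order_trans[OF _ abs_ge_self]\<close>)
    have "(\<lambda>n. LINT \<xi>|lborel. ?h n \<xi>) \<longlonglongrightarrow> (LINT \<xi>::real|lborel. 0)"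
    proof (rule integral_dominated_convergence[OF _ _ P])
      show "AE \<xi> in lborel. (\<lambda>n. ?h n \<xi>) \<longlonglongrightarrow> 0"
      proof (rule AE_I2)
        fix \<xi>
        have "(\<lambda>n. d n \<xi>) \<longlonglongrightarrow> k \<xi> - k \<xi>" unfolding d_def by (intro tendsto_intros lim)
        then have "(\<lambda>n. norm (d n \<xi>)) \<longlonglongrightarrow> 0" using tendsto_norm_zero by auto
        then have "(\<lambda>n. ?h n \<xi>) \<longlonglongrightarrow> max 0 (norm (G \<xi>) * 0 - (1 + \<xi>\<^sup>2) * 0\<^sup>2 / (2 * t))"
          using t by (intro tendsto_intros) auto
        then show "(\<lambda>n. ?h n \<xi>) \<longlonglongrightarrow> 0" by simp
      qed
      show "AE \<xi> in lborel. norm (?h n \<xi>) \<le> ?P \<xi>" for n using hP by (intro AE_I2)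
    qed measurable
    then have "(\<lambda>n. LINT \<xi>|lborel. ?h n \<xi>) \<longlonglongrightarrow> 0" by simp
    then obtain N where N: "\<And>n. n \<ge> N \<Longrightarrow> \<bar>LINT \<xi>|lborel. ?h n \<xi>\<bar> < e / 2"
      using LIMSEQ_D[of _ 0 "e/2"] e by fastforce
    have "norm ((LINT \<xi>|lborel. G \<xi> * cnj (d n \<xi>)) - 0) < e" if "n \<ge> N" for n
    proof -
      have "norm (LINT \<xi>|lborel. G \<xi> * cnj (d n \<xi>)) \<le> (LINT \<xi>|lborel. norm (G \<xi> * cnj (d n \<xi>)))"
        by (rule integral_norm_bound)
      also have "\<dots> \<le> (LINT \<xi>|lborel. ?h n \<xi> + ?q n \<xi>)"
      proof (rule integral_mono)
        show "integrable lborel (\<lambda>\<xi>. norm (G \<xi> * cnj (d n \<xi>)))"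
          using Gd by (rule integrable_norm)
        show "integrable lborel (\<lambda>\<xi>. ?h n \<xi> + ?q n \<xi>)"
          by (intro Bochner_Integration.integrable_add h integrable_divide d)
      qed (simp add: norm_mult)
      also have "\<dots> = (LINT \<xi>|lborel. ?h n \<xi>) + (LINT \<xi>|lborel. (1 + \<xi>\<^sup>2) * (norm (d n \<xi>))\<^sup>2) / (2 * t)"
        using h d by simp
      also have "\<dots> \<le> (LINT \<xi>|lborel. ?h n \<xi>) + D / (2 * t)"
        using dD t by (intro add_left_mono divide_right_mono) auto
      also have "\<dots> < e / 2 + e / 2"
      proof (rule add_less_le_mono)
        show "D / (2 * t) \<le> e / 2"
          using e D0 by (simp add: t_def field_simps)
      qed (use N[OF that] in auto)
      finally show ?thesis by simp
    qed
    then show "\<exists>N. \<forall>n\<ge>N. norm ((LINT \<xi>|lborel. G \<xi> * cnj (d n \<xi>)) - 0) < e" by blast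
  qed
  moreover have "(LINT \<xi>|lborel. G \<xi> * cnj (K n \<xi>)) = (LINT \<xi>|lborel. G \<xi> * cnj (d n \<xi>)) + (LINT \<xi>|lborel. G \<xi> * cnj (k \<xi>))" for n
    using Bochner_Integration.integral_add[OF Gd[of n] weighted_pairing_integrable[OF G _ k]]
    by (simp add: d_def algebra_simps)
  ultimately show ?thesis
    using tendsto_add[OF _ tendsto_const, of _ 0] by fastforce
qed

text \<open>\<open>b\<close> is merely bounded and measurable, so the product need not be a Schwartz
  function. Multiplication by i xi changes only the factor \<open>s\<close>, which stays in
  \<open>schwartz\<close>; hence every derivative of the transform is of the same form.\<close>

lemma smooth_ft_mult:
  assumes [measurable]: "b \<in> borel_measurable borel" and b: "\<And>\<xi>. norm (b \<xi>) \<le> B" and s: "s \<in> schwartz"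
  shows "integrable lborel (\<lambda>\<xi>. b \<xi> * s \<xi>)" "smooth (ft (\<lambda>\<xi>. b \<xi> * s \<xi>))"
proof -
  have int: "integrable lborel (\<lambda>\<xi>. b \<xi> * s \<xi>)" if s: "s \<in> schwartz" for s
  proof (rule Bochner_Integration.integrable_bound)
    have [measurable]: "s \<in> borel_measurable borel" using s by (rule schwartz_measurable)
    show "(\<lambda>\<xi>. b \<xi> * s \<xi>) \<in> borel_measurable lborel" by measurable
    show "integrable lborel (\<lambda>\<xi>. B * norm (s \<xi>))" using schwartz_integrable[OF s] by auto
    show "AE \<xi> in lborel. norm (b \<xi> * s \<xi>) \<le> norm (B * norm (s \<xi>))"
      unfolding norm_mult using order_trans[OF b abs_ge_self] by (intro AE_I2 mult_mono) auto
  qed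
  show "integrable lborel (\<lambda>\<xi>. b \<xi> * s \<xi>)" by (rule int[OF s])
  have "deriv_closed ((\<lambda>s. ft (\<lambda>\<xi>. b \<xi> * s \<xi>)) ` schwartz)"
  proof (rule deriv_closedI)
    fix f assume "f \<in> (\<lambda>s. ft (\<lambda>\<xi>. b \<xi> * s \<xi>)) ` schwartz"
    then obtain s where s: "s \<in> schwartz" "f = ft (\<lambda>\<xi>. b \<xi> * s \<xi>)" by auto
    have s': "(\<lambda>\<xi>. \<i> * of_real \<xi> * s \<xi>) \<in> schwartz"
      using schwartz_monom_mult[OF s(1), of \<i> 1] by simp
    have eq: "(\<lambda>\<xi>. \<i> * of_real \<xi> * (b \<xi> * s \<xi>)) = (\<lambda>\<xi>. b \<xi> * (\<i> * of_real \<xi> * s \<xi>))"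
      by (auto simp: mult_ac)
    have "(f has_vector_derivative ft (\<lambda>\<xi>. b \<xi> * (\<i> * of_real \<xi> * s \<xi>)) x) (at x)" for x
      using ft_has_vector_derivative[OF int[OF s(1)], of x] int[OF s'] unfolding s(2) eq by blast
    with s' show "\<exists>f'. f' \<in> (\<lambda>s. ft (\<lambda>\<xi>. b \<xi> * s \<xi>)) ` schwartz \<and> (\<forall>x. (f has_vector_derivative f' x) (at x))"
      by blast
  qed
  then show "smooth (ft (\<lambda>\<xi>. b \<xi> * s \<xi>))"
    by (rule deriv_closed_smooth) (use s in auto)
qed

section \<open>Compact supports and mollifiers at small scale\<close>

lemma integrable_continuous_compact_support:
  fixes h :: "real \<Rightarrow> complex"
  assumes "continuous_on UNIV h" "\<And>y. y \<notin> {p..q} \<Longrightarrow> h y = 0"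
  shows "integrable lborel h"
proof -
  have "set_integrable lborel {p..q} h"
    by (rule borel_integrable_atLeastAtMost') (rule continuous_on_subset[OF assms(1)], simp)
  moreover have "indicator {p..q} y *\<^sub>R h y = h y" for y
    using assms(2)[of y] by (auto simp: indicator_def)
  ultimately show ?thesis by (simp only: set_integrable_def)
qed

definition scaled_mollifier :: "real \<Rightarrow> real \<Rightarrow> real" where
  "scaled_mollifier e t = inverse e * mollifier (inverse e * t)"

lemma scaled_mollifier_eq_0: "0 < e \<Longrightarrow> e \<le> \<bar>t\<bar> \<Longrightarrow> scaled_mollifier e t = 0"
  by (simp add: scaled_mollifier_def mollifier_eq_0 abs_mult field_simps)

lemma scaled_mollifier_test:
  assumes "0 < e"
  shows "(\<lambda>t. of_real (scaled_mollifier e t)) \<in> test_functions {-e..e}"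
proof (rule test_functionsI[of _ "{-e..e}"])
  have "smooth (\<lambda>x. of_real (mollifier x))"
    using test_mollifier by (simp add: test_functions_iff)
  from smooth_cmult[OF smooth_affine[OF this, of 0 "inverse e"], of "of_real (inverse e)"]
  show "smooth (\<lambda>t. of_real (scaled_mollifier e t))"
    by (simp add: scaled_mollifier_def)
  show "of_real (scaled_mollifier e t) = (0 :: complex)" if "t \<notin> {-e..e}" for t
    using scaled_mollifier_eq_0[OF assms, of t] that by auto
qed auto

text \<open>Narrowing the mollifier stretches its transform. As \<open>e\<close> tends to 0 the
  transform therefore tends pointwise to its value at 0, which is the mass 1, while staying bounded
  by 1.\<close>

lemma ft_scaled_mollifier:
  assumes "0 < e"
  shows "ft (\<lambda>t. of_real (scaled_mollifier e t)) \<xi> = ft (\<lambda>t. of_real (mollifier t)) (e * \<xi>)"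
proof -
  have "ft (\<lambda>t. of_real (scaled_mollifier e t)) \<xi>
      = of_real (inverse e) * ft (\<lambda>t. of_real (mollifier (inverse e * t))) \<xi>"
    unfolding scaled_mollifier_def of_real_mult ft_cmult by simp
  also have "\<dots> = of_real (inverse e) * (of_real e * ft (\<lambda>t. of_real (mollifier t)) (\<xi> * e))"
    using ft_scale[of "inverse e" "\<lambda>t. of_real (mollifier t)" \<xi>] assms by (simp add: divide_inverse)
  finally show ?thesis using assms by (simp add: mult.commute)
qed

lemma ft_mollifier_0: "ft (\<lambda>t. of_real (mollifier t)) 0 = 1"
  using mollifier_has_bochner_integral
  by (simp add: ft_def integral_complex_of_real has_bochner_integral_iff)

lemma norm_ft_mollifier: "norm (ft (\<lambda>t. of_real (mollifier t)) x) \<le> 1"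
  using norm_ft_le[of "\<lambda>t. of_real (mollifier t)" x] mollifier_has_bochner_integral
  by (simp add: mollifier_nonneg has_bochner_integral_iff)

text \<open>Since \<open>W\<close> is controlled only on test functions, \<open>g\<close> is
  approximated by functions \<open>k n\<close> whose transforms are test functions on (p, q). Each
  of them pairs to 0 with \<open>fhat W\<close>, and weak convergence carries this over to
  \<open>g\<close>.\<close>

lemma pairing_eq_0_if_ft_vanishes_outside:
  fixes g :: "real \<Rightarrow> complex"
  assumes W: "W \<in> Hm1" and pq: "p < q"
    and van: "\<And>f. f \<in> test_functions {p<..<q} \<Longrightarrow> W f = 0"
    and g_meas [measurable]: "g \<in> borel_measurable borel"
    and g: "integrable lborel (\<lambda>\<xi>. (1 + \<xi>\<^sup>2) * (norm (g \<xi>))\<^sup>2)"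
    and zero: "\<And>y. y \<notin> {p<..<q} \<Longrightarrow> ft g y = 0"
  shows "(LINT \<xi>|lborel. fhat W \<xi> * cnj (g \<xi>)) = 0"
proof -
  have [measurable]: "fhat W \<in> borel_measurable borel" using W by (rule Hm1_measurable)
  have g_int: "integrable lborel g"
  proof -
    \<comment> \<open>Pairing with the constant 1 shows that \<open>g\<close> itself is integrable,
      so that \<open>ft g\<close> is a continuous function.\<close>
    have "weighted_L2 (\<lambda>\<xi>. 1)" by (rule weighted_L2_bounded[of _ 1]) auto
    from weighted_pairing_integrable[OF this g_meas g] show ?thesis by simp
  qed
  define h where "h = ft g"
  have h_int: "integrable lborel h"
    unfolding h_def
    by (rule integrable_continuous_compact_support[of _ p q]) (use continuous_on_ft[OF g_int] zero in auto)
  \<comment> \<open>\<open>g\<close> is only measurable, while the limit of its dilates needs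
    continuity. Inverting \<open>h\<close>, which is continuous and vanishes off a bounded interval,
    supplies a continuous bounded representative.\<close>
  define g0 where "g0 \<xi> = ft h (- \<xi>) / (2 * of_real pi)" for \<xi>
  have g0_cont: "continuous_on UNIV g0"
    unfolding g0_def
    by (intro continuous_intros continuous_on_compose2[OF continuous_on_ft[OF h_int]]) auto
  have g0_meas [measurable]: "g0 \<in> borel_measurable borel"
    by (rule borel_measurable_continuous_onI[OF g0_cont])
  obtain B where B: "\<And>\<xi>. norm (g0 \<xi>) \<le> B"
  proof
    show "norm (g0 \<xi>) \<le> (LINT x|lborel. norm (h x)) / norm (2 * complex_of_real pi)" for \<xi>
      unfolding g0_def norm_divide by (intro divide_right_mono norm_ft_le) auto
  qed
  have AE: "AE \<xi> in lborel. g0 \<xi> = g \<xi>"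
    using ft_inversion_AE[OF g_int h_int[unfolded h_def]] by eventually_elim (simp add: g0_def h_def)
  have ft_g0: "ft g0 = h"
    unfolding h_def by (rule ext, rule ft_cong_AE[OF _ _ AE]) measurable
  have g0_int: "integrable lborel g0"
    using integrable_cong_AE[OF _ _ AE] g_int by simp
  have g0: "integrable lborel (\<lambda>\<xi>. (1 + \<xi>\<^sup>2) * (norm (g0 \<xi>))\<^sup>2)"
    by (subst integrable_cong_AE[where g = "\<lambda>\<xi>. (1 + \<xi>\<^sup>2) * (norm (g \<xi>))\<^sup>2"]) (use AE g in auto)
  define C where "C = (LINT \<xi>|lborel. (1 + \<xi>\<^sup>2) * (norm (g0 \<xi>))\<^sup>2)"
  define m r where "m = (p + q) / 2" and "r = (q - p) / 2"
  have r: "0 < r" using pq by (simp add: r_def)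
  \<comment> \<open>Starting at 1/2 keeps the dilation factor 1 - s n between 1/2 and 1, which later
    bounds the norms by 2 C.\<close>
  define s where "s n = inverse (real (Suc (Suc n)))" for n
  have s: "0 < s n" "s n \<le> 1 / 2" for n by (auto simp: s_def field_simps)
  have s_lim: "s \<longlonglongrightarrow> 0"
    unfolding s_def by (rule LIMSEQ_Suc[OF LIMSEQ_inverse_real_of_nat])
  \<comment> \<open>On the Fourier side, \<open>b n\<close> dilates about the midpoint \<open>m\<close> by the factor \<open>1 - s n\<close>, and
    \<open>mu n\<close> mollifies at a scale that fits into the gap created by the dilation.\<close>
  define b where "b n \<xi> = iexp (\<xi> * (- (s n * m))) * (of_real (1 - s n) * g0 ((1 - s n) * \<xi>))" for n \<xi>
  define e where "e n = r * s n / 4" for n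
  have e: "0 < e n" for n using r s by (simp add: e_def)
  define mu where "mu n = ft (\<lambda>t. of_real (scaled_mollifier (e n) t))" for n
  define k where "k n \<xi> = b n \<xi> * mu n \<xi>" for n \<xi>
  have [measurable]: "b n \<in> borel_measurable borel" for n unfolding b_def by measurable
  have moll: "(\<lambda>t. of_real (scaled_mollifier (e n) t)) \<in> schwartz" for n
    by (rule test_functions_schwartz[OF scaled_mollifier_test[OF e]])
  have mu: "mu n \<in> schwartz" for n unfolding mu_def by (rule schwartz_ft[OF moll])
  have [measurable]: "mu n \<in> borel_measurable borel" for n by (rule schwartz_measurable[OF mu])
  have [measurable]: "k n \<in> borel_measurable borel" for n unfolding k_def by measurable
  have mu_eq: "mu n \<xi> = ft (\<lambda>t. of_real (mollifier t)) (e n * \<xi>)" for n \<xi>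
    unfolding mu_def by (rule ft_scaled_mollifier[OF e])
  have norm_b: "norm (b n \<xi>) = (1 - s n) * norm (g0 ((1 - s n) * \<xi>))" for n \<xi>
    unfolding b_def norm_mult norm_exp_i norm_of_real using s(2)[of n] by simp
  have b_bd: "norm (b n \<xi>) \<le> B" for n \<xi>
  proof -
    have "(1 - s n) * norm (g0 ((1 - s n) * \<xi>)) \<le> 1 * B"
      by (intro mult_mono B) (use s[of n] in auto)
    then show ?thesis by (simp add: norm_b)
  qed
  have b_int: "integrable lborel (b n)" for n
  proof -
    have "integrable lborel (\<lambda>\<xi>. of_real (1 - s n) * g0 ((1 - s n) * \<xi>))"
      using lborel_integrable_real_affine[OF g0_int, of "1 - s n" 0] s(2)[of n]
      by (intro integrable_mult_right) auto
    then show ?thesis unfolding b_def by (rule integrable_exp_i_mult)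
  qed
  have ft_b: "ft (b n) y = h (m + (y - m) / (1 - s n))" for n y
  proof -
    have s1: "0 < 1 - s n" using s(2)[of n] by simp
    have "ft (b n) y = of_real (1 - s n) * (of_real (inverse (1 - s n)) * h ((y + - (s n * m)) / (1 - s n)))"
      unfolding b_def ft_modulate ft_cmult ft_scale[OF s1] ft_g0 ..
    also have "\<dots> = h ((y + - (s n * m)) / (1 - s n))"
      unfolding mult.assoc[symmetric] of_real_mult[symmetric] using s1 by simp
    also have "(y + - (s n * m)) / (1 - s n) = m + (y - m) / (1 - s n)"
      using s1 by (simp add: field_simps)
    finally show ?thesis .
  qed
  have ft_k: "ft (k n) y = (LINT t|lborel. ft (b n) (t + y) * of_real (scaled_mollifier (e n) t))" for n y
  proof -
    have "ft (k n) y = (LINT \<xi>|lborel. (iexp (\<xi> * y) * b n \<xi>) * mu n \<xi>)"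
      unfolding ft_def k_def by (simp add: mult.assoc)
    also have "\<dots> = (LINT t|lborel. ft (\<lambda>\<xi>. iexp (\<xi> * y) * b n \<xi>) t * of_real (scaled_mollifier (e n) t))"
      unfolding mu_def
      by (rule ft_multiplication_formula[symmetric, OF integrable_exp_i_mult[OF b_int] schwartz_integrable[OF moll]])
    finally show ?thesis unfolding ft_modulate .
  qed
  \<comment> \<open>The dilated \<open>h\<close> vanishes at distance (1 - s n) r or more from
    \<open>m\<close>, and the mollifier spreads this by e n = r * s n / 4. The half-length (1 - s n
    / 2) r leaves room for that and is still below r.\<close>
  let ?I = "\<lambda>n. {m - (1 - s n / 2) * r .. m + (1 - s n / 2) * r}"
  have ft_k_0: "ft (k n) y = 0" if y: "y \<notin> ?I n" for n y
  proof -
    have integrand: "ft (b n) (t + y) * of_real (scaled_mollifier (e n) t) = 0" for t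
    proof (cases "e n \<le> \<bar>t\<bar>")
      case True
      then show ?thesis by (simp add: scaled_mollifier_eq_0[OF e])
    next
      case False
      have s1: "0 < 1 - s n" using s(2)[of n] by simp
      have "\<bar>y - m\<bar> > (1 - s n / 2) * r" using y by (auto simp: abs_if)
      moreover have "(1 - s n / 2) * r - r * s n / 4 \<ge> (1 - s n) * r"
        using s(1)[of n] r by (simp add: algebra_simps)
      ultimately have "\<bar>t + y - m\<bar> \<ge> r * (1 - s n)"
        using False unfolding e_def by (simp add: mult.commute)
      then have "\<bar>(t + y - m) / (1 - s n)\<bar> \<ge> r"
        using s1 by (simp add: abs_divide pos_le_divide_eq)
      then have "m + (t + y - m) / (1 - s n) \<notin> {p<..<q}"
        by (auto simp: m_def r_def abs_if field_simps split: if_splits)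
      then show ?thesis unfolding ft_b h_def using zero by simp
    qed
    show ?thesis unfolding ft_k integrand by simp
  qed
  have k_int: "integrable lborel (k n)" and k_smooth: "smooth (ft (k n))" for n
    using smooth_ft_mult[of "b n" B "mu n"] b_bd mu unfolding k_def[abs_def] by auto
  have test: "ft (k n) \<in> test_functions {p<..<q}" for n
  proof (rule test_functionsI[of _ "?I n", OF k_smooth])
    have "s n / 2 * r > 0" using s r by simp
    then have "(1 - s n / 2) * r < r" by (simp add: left_diff_distrib)
    moreover have "m - r = p" "m + r = q" by (simp_all add: m_def r_def field_simps)
    ultimately show "?I n \<subseteq> {p<..<q}" by auto
  qed (use ft_k_0 in auto)
  have pair_0: "(LINT \<xi>|lborel. fhat W \<xi> * cnj (k n \<xi>)) = 0" for n
  proof -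
    \<comment> \<open>The unnormalised inversion contributes 2 pi and \<open>fourier\<close> its own
      factor. The product is nonzero, so vanishing of W (ft (k n)) passes to the pairing with
      \<open>k n\<close>.\<close>
    let ?c = "complex_of_real (1 / sqrt (2 * pi)) * (2 * of_real pi)"
    have ft_int: "integrable lborel (ft (k n))"
      by (rule integrable_continuous_compact_support[OF continuous_on_ft[OF k_int] ft_k_0])
    have four: "AE \<xi> in lborel. fourier (ft (k n)) \<xi> = ?c * k n \<xi>"
      using ft_inversion_AE[OF k_int ft_int] by eventually_elim (simp add: fourier_def)
    have fS: "ft (k n) \<in> schwartz" by (rule test_functions_schwartz[OF test])
    have [measurable]: "fourier (ft (k n)) \<in> borel_measurable borel"
      by (rule schwartz_measurable[OF schwartz_fourier[OF fS]])
    have "0 = W (ft (k n))" using van[OF test] by simp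
    also have "\<dots> = (LINT \<xi>|lborel. fhat W \<xi> * cnj (fourier (ft (k n)) \<xi>))"
      by (rule Hm1_apply[OF W fS])
    also have "\<dots> = (LINT \<xi>|lborel. cnj ?c * (fhat W \<xi> * cnj (k n \<xi>)))"
      by (rule integral_cong_AE) (measurable, use four in eventually_elim, simp add: mult_ac)
    also have "\<dots> = cnj ?c * (LINT \<xi>|lborel. fhat W \<xi> * cnj (k n \<xi>))" by simp
    finally show ?thesis by simp
  qed
  \<comment> \<open>\<open>mu n\<close> has modulus at most 1, and \<open>b n\<close> brings the
    factor (1 - s n)^2. Being at most 1, this factor turns the weight at xi into at most the weight
    at the dilated point.\<close>
  have k_le: "(1 + \<xi>\<^sup>2) * (norm (k n \<xi>))\<^sup>2 \<le> (1 + ((1 - s n) * \<xi>)\<^sup>2) * (norm (g0 ((1 - s n) * \<xi>)))\<^sup>2" for n \<xi>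
  proof -
    have "norm (k n \<xi>) \<le> norm (b n \<xi>) * 1"
      unfolding k_def norm_mult mu_eq by (intro mult_left_mono norm_ft_mollifier) simp
    then have "(norm (k n \<xi>))\<^sup>2 \<le> (1 - s n)\<^sup>2 * (norm (g0 ((1 - s n) * \<xi>)))\<^sup>2"
      using power_mono[of "norm (k n \<xi>)" "norm (b n \<xi>)" 2] by (simp add: norm_b power_mult_distrib)
    then have "(1 + \<xi>\<^sup>2) * (norm (k n \<xi>))\<^sup>2 \<le> ((1 + \<xi>\<^sup>2) * (1 - s n)\<^sup>2) * (norm (g0 ((1 - s n) * \<xi>)))\<^sup>2"
      by (simp add: mult.assoc)
    also have "\<dots> \<le> (1 + ((1 - s n) * \<xi>)\<^sup>2) * (norm (g0 ((1 - s n) * \<xi>)))\<^sup>2"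
    proof (rule mult_right_mono)
      have "(1 - s n)\<^sup>2 \<le> 1" using s[of n] by (intro power_le_one) auto
      then show "(1 + \<xi>\<^sup>2) * (1 - s n)\<^sup>2 \<le> 1 + ((1 - s n) * \<xi>)\<^sup>2"
        unfolding power_mult_distrib by (simp add: distrib_right mult.commute)
    qed simp
    finally show ?thesis .
  qed
  have dil_int: "integrable lborel (\<lambda>\<xi>. (1 + ((1 - s n) * \<xi>)\<^sup>2) * (norm (g0 ((1 - s n) * \<xi>)))\<^sup>2)" for n
    using lborel_integrable_real_affine[OF g0, of "1 - s n" 0] s(2)[of n] by simp
  have k_w: "integrable lborel (\<lambda>\<xi>. (1 + \<xi>\<^sup>2) * (norm (k n \<xi>))\<^sup>2)" for n
  proof (rule Bochner_Integration.integrable_bound[OF dil_int[of n]])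
    show "AE \<xi> in lborel. norm ((1 + \<xi>\<^sup>2) * (norm (k n \<xi>))\<^sup>2) \<le> norm ((1 + ((1 - s n) * \<xi>)\<^sup>2) * (norm (g0 ((1 - s n) * \<xi>)))\<^sup>2)"
      unfolding real_norm_def
      by (intro AE_I2 order_trans[OF _ abs_ge_self]) (use k_le in \<open>simp add: abs_mult less_imp_le\<close>)
  qed measurable
  have k_bound: "(LINT \<xi>|lborel. (1 + \<xi>\<^sup>2) * (norm (k n \<xi>))\<^sup>2) \<le> 2 * C" for n
  proof -
    have s1: "0 < 1 - s n" using s(2)[of n] by simp
    have C0: "0 \<le> C" unfolding C_def by (rule Bochner_Integration.integral_nonneg) (simp add: less_imp_le)
    have CI: "C = (1 - s n) * (LINT \<xi>|lborel. (1 + ((1 - s n) * \<xi>)\<^sup>2) * (norm (g0 ((1 - s n) * \<xi>)))\<^sup>2)"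
      unfolding C_def using s1
        lborel_integral_real_affine[of "1 - s n" "\<lambda>\<xi>. (1 + \<xi>\<^sup>2) * (norm (g0 \<xi>))\<^sup>2" 0]
      by simp
    have "(LINT \<xi>|lborel. (1 + \<xi>\<^sup>2) * (norm (k n \<xi>))\<^sup>2) \<le> (LINT \<xi>|lborel. (1 + ((1 - s n) * \<xi>)\<^sup>2) * (norm (g0 ((1 - s n) * \<xi>)))\<^sup>2)"
      by (rule integral_mono[OF k_w dil_int k_le])
    also have "\<dots> = C / (1 - s n)" using CI s1 by (simp add: field_simps)
    also have "\<dots> \<le> C / (1 / 2)" using s(2)[of n] C0 by (intro divide_left_mono) auto
    finally show ?thesis by simp
  qed
  have k_lim: "(\<lambda>n. k n \<xi>) \<longlonglongrightarrow> g0 \<xi>" for \<xi>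
  proof -
    have cont: "isCont g0 x" for x using g0_cont by (simp add: continuous_on_eq_continuous_at)
    have "continuous_on UNIV (ft (\<lambda>t. of_real (mollifier t)))"
      by (intro continuous_on_ft schwartz_integrable test_functions_schwartz[OF test_mollifier])
    then have cont': "isCont (ft (\<lambda>t. of_real (mollifier t))) x" for x
      by (simp add: continuous_on_eq_continuous_at)
    have l1: "(\<lambda>n. g0 ((1 - s n) * \<xi>)) \<longlonglongrightarrow> g0 ((1 - 0) * \<xi>)"
      by (rule isCont_tendsto_compose[OF cont]) (intro tendsto_intros s_lim)
    have l2: "(\<lambda>n. ft (\<lambda>t. of_real (mollifier t)) (e n * \<xi>)) \<longlonglongrightarrow> ft (\<lambda>t. of_real (mollifier t)) ((r * 0 / 4) * \<xi>)"
      unfolding e_def by (rule isCont_tendsto_compose[OF cont']) (intro tendsto_intros s_lim, simp)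
    have "(\<lambda>n. k n \<xi>) \<longlonglongrightarrow> iexp (\<xi> * (- (0 * m))) * (of_real (1 - 0) * g0 ((1 - 0) * \<xi>)) * ft (\<lambda>t. of_real (mollifier t)) ((r * 0 / 4) * \<xi>)"
      unfolding k_def b_def mu_eq by (intro tendsto_intros s_lim l1 l2)
    then show ?thesis by (simp add: ft_mollifier_0)
  qed
  have "(\<lambda>n. LINT \<xi>|lborel. fhat W \<xi> * cnj (k n \<xi>)) \<longlonglongrightarrow> (LINT \<xi>|lborel. fhat W \<xi> * cnj (g0 \<xi>))"
    by (rule weighted_pairing_tendsto[OF Hm1_weighted_L2[OF W] _ _ g0 k_w k_bound k_lim]) measurable
  then have "(LINT \<xi>|lborel. fhat W \<xi> * cnj (g0 \<xi>)) = 0"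
    unfolding pair_0 using LIMSEQ_unique tendsto_const by blast
  moreover have "(LINT \<xi>|lborel. fhat W \<xi> * cnj (g0 \<xi>)) = (LINT \<xi>|lborel. fhat W \<xi> * cnj (g \<xi>))"
    by (rule integral_cong_AE) (measurable, use AE in eventually_elim, simp)
  ultimately show ?thesis by simp
qed

section \<open>The minimal extension\<close>

text \<open>exp (- x) and exp x solve y'' = y, and the weights sinh (q - x) and sinh (x - p)
  interpolate such solutions between p and q.\<close>

lemma sinh_exp_identity:
  fixes p q x :: real
  shows "sinh (q - p) * exp (- x) = sinh (q - x) * exp (- p) + sinh (x - p) * exp (- q)"
    and "sinh (q - p) * exp x = sinh (q - x) * exp p + sinh (x - p) * exp q"
  by (simp_all add: sinh_def field_simps flip: exp_add)

text \<open>\<open>W\<close> is paired with the Riesz image of \<open>D\<close>, a combination of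
  three deltas. On either side of (p, q) the three potentials are multiples of one exponential, exp
  y or exp (- y), and the sinh weights make these multiples cancel.\<close>

lemma Hm1_inner_dirac_interpolation:
  assumes W: "W \<in> Hm1" and pq: "p < q" and x: "p \<le> x" "x \<le> q"
    and van: "\<And>f. f \<in> test_functions {p<..<q} \<Longrightarrow> W f = 0"
  shows "of_real (sinh (q - p)) * Hm1_inner W (dirac x) =
    of_real (sinh (q - x)) * Hm1_inner W (dirac p) + of_real (sinh (x - p)) * Hm1_inner W (dirac q)"
proof -
  have [measurable]: "fhat W \<in> borel_measurable borel" using W by (rule Hm1_measurable)
  let ?S = "complex_of_real (sinh (q - p))" and ?A = "complex_of_real (sinh (q - x))"
    and ?B = "complex_of_real (sinh (x - p))"
  let ?w = "\<lambda>\<xi>. complex_of_real (inverse (1 + \<xi>\<^sup>2))"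
  define D where "D \<xi> = ?S * dirac_hat x \<xi> + (- ?A) * dirac_hat p \<xi> + (- ?B) * dirac_hat q \<xi>" for \<xi>
  define g where "g \<xi> = ?w \<xi> * D \<xi>" for \<xi>
  have D: "weighted_L2 D"
  proof -
    have "weighted_L2 (\<lambda>\<xi>. 0 + ?S * dirac_hat x \<xi>)"
      by (intro weighted_L2_lincomb weighted_L2_dirac_hat weighted_L2_bounded[of _ 0]) auto
    from weighted_L2_lincomb[OF weighted_L2_lincomb[OF this weighted_L2_dirac_hat[of p], of "- ?A"]
        weighted_L2_dirac_hat[of q], of "- ?B"]
    show ?thesis by (simp add: D_def[abs_def])
  qed
  have [measurable]: "D \<in> borel_measurable borel" by (rule weighted_L2_measurable[OF D])
  have int: "integrable lborel (\<lambda>\<xi>. iexp (\<xi> * y) * (?w \<xi> * dirac_hat z \<xi>))" for y z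
  proof (rule integrable_exp_i_mult, rule bounded_by_inverse_1_plus_integrable)
    show "norm (?w \<xi> * dirac_hat z \<xi>) \<le> (1 / sqrt (2 * pi)) * inverse (1 + \<xi>\<^sup>2)" for \<xi>
      unfolding norm_mult norm_dirac_hat norm_of_real by (simp add: less_imp_le)
  qed measurable
  let ?k = "complex_of_real (1 / sqrt (2 * pi))"
  have ft_dirac: "ft (\<lambda>\<xi>. ?w \<xi> * dirac_hat z \<xi>) y = ?k * of_real (pi * exp (- \<bar>y - z\<bar>))" for y z
  proof -
    have "ft (\<lambda>\<xi>. ?w \<xi> * dirac_hat z \<xi>) y = ft (\<lambda>\<xi>. ?k * (iexp (\<xi> * (- z)) * ?w \<xi>)) y"
      unfolding dirac_hat_def by (simp add: mult_ac)
    then show ?thesis unfolding ft_cmult ft_modulate ft_inverse_1_plus_power2 by simp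
  qed
  have ft_g: "ft g y = ?k * of_real (pi * (sinh (q - p) * exp (- \<bar>y - x\<bar>)
      - sinh (q - x) * exp (- \<bar>y - p\<bar>) - sinh (x - p) * exp (- \<bar>y - q\<bar>)))" for y
  proof -
    have "ft g y = (LINT \<xi>|lborel. ?S * (iexp (\<xi> * y) * (?w \<xi> * dirac_hat x \<xi>)) +
       (- ?A) * (iexp (\<xi> * y) * (?w \<xi> * dirac_hat p \<xi>)) + (- ?B) * (iexp (\<xi> * y) * (?w \<xi> * dirac_hat q \<xi>)))"
      unfolding ft_def g_def D_def by (rule Bochner_Integration.integral_cong) (auto simp: algebra_simps)
    also have "\<dots> = ?S * ft (\<lambda>\<xi>. ?w \<xi> * dirac_hat x \<xi>) y + (- ?A) * ft (\<lambda>\<xi>. ?w \<xi> * dirac_hat p \<xi>) y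
       + (- ?B) * ft (\<lambda>\<xi>. ?w \<xi> * dirac_hat q \<xi>) y"
      unfolding ft_def
      by (subst Bochner_Integration.integral_add,
          (intro Bochner_Integration.integrable_add integrable_mult_right int)+,
          subst Bochner_Integration.integral_add,
          (intro integrable_mult_right int)+) (simp only: integral_mult_right_zero)
    finally show ?thesis unfolding ft_dirac by (simp add: algebra_simps)
  qed
  have "(LINT \<xi>|lborel. fhat W \<xi> * cnj (g \<xi>)) = 0"
  proof (rule pairing_eq_0_if_ft_vanishes_outside[OF W pq van])
    show "g \<in> borel_measurable borel" unfolding g_def by measurable
    show "integrable lborel (\<lambda>\<xi>. (1 + \<xi>\<^sup>2) * (norm (g \<xi>))\<^sup>2)"
      unfolding g_def by (rule weighted_L2_dual[OF D])
    fix y assume y: "y \<notin> {p<..<q}"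
    then consider "y \<le> p" | "q \<le> y" by fastforce
    then have "sinh (q - p) * exp (- \<bar>y - x\<bar>) - sinh (q - x) * exp (- \<bar>y - p\<bar>) - sinh (x - p) * exp (- \<bar>y - q\<bar>) = 0"
    proof cases
      case 1
      then have "exp (- \<bar>y - x\<bar>) = exp y * exp (- x)" "exp (- \<bar>y - p\<bar>) = exp y * exp (- p)"
        "exp (- \<bar>y - q\<bar>) = exp y * exp (- q)"
        using x pq by (auto simp flip: exp_add)
      then show ?thesis using arg_cong[OF sinh_exp_identity(1)[of q p x], of "\<lambda>z. exp y * z"]
        by (simp add: algebra_simps)
    next
      case 2
      then have "exp (- \<bar>y - x\<bar>) = exp (- y) * exp x" "exp (- \<bar>y - p\<bar>) = exp (- y) * exp p"
        "exp (- \<bar>y - q\<bar>) = exp (- y) * exp q"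
        using x pq by (auto simp flip: exp_add)
      then show ?thesis using arg_cong[OF sinh_exp_identity(2)[of q p x], of "\<lambda>z. exp (- y) * z"]
        by (simp add: algebra_simps)
    qed
    then show "ft g y = 0" unfolding ft_g by simp
  qed
  also have "(LINT \<xi>|lborel. fhat W \<xi> * cnj (g \<xi>)) =
      (LINT \<xi>|lborel. ?S * (?w \<xi> * fhat W \<xi> * cnj (dirac_hat x \<xi>)) + (- ?A) * (?w \<xi> * fhat W \<xi> * cnj (dirac_hat p \<xi>))
        + (- ?B) * (?w \<xi> * fhat W \<xi> * cnj (dirac_hat q \<xi>)))"
    unfolding g_def D_def by (rule Bochner_Integration.integral_cong) (auto simp: algebra_simps)
  also have "\<dots> = ?S * Hm1_inner W (dirac x) + (- ?A) * Hm1_inner W (dirac p) + (- ?B) * Hm1_inner W (dirac q)"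
    unfolding Hm1_inner_dirac_pairing[OF W]
    by (subst Bochner_Integration.integral_add,
        (intro Bochner_Integration.integrable_add integrable_mult_right weighted_L2_inner_integrable Hm1_weighted_L2[OF W] weighted_L2_dirac_hat)+,
        subst Bochner_Integration.integral_add,
        (intro integrable_mult_right weighted_L2_inner_integrable Hm1_weighted_L2[OF W] weighted_L2_dirac_hat)+)
       (simp only: integral_mult_right_zero)
  finally show ?thesis by (simp add: algebra_simps)
qed

lemma Hm1_inner_dirac_bounded:
  assumes "W \<in> Hm1"
  obtains M where "\<And>x. norm (Hm1_inner W (dirac x)) \<le> M"
proof
  show "norm (Hm1_inner W (dirac x)) \<le> norm (complex_of_real (1 / sqrt (2 * pi))) *
      (LINT \<xi>|lborel. norm (of_real (inverse (1 + \<xi>\<^sup>2)) * fhat W \<xi>))" for x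
    unfolding Hm1_inner_dirac[OF assms] norm_mult[of "of_real (1 / sqrt (2 * pi))"]
    by (intro mult_left_mono norm_ft_le) auto
qed

text \<open>Interpolation between b and a far point L loses its term at b and leaves sinh (x - b) /
  sinh (L - b) times the value at L, which stays bounded while the denominator grows.\<close>

lemma Hm1_inner_dirac_eq_0_right:
  assumes W: "W \<in> Hm1" and x: "b < x"
    and van: "\<And>L f. f \<in> test_functions {b<..<L} \<Longrightarrow> W f = 0"
    and b: "Hm1_inner W (dirac b) = 0"
  shows "Hm1_inner W (dirac x) = 0"
proof -
  obtain M where M: "\<And>x. norm (Hm1_inner W (dirac x)) \<le> M"
    using Hm1_inner_dirac_bounded[OF W] by blast
  have le: "norm (Hm1_inner W (dirac x)) \<le> sinh (x - b) * M / sinh (L - b)" if L: "x < L" for L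
  proof -
    have S: "0 < sinh (L - b)" "0 < sinh (x - b)" using x L by auto
    have "of_real (sinh (L - b)) * Hm1_inner W (dirac x) = of_real (sinh (x - b)) * Hm1_inner W (dirac L)"
      using Hm1_inner_dirac_interpolation[OF W _ _ _ van, of b L x] x L b by simp
    then have "norm (of_real (sinh (L - b)) * Hm1_inner W (dirac x)) = norm (of_real (sinh (x - b)) * Hm1_inner W (dirac L))"
      by (rule arg_cong)
    then have "sinh (L - b) * norm (Hm1_inner W (dirac x)) = sinh (x - b) * norm (Hm1_inner W (dirac L))"
      unfolding norm_mult norm_of_real using S by simp
    also have "\<dots> \<le> sinh (x - b) * M"
      using S by (intro mult_left_mono M) auto
    finally show ?thesis using S by (simp add: field_simps)
  qed
  have "((\<lambda>L. sinh (x - b) * M / sinh (L - b)) \<longlongrightarrow> 0) at_top"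
  proof (rule tendsto_divide_0[OF tendsto_const])
    have "filterlim (\<lambda>L::real. sinh (L - b)) at_top at_top"
      by (rule filterlim_compose[OF sinh_real_at_top]) real_asymp
    then show "filterlim (\<lambda>L::real. sinh (L - b)) at_infinity at_top"
      by (rule filterlim_at_top_imp_at_infinity)
  qed
  then have "norm (Hm1_inner W (dirac x)) \<le> 0"
    by (rule tendsto_lowerbound) (auto intro: eventually_mono[OF eventually_gt_at_top[of x]] le)
  then show ?thesis by simp
qed

text \<open>The mirror image, with the far endpoint tending to minus infinity.\<close>

lemma Hm1_inner_dirac_eq_0_left:
  assumes W: "W \<in> Hm1" and x: "x < a"
    and van: "\<And>L f. f \<in> test_functions {L<..<a} \<Longrightarrow> W f = 0"
    and a: "Hm1_inner W (dirac a) = 0"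
  shows "Hm1_inner W (dirac x) = 0"
proof -
  obtain M where M: "\<And>x. norm (Hm1_inner W (dirac x)) \<le> M"
    using Hm1_inner_dirac_bounded[OF W] by blast
  have le: "norm (Hm1_inner W (dirac x)) \<le> sinh (a - x) * M / sinh (a - L)" if L: "L < x" for L
  proof -
    have S: "0 < sinh (a - L)" "0 < sinh (a - x)" using x L by auto
    have "of_real (sinh (a - L)) * Hm1_inner W (dirac x) = of_real (sinh (a - x)) * Hm1_inner W (dirac L)"
      using Hm1_inner_dirac_interpolation[OF W _ _ _ van, of L a x] x L a by simp
    then have "norm (of_real (sinh (a - L)) * Hm1_inner W (dirac x)) = norm (of_real (sinh (a - x)) * Hm1_inner W (dirac L))"
      by (rule arg_cong)
    then have "sinh (a - L) * norm (Hm1_inner W (dirac x)) = sinh (a - x) * norm (Hm1_inner W (dirac L))"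
      unfolding norm_mult norm_of_real using S by simp
    also have "\<dots> \<le> sinh (a - x) * M"
      using S by (intro mult_left_mono M) auto
    finally show ?thesis using S by (simp add: field_simps)
  qed
  have "((\<lambda>L. sinh (a - x) * M / sinh (a - L)) \<longlongrightarrow> 0) at_bot"
  proof (rule tendsto_divide_0[OF tendsto_const])
    have "filterlim (\<lambda>L::real. sinh (a - L)) at_top at_bot"
      by (rule filterlim_compose[OF sinh_real_at_top]) real_asymp
    then show "filterlim (\<lambda>L::real. sinh (a - L)) at_infinity at_bot"
      by (rule filterlim_at_top_imp_at_infinity)
  qed
  then have "norm (Hm1_inner W (dirac x)) \<le> 0"
    by (rule tendsto_lowerbound) (auto intro: eventually_mono[OF eventually_gt_at_bot[of x]] le)
  then show ?thesis by simp
qed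

text \<open>\<open>right\<close> and \<open>left\<close> propagate the two zeros of the potential to
  every point off (a, b). The Riesz image of \<open>V\<close> then qualifies for pairing with any
  \<open>W\<close> supported off (a, b), and that pairing is the inner product.\<close>

lemma Hm1_orth_supp_compl:
  assumes ab: "a < b" and V: "V \<in> Hm1"
    and right: "\<And>L f. f \<in> test_functions {b<..<L} \<Longrightarrow> V f = 0"
    and left: "\<And>L f. f \<in> test_functions {L<..<a} \<Longrightarrow> V f = 0"
    and zero: "Hm1_inner V (dirac a) = 0" "Hm1_inner V (dirac b) = 0"
  shows "V \<in> Hm1_orth (Hm1_supp (- {a<..<b}))"
  unfolding Hm1_orth_def
proof (intro CollectI conjI ballI V)
  fix W assume "W \<in> Hm1_supp (- {a<..<b})"
  then have W: "W \<in> Hm1" "supp W \<subseteq> - {a<..<b}" by (auto simp: Hm1_supp_def)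
  have [measurable]: "fhat V \<in> borel_measurable borel" using V by (rule Hm1_measurable)
  have v: "Hm1_inner V (dirac y) = 0" if "y \<notin> {a<..<b}" for y
    using that zero Hm1_inner_dirac_eq_0_right[OF V _ right zero(2), of y]
      Hm1_inner_dirac_eq_0_left[OF V _ left zero(1), of y]
    by (cases "y = a"; cases "y = b") fastforce+
  let ?g = "\<lambda>\<xi>. of_real (inverse (1 + \<xi>\<^sup>2)) * fhat V \<xi>"
  have "(LINT \<xi>|lborel. fhat W \<xi> * cnj (?g \<xi>)) = 0"
  proof (rule pairing_eq_0_if_ft_vanishes_outside[OF W(1) ab])
    show "W f = 0" if "f \<in> test_functions {a<..<b}" for f
      by (rule vanishes_off_supp'[OF Hm1_tempered[OF W(1)] W(2) that]) auto
    show "?g \<in> borel_measurable borel" by measurable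
    show "integrable lborel (\<lambda>\<xi>. (1 + \<xi>\<^sup>2) * (norm (?g \<xi>))\<^sup>2)"
      by (rule weighted_L2_dual[OF Hm1_weighted_L2[OF V]])
    show "ft ?g y = 0" if "y \<notin> {a<..<b}" for y
      using v[OF that] unfolding Hm1_inner_dirac[OF V] by simp
  qed
  then have "Hm1_inner W V = 0"
    unfolding Hm1_inner_def by (simp add: mult_ac)
  then show "Hm1_inner V W = 0"
    using Hm1_inner_cnj[of V W] by simp
qed

section \<open>Deltas at the endpoints and orthogonal projections\<close>

lemma dirac_eq_0_test: "f \<in> test_functions S \<Longrightarrow> x \<notin> S \<Longrightarrow> dirac x f = 0"
  by (auto simp: test_functions_iff dirac_def)

lemma supp_subset_if_vanishes:
  assumes "open V" "\<And>f. f \<in> test_functions V \<Longrightarrow> u f = 0"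
  shows "supp u \<subseteq> - V"
  using assms by (auto simp: supp_def)

text \<open>Applied to the endpoints and the complement of the open interval, this puts both deltas
  into the space that the projection removes.\<close>

lemma dirac_Hm1_supp: "x \<in> F \<Longrightarrow> closed F \<Longrightarrow> dirac x \<in> Hm1_supp F"
  using supp_subset_if_vanishes[of "- F" "dirac x"]
  by (auto simp: Hm1_supp_def dirac_Hm1 dirac_eq_0_test)

text \<open>\<open>Qm1\<close> is a definite description, so exhibiting a projection determines it
  only together with uniqueness. The difference of two candidates lies in \<open>N\<close> and is
  orthogonal to \<open>N\<close>, hence to itself.\<close>

lemma is_orth_proj_unique:
  assumes u: "u \<in> Hm1" and N: "N \<subseteq> Hm1" "\<And>v w. v \<in> N \<Longrightarrow> w \<in> N \<Longrightarrow> (\<lambda>f. v f - w f) \<in> N"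
    and v: "is_orth_proj N u v" and w: "is_orth_proj N u w"
  shows "v = w"
proof -
  let ?d = "\<lambda>f. v f - w f"
  have vw: "v \<in> N" "w \<in> N" "v \<in> Hm1" "w \<in> Hm1" using v w N by (auto simp: is_orth_proj_def)
  have d: "?d \<in> N" "?d \<in> Hm1" using N vw by auto
  have "Hm1_inner u ?d - Hm1_inner v ?d = 0" "Hm1_inner u ?d - Hm1_inner w ?d = 0"
    using v w d u vw by (auto simp: is_orth_proj_def Hm1_inner_diff[symmetric])
  then have "Hm1_inner ?d ?d = 0"
    using Hm1_inner_diff[OF vw(3,4) d(2)] by simp
  then have "?d = (\<lambda>f. 0)"
    using Hm1_inner_self[OF d(2)] Hm1_norm_eq_0[OF d(2)] by simp
  then show ?thesis by (metis eq_iff_diff_eq_0 ext)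
qed

lemma Hm1_orth_diff:
  assumes "M \<subseteq> Hm1" "v \<in> Hm1_orth M" "w \<in> Hm1_orth M"
  shows "(\<lambda>f. v f - w f) \<in> Hm1_orth M"
  using assms unfolding Hm1_orth_def by (auto simp: Hm1_diff Hm1_inner_diff subset_iff)

lemma Hm1_pythagoras:
  assumes u: "u \<in> Hm1" and v: "v \<in> Hm1" and orth: "Hm1_inner v (\<lambda>f. u f - v f) = 0"
  shows "(Hm1_norm u)\<^sup>2 = (Hm1_norm v)\<^sup>2 + (Hm1_norm (\<lambda>f. u f - v f))\<^sup>2"
proof -
  let ?d = "\<lambda>f. u f - v f"
  have d: "?d \<in> Hm1" by (rule Hm1_diff[OF u v])
  have du: "Hm1_inner u w = Hm1_inner v w + Hm1_inner ?d w" if "w \<in> Hm1" for w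
    using Hm1_inner_diff[OF u v that] by simp
  have orth': "Hm1_inner ?d v = 0"
    using Hm1_inner_cnj[of ?d v] orth by simp
  have "Hm1_inner u u = Hm1_inner v u + Hm1_inner ?d u" by (rule du[OF u])
  also have "Hm1_inner v u = cnj (Hm1_inner u v)" by (rule Hm1_inner_cnj)
  also have "Hm1_inner ?d u = cnj (Hm1_inner u ?d)" by (rule Hm1_inner_cnj)
  finally have "Hm1_inner u u = Hm1_inner v v + Hm1_inner ?d ?d"
    unfolding du[OF v] du[OF d] using orth orth' by (simp add: Hm1_inner_self v d)
  then have "complex_of_real ((Hm1_norm u)\<^sup>2) = of_real ((Hm1_norm v)\<^sup>2 + (Hm1_norm ?d)\<^sup>2)"
    by (simp add: Hm1_inner_self u v d)
  then show ?thesis unfolding of_real_eq_iff .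
qed

theorem mainTheorem6:
  fixes a b :: real
    and U :: "(real \<Rightarrow> complex) \<Rightarrow> complex"
    and \<Omega> :: "real set"
    and c\<^sub>a c\<^sub>b :: complex
  assumes "a < b"
    and "\<Omega> = {a<..<b}"
    and "U \<in> Hm1_supp (closure \<Omega>)"
    and "c\<^sub>a = (Hm1_inner U (dirac b) - of_real (exp (b - a)) * Hm1_inner U (dirac a))
                / of_real (sinh (b - a))"
    and "c\<^sub>b = (Hm1_inner U (dirac a) - of_real (exp (b - a)) * Hm1_inner U (dirac b))
                / of_real (sinh (b - a))"
  shows "is_orth_proj (Hm1_orth (Hm1_supp (- \<Omega>))) U (Qm1 \<Omega> U)
    \<and> is_min_norm_extension \<Omega> (restrict_dist \<Omega> U) (Qm1 \<Omega> U)
    \<and> Qm1 \<Omega> U = (\<lambda>f. U f + c\<^sub>a * dirac a f + c\<^sub>b * dirac b f)"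
proof -
  note ab = assms(1) and \<Omega> = assms(2)
  define N where "N = Hm1_orth (Hm1_supp (- \<Omega>))"
  define V where "V = (\<lambda>f. U f + c\<^sub>a * dirac a f + c\<^sub>b * dirac b f)"
  have U: "U \<in> Hm1" "supp U \<subseteq> {a..b}"
    using assms(3) ab by (auto simp: Hm1_supp_def \<Omega>)
  have Ua: "(\<lambda>f. U f + c\<^sub>a * dirac a f) \<in> Hm1" by (rule Hm1_lincomb[OF U(1) dirac_Hm1])
  have V: "V \<in> Hm1" unfolding V_def by (rule Hm1_lincomb[OF Ua dirac_Hm1])
  have V_inner: "Hm1_inner V w = Hm1_inner U w + c\<^sub>a * Hm1_inner (dirac a) w + c\<^sub>b * Hm1_inner (dirac b) w"
    if "w \<in> Hm1" for w
    unfolding V_def Hm1_inner_lincomb[OF Ua dirac_Hm1 that] Hm1_inner_lincomb[OF U(1) dirac_Hm1 that] ..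
  define A B where "A = Hm1_inner U (dirac a)" and "B = Hm1_inner U (dirac b)"
  \<comment> \<open>In terms of \<open>E\<close>, exp (- (b - a)) is 1 / E and sinh (b - a) is (E -
    1 / E) / 2, so the vanishing at the endpoints becomes a rational identity.\<close>
  define E where "E = complex_of_real (exp (b - a))"
  have E0: "E \<noteq> 0" by (simp add: E_def)
  have "complex_of_real (exp (- (b - a))) = inverse E"
    by (simp only: exp_minus E_def of_real_inverse)
  then have exp_ab: "complex_of_real (exp (a - b)) = inverse E" by simp
  have S: "complex_of_real (sinh (b - a)) = (E - inverse E) / 2"
    using exp_ab by (simp add: sinh_def E_def[symmetric] scaleR_conv_of_real)
  have S0: "E - inverse E \<noteq> 0"
    using ab S by auto
  have E': "complex_of_real (exp (- \<bar>b - a\<bar>)) = inverse E"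
     "complex_of_real (exp (- \<bar>a - b\<bar>)) = inverse E"
    using ab exp_ab by simp_all
  \<comment> \<open>These values solve A + c_a / 2 + c_b / (2 E) = 0 and B + c_a / (2 E) + c_b / 2 =
    0, the conditions that the potential of \<open>V\<close> vanishes at a and at b.\<close>
  have ca: "c\<^sub>a = 2 * (B - E * A) / (E - inverse E)" and cb: "c\<^sub>b = 2 * (A - E * B) / (E - inverse E)"
    unfolding assms(4,5) S by (simp_all add: A_def B_def E_def)
  have "Hm1_inner V (dirac a) = A + c\<^sub>a / 2 + c\<^sub>b * (inverse E / 2)"
    unfolding V_inner[OF dirac_Hm1] Hm1_inner_dirac_dirac A_def[symmetric] of_real_divide E' by simp
  also have "\<dots> = 0"
    unfolding ca cb using E0 S0 by (simp add: field_simps)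
  finally have Va: "Hm1_inner V (dirac a) = 0" .
  have "Hm1_inner V (dirac b) = B + c\<^sub>a * (inverse E / 2) + c\<^sub>b / 2"
    unfolding V_inner[OF dirac_Hm1] Hm1_inner_dirac_dirac B_def[symmetric] of_real_divide E' by simp
  also have "\<dots> = 0"
    unfolding ca cb using E0 S0 by (simp add: field_simps)
  finally have Vb: "Hm1_inner V (dirac b) = 0" .
  have V0: "V f = 0" if "f \<in> test_functions T" "T \<inter> {a..b} = {}" for f T
  proof -
    have "a \<notin> T" "b \<notin> T" using that(2) ab by auto
    then show ?thesis
      using vanishes_off_supp'[OF Hm1_tempered[OF U(1)] U(2) that] that(1)
      by (simp add: V_def dirac_eq_0_test)
  qed
  have VN: "V \<in> N"
    unfolding N_def \<Omega> by (rule Hm1_orth_supp_compl[OF ab V _ _ Va Vb]) (erule V0, force)+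
  \<comment> \<open>U - V is a combination of the two deltas, so orthogonality of the deltas to
    \<open>N\<close> is exactly what the projection property asks for.\<close>
  have dN: "Hm1_inner (dirac x) w = 0" if "w \<in> N" "x \<in> {a, b}" for x w
  proof -
    have "dirac x \<in> Hm1_supp (- \<Omega>)" using that(2) by (intro dirac_Hm1_supp) (auto simp: \<Omega>)
    then have "Hm1_inner w (dirac x) = 0" using that(1) by (simp add: N_def Hm1_orth_def)
    then show ?thesis using Hm1_inner_cnj[of "dirac x" w] by simp
  qed
  have proj: "is_orth_proj N U V"
    unfolding is_orth_proj_def
  proof (intro conjI VN ballI)
    fix w assume w: "w \<in> N"
    then have wH: "w \<in> Hm1" by (simp add: N_def Hm1_orth_def)
    show "Hm1_inner (\<lambda>f. U f - V f) w = 0"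
      using dN[OF w] by (simp add: Hm1_inner_diff[OF U(1) V wH] V_inner[OF wH])
  qed
  have supp_sub: "Hm1_supp (- \<Omega>) \<subseteq> Hm1" by (auto simp: Hm1_supp_def)
  have N_sub: "N \<subseteq> Hm1" by (auto simp: N_def Hm1_orth_def)
  have Q: "Qm1 \<Omega> U = V"
    unfolding Qm1_def N_def[symmetric]
  proof (rule the_equality[of "is_orth_proj N U", OF proj])
    show "v = V" if "is_orth_proj N U v" for v
      by (rule is_orth_proj_unique[OF U(1) N_sub _ that proj])
         (auto simp: N_def intro: Hm1_orth_diff[OF supp_sub])
  qed
  have "is_min_norm_extension \<Omega> (restrict_dist \<Omega> U) V"
    unfolding is_min_norm_extension_def
  proof (intro conjI ballI impI V)
    \<comment> \<open>The deltas sit at the endpoints, outside the open interval, and are invisible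
      to test functions on \<open>\<Omega>\<close>.\<close>
    show rest: "restrict_dist \<Omega> V = restrict_dist \<Omega> U"
      by (auto simp: restrict_dist_def V_def dirac_eq_0_test \<Omega>)
    fix w assume w: "w \<in> Hm1" and "restrict_dist \<Omega> w = restrict_dist \<Omega> U \<and> w \<noteq> V"
    then have eq: "restrict_dist \<Omega> w = restrict_dist \<Omega> V" and ne: "w \<noteq> V" using rest by auto
    let ?d = "\<lambda>f. w f - V f"
    have d: "?d \<in> Hm1" by (rule Hm1_diff[OF w V])
    \<comment> \<open>A competitor differs from \<open>V\<close> by a functional supported off
      \<open>\<Omega>\<close>, to which \<open>V\<close> is orthogonal. Pythagoras gives minimality,
      and it is strict because a nonzero difference has nonzero norm.\<close>
    have "supp ?d \<subseteq> - \<Omega>"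
    proof (rule supp_subset_if_vanishes)
      show "?d f = 0" if "f \<in> test_functions \<Omega>" for f
        using fun_cong[OF eq, of f] that by (simp add: restrict_dist_def)
    qed (simp add: \<Omega>)
    then have "Hm1_inner V ?d = 0"
      using VN d by (simp add: N_def Hm1_orth_def Hm1_supp_def)
    then have "(Hm1_norm w)\<^sup>2 = (Hm1_norm V)\<^sup>2 + (Hm1_norm ?d)\<^sup>2"
      by (rule Hm1_pythagoras[OF w V])
    moreover have "Hm1_norm ?d \<noteq> 0"
      using Hm1_norm_eq_0[OF d] ne by (metis eq_iff_diff_eq_0 ext)
    ultimately have "(Hm1_norm V)\<^sup>2 < (Hm1_norm w)\<^sup>2" by simp
    then show "Hm1_norm V < Hm1_norm w"
      by (rule power_less_imp_less_base) (rule Hm1_norm_nonneg)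
  qed
  with proj show ?thesis unfolding Q N_def[symmetric] V_def[symmetric] by blast
qed

end
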